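(* Let $K$ be a field, $S=K[t_1,\dots,t_s]$, and let $(0)\ne I\subset S$ be a Geramita ideal. Then $I$ is Cayley–Bacharach if and only if $$\mathrm{reg}(\delta_I)=\mathrm v(I)=\mathrm{reg}(S/I).$$
   Context: $S=\bigoplus_{d\ge0}S_d$ has the standard grading; $K$ is arbitrary. A Geramita ideal is a graded ideal $I\subsetneq S$ that is unmixed (all its associated primes have the same height), with $\dim(S/I)=1$, and all of whose associated primes are generated by linear forms. $\mathrm{reg}(S/I)$ is the Castelnuovo–Mumford regularity. v-numbers: for $\mathfrak p\in\mathrm{Ass}(S/I)$, $\mathrm v_{\mathfrak p}(I)=\min\{d\ge1 : \exists f\in S_d\text{ with }(I:f)=\mathfrak p\}$, and $\mathrm v(I)=\min\{\mathrm v_{\mathfrak p}(I):\mathfrak p\in\mathrm{Ass}(S/I)\}$. A Geramita ideal $I$ is Cayley–Bacharach if $\mathrm v_{\mathfrak p}(I)=\mathrm{reg}(S/I)$ for all $\mathfrak p\in\mathrm{Ass}(S/I)$. With $H_I(d)=\dim_K(S_d/I_d)$ and $k=\dim(S/I)$, $\deg(S/I)=(k-1)!\lim_{d\to\infty}H_I(d)/d^{k-1}$ if $k\ge1$ and $\dim_K(S/I)$ if $k=0$. For $d\ge1$ let $\mathcal F_d$ be the set of $f\in S_d\setminus I$ with $(I:f)\ne I$; $\delta_I(d)=\deg(S/I)-\max\{\deg(S/(I,f)): f\in\mathcal F_d\}$ if $\mathcal F_d\neq\emptyset$, and $\delta_I(d)=\deg(S/I)$ if $\mathcal F_d=\emptyset$.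 $\mathrm{reg}(\delta_I)$ is the smallest $d\ge1$ with $\delta_I(d)=1$; if $I$ is prime, $\mathrm{reg}(\delta_I)=1$ by convention. *)

theory Defs
  imports
    Complex_Main
    "HOL-Library.Extended_Nat"
    "HOL-Library.Poly_Mapping"
    "Jordan_Normal_Form.Matrix_Kernel"
begin

text \<open>
  The polynomial ring \<open>S = K[t\<^sub>1,\<dots>,t\<^sub>s]\<close> is the monoid algebra of \<open>'n \<Rightarrow>\<^sub>0 nat\<close> over
  \<open>'k\<close>, where the finite type \<open>'n\<close> indexes the variables, so that \<open>s = CARD('n)\<close>.
  Ideals of \<open>S\<close> are the submodules of \<open>S\<close> over itself, i.e. \<open>idl.subspace\<close> below,
  and \<open>idl.span A\<close> is the ideal generated by \<open>A\<close>.
\<close>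

type_synonym ('n, 'k) mpoly = "('n \<Rightarrow>\<^sub>0 nat) \<Rightarrow>\<^sub>0 'k"

interpretation idl: Modules.module "(*) :: 'a::comm_ring_1 \<Rightarrow> 'a \<Rightarrow> 'a"
  by unfold_locales (simp_all add: algebra_simps)

definition scale :: "'k \<Rightarrow> ('n, 'k::field) mpoly \<Rightarrow> ('n, 'k) mpoly" where
  "scale c f = Poly_Mapping.single 0 c * f"

interpretation S: Vector_Spaces.vector_space "scale :: 'k::field \<Rightarrow> ('n, 'k) mpoly \<Rightarrow> ('n, 'k) mpoly"
proof
  fix a b :: 'k and x y :: "('n, 'k) mpoly"
  show "scale a (x + y) = scale a x + scale a y"
    by (simp add: scale_def distrib_left)
  show "scale (a + b) x = scale a x + scale b x"
    by (simp add: scale_def single_add distrib_right)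
  show "scale a (scale b x) = scale (a * b) x"
    by (simp add: scale_def mult_single flip: mult.assoc)
  show "scale 1 x = x"
    by (simp add: scale_def)
qed


section \<open>Grading\<close>

definition mdeg :: "('n::finite \<Rightarrow>\<^sub>0 nat) \<Rightarrow> nat" where
  "mdeg m = (\<Sum>i\<in>UNIV. Poly_Mapping.lookup m i)"

definition graded_part :: "nat \<Rightarrow> ('n::finite, 'k::field) mpoly set" where
  "graded_part d = {f. \<forall>m \<in> Poly_Mapping.keys f. mdeg m = d}"

definition graded_ideal :: "('n::finite, 'k::field) mpoly set \<Rightarrow> bool" where
  "graded_ideal I \<longleftrightarrow> idl.subspace I \<and> I = idl.span (\<Union>d. I \<inter> graded_part d)"


section \<open>Prime ideals, dimension and associated primes\<close>

definition prime_ideal :: "'a::comm_ring_1 set \<Rightarrow> bool" where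
  "prime_ideal P \<longleftrightarrow> idl.subspace P \<and> P \<noteq> UNIV \<and> (\<forall>a b. a * b \<in> P \<longrightarrow> a \<in> P \<or> b \<in> P)"

definition prime_chain :: "nat \<Rightarrow> (nat \<Rightarrow> 'a::comm_ring_1 set) \<Rightarrow> bool" where
  "prime_chain n P \<longleftrightarrow> (\<forall>i\<le>n. prime_ideal (P i)) \<and> (\<forall>i<n. P i \<subset> P (Suc i))"

definition height :: "'a::comm_ring_1 set \<Rightarrow> enat" where
  "height \<pp> = Sup {enat n | n P. prime_chain n P \<and> P n = \<pp>}"

text \<open>
  Krull dimension of the quotient by \<open>I\<close>; the prime ideals of the quotient are
  the prime ideals containing \<open>I\<close>. The zero ring gets dimension \<open>0\<close> here.
\<close>

definition quot_krull_dim :: "'a::comm_ring_1 set \<Rightarrow> enat" where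
  "quot_krull_dim I = Sup {enat n | n P. prime_chain n P \<and> I \<subseteq> P 0}"

definition colon :: "'a::comm_ring_1 set \<Rightarrow> 'a \<Rightarrow> 'a set" where
  "colon I f = {g. g * f \<in> I}"

text \<open>\<open>colon I f\<close> is the annihilator of the class of \<open>f\<close> in the quotient by \<open>I\<close>.\<close>

definition Ass :: "'a::comm_ring_1 set \<Rightarrow> 'a set set" where
  "Ass I = {\<pp>. prime_ideal \<pp> \<and> (\<exists>f. \<pp> = colon I f)}"

definition unmixed :: "'a::comm_ring_1 set \<Rightarrow> bool" where
  "unmixed I \<longleftrightarrow> (\<exists>h. \<forall>\<pp>\<in>Ass I. height \<pp> = h)"

definition geramita :: "('n::finite, 'k::field) mpoly set \<Rightarrow> bool" where
  "geramita I \<longleftrightarrow>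
     graded_ideal I \<and> I \<noteq> UNIV \<and> unmixed I \<and> quot_krull_dim I = 1 \<and>
     (\<forall>\<pp>\<in>Ass I. \<exists>L \<subseteq> graded_part 1. \<pp> = idl.span L)"


section \<open>Castelnuovo--Mumford regularity\<close>

text \<open>
  A minimal graded free resolution
  \<open>\<dots> \<longrightarrow> F\<^sub>2 \<longrightarrow> F\<^sub>1 \<longrightarrow> F\<^sub>0 = S \<longrightarrow> S/I \<longrightarrow> 0\<close>
  with \<open>F\<^sub>i\<close> the direct sum of the \<open>S(-a i k)\<close> for \<open>k < r i\<close>, and \<open>M i\<close> the matrix of
  the map from the \<open>(i+1)\<close>st to the \<open>i\<close>th free module. Minimality says that all
  matrix entries lie in the ideal generated by the variables. The length is not
  bounded a priori; resolutions of finite length are those with \<open>r i = 0\<close> for large \<open>i\<close>.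
\<close>

definition minimal_graded_free_resolution ::
  "('n::finite, 'k::field) mpoly set \<Rightarrow> (nat \<Rightarrow> nat) \<Rightarrow> (nat \<Rightarrow> nat \<Rightarrow> int) \<Rightarrow>
   (nat \<Rightarrow> ('n, 'k) mpoly mat) \<Rightarrow> bool" where
  "minimal_graded_free_resolution I r a M \<longleftrightarrow>
     r 0 = 1 \<and> a 0 0 = 0 \<and>
     (\<forall>i. M i \<in> carrier_mat (r i) (r (Suc i))) \<and>
     (\<forall>i. \<forall>l < r i. \<forall>k < r (Suc i). \<forall>m \<in> Poly_Mapping.keys (M i $$ (l, k)).
        a i l + int (mdeg m) = a (Suc i) k) \<and>
     {(M 0 *\<^sub>v v) $ 0 | v. v \<in> carrier_vec (r 1)} = I \<and>
     (\<forall>i. {M (Suc i) *\<^sub>v v | v. v \<in> carrier_vec (r (Suc (Suc i)))} = mat_kernel (M i)) \<and>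
     (\<forall>i. \<forall>l < r i. \<forall>k < r (Suc i). Poly_Mapping.lookup (M i $$ (l, k)) 0 = 0)"

text \<open>
  The regularity of \<open>S/I\<close> is the maximum of \<open>j - i\<close> over the nonzero graded Betti
  numbers \<open>b\<^sub>i\<^sub>j\<close>, the number of summands \<open>S(-j)\<close> of \<open>F\<^sub>i\<close>. It does not depend on the
  resolution chosen, since minimal graded free resolutions are unique up to isomorphism.
\<close>

definition cm_reg :: "('n::finite, 'k::field) mpoly set \<Rightarrow> int" where
  "cm_reg I = (THE \<rho>. \<exists>r a M. minimal_graded_free_resolution I r a M \<and>
     \<rho> = Max {a i k - int i | i k. k < r i})"


section \<open>v-numbers\<close>

definition v_at :: "('n::finite, 'k::field) mpoly set \<Rightarrow> ('n, 'k) mpoly set \<Rightarrow> nat" where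
  "v_at \<pp> I = (LEAST d. d \<ge> 1 \<and> (\<exists>f\<in>graded_part d. colon I f = \<pp>))"

definition v_number :: "('n::finite, 'k::field) mpoly set \<Rightarrow> nat" where
  "v_number I = Min {v_at \<pp> I | \<pp>. \<pp> \<in> Ass I}"

definition cayley_bacharach :: "('n::finite, 'k::field) mpoly set \<Rightarrow> bool" where
  "cayley_bacharach I \<longleftrightarrow> geramita I \<and> (\<forall>\<pp>\<in>Ass I. int (v_at \<pp> I) = cm_reg I)"


section \<open>Degree and minimum distance function\<close>

text \<open>
  \<open>K\<close>-dimension of \<open>V/W\<close> for subspaces \<open>W \<subseteq> V\<close>: the classes of the elements of \<open>B\<close> are
  pairwise distinct and form a basis of \<open>V/W\<close>. The value is \<open>0\<close> if \<open>V/W\<close> is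
  infinite-dimensional.
\<close>

definition quot_dim :: "('n, 'k::field) mpoly set \<Rightarrow> ('n, 'k) mpoly set \<Rightarrow> nat" where
  "quot_dim V W = (THE n. \<exists>B \<subseteq> V. S.independent B \<and> S.span B \<inter> W = {0} \<and>
     V \<subseteq> S.span (B \<union> W) \<and> n = card B)"

definition hilbert_function :: "('n::finite, 'k::field) mpoly set \<Rightarrow> nat \<Rightarrow> nat" where
  "hilbert_function I d = quot_dim (graded_part d) (I \<inter> graded_part d)"

definition quot_degree :: "('n::finite, 'k::field) mpoly set \<Rightarrow> real" where
  "quot_degree I = (let k = the_enat (quot_krull_dim I) in
     if k \<ge> 1 then fact (k - 1) * lim (\<lambda>d. real (hilbert_function I d) / real d ^ (k - 1))
     else real (quot_dim UNIV I))"

definition zero_div_forms :: "('n::finite, 'k::field) mpoly set \<Rightarrow> nat \<Rightarrow> ('n, 'k) mpoly set" where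
  "zero_div_forms I d = {f \<in> graded_part d - I. colon I f \<noteq> I}"

definition min_dist :: "('n::finite, 'k::field) mpoly set \<Rightarrow> nat \<Rightarrow> real" where
  "min_dist I d =
     (if zero_div_forms I d \<noteq> {}
      then quot_degree I - Max {quot_degree (idl.span (insert f I)) | f. f \<in> zero_div_forms I d}
      else quot_degree I)"

definition reg_min_dist :: "('n::finite, 'k::field) mpoly set \<Rightarrow> nat" where
  "reg_min_dist I = (if prime_ideal I then 1 else (LEAST d. d \<ge> 1 \<and> min_dist I d = 1))"

end

theory Submission
  imports Defs "HOL-Computational_Algebra.Polynomial" "HOL-Library.Function_Algebras" "HOL-Library.Product_Plus"
begin

text \<open>
  A Geramita ideal is the ideal of finitely many, possibly fat, points: every associated
  prime is the ideal of a line \<open>K a\<close>, and \<open>S/I\<close> has depth one.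

  For a zero divisor \<open>f\<close> of degree \<open>d\<close> the exact sequence
  \<open>0 \<longrightarrow> (S/(I : f))(-d) \<longrightarrow> S/I \<longrightarrow> S/(I, f) \<longrightarrow> 0\<close> gives
  \<open>deg S/(I, f) = deg S/I - deg S/(I : f)\<close>, and \<open>deg S/(I : f) = 1\<close> exactly when \<open>I : f\<close>
  is an associated prime. So \<open>reg \<delta> = v(I)\<close> for every Geramita ideal, and the equivalence
  reduces to \<open>v_at p I \<le> reg (S/I)\<close> for all \<open>p\<close>, unless \<open>I\<close> is prime, where there is only one \<open>p\<close>.

  Take a form \<open>h\<close> of degree \<open>e\<close> outside all associated primes and let \<open>t\<close> be the top degree of the
  Artinian ring \<open>S/(I, h)\<close>. Then \<open>reg (S/I) = t - e + 1\<close>. An \<open>f\<close> of least degree \<open>d\<close> in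
  \<open>(I : p) - I\<close> has a multiple of degree \<open>d + e - 1\<close> outside \<open>(I, h)\<close>: otherwise, dividing by \<open>h\<close>,
  either \<open>I : p\<close> would contain an element of smaller degree or \<open>f\<close> would be annihilated by
  all forms of degree \<open>e - 1\<close>. Hence \<open>d + e - 1 \<le> t\<close>.
\<close>


text \<open>The obstacle is the arbitrary field. Over a small finite field there may be no linear
  form outside all associated primes, so the regularity cannot simply be read off as the top degree
  modulo such a form. A form \<open>h\<close> of degree \<open>e\<close> exists once
  \<open>e\<close> is at least the number of primes, and the mapping cone of \<open>h\<close> on a
  minimal resolution is again minimal. Filtering the cone by the ideals of the first
  \<open>k\<close> variables carries the top degree of \<open>S/(I, h)\<close> to the generators of
  the resolution; the summand shifted by \<open>e\<close> in degree and by one in index turns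
  \<open>t\<close> into \<open>t - e + 1\<close>. The freedom in \<open>e\<close> pays a second
  time: comparing \<open>e\<close> and \<open>e + 1\<close> shows that Hilbert functions become
  constant. The prime case is exceptional because v-numbers count only degrees at least 1: for the
  ideal of a single line \<open>v(I) = 1\<close> although \<open>reg(S/I) = 0\<close>. Regularity is
  a definite description over minimal resolutions of a priori unbounded length, so their existence,
  the independence of the choice and the finiteness of the set below \<open>Max\<close> all have to
  be settled.\<close>

abbreviation lookup where "lookup \<equiv> Poly_Mapping.lookup"
abbreviation keys where "keys \<equiv> Poly_Mapping.keys"
abbreviation single where "single \<equiv> Poly_Mapping.single"

text \<open>As a simplification rule this fact of the interpretation loops with associativity.\<close>

declare idl.scale_scale [simp del]

section \<open>Homogeneous components\<close>

lemma mpoly_as_sum: "f = (\<Sum>m\<in>keys f. single m (lookup f m))"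
  by (rule poly_mapping_eqI) (auto simp: lookup_sum lookup_single when_def not_in_keys_iff_lookup_eq_zero)

lemma mpoly_induct [case_names zero single add]:
  assumes "P 0" "\<And>m c. P (single m c)" "\<And>f g. P f \<Longrightarrow> P g \<Longrightarrow> P (f + g)"
  shows "P (f :: 'a \<Rightarrow>\<^sub>0 'b::comm_monoid_add)"
proof -
  have "P (\<Sum>m\<in>A. single m (lookup f m))" if "finite A" for A
    using that by induction (auto intro: assms)
  then show ?thesis
    by (subst mpoly_as_sum) simp
qed

lemma mdeg_add [simp]: "mdeg (m + m') = mdeg m + mdeg m'"
  by (simp add: mdeg_def lookup_add sum.distrib)

lemma mdeg_zero [simp]: "mdeg 0 = 0"
  by (simp add: mdeg_def)

lemma mdeg_eq_0_iff [simp]: "mdeg m = 0 \<longleftrightarrow> m = 0"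
  by (auto simp: mdeg_def poly_mapping_eq_iff fun_eq_iff)

lemma mdeg_single [simp]: "mdeg (single i n) = n"
  by (simp add: mdeg_def lookup_single when_def)

lemma inj_lookup: "inj_on lookup A"
  by (metis inj_onI poly_mapping_eq_iff)

lemma lookup_mdeg_le: "lookup ` {m :: 'n::finite \<Rightarrow>\<^sub>0 nat. mdeg m \<le> d} \<subseteq> PiE UNIV (\<lambda>_. {..d})"
proof -
  have le: "lookup m i \<le> mdeg m" for m :: "'n \<Rightarrow>\<^sub>0 nat" and i
    unfolding mdeg_def by (rule member_le_sum) auto
  show ?thesis by (auto simp: PiE_UNIV_domain intro: order_trans[OF le])
qed

lemma finite_mdeg_le: "finite {m :: 'n::finite \<Rightarrow>\<^sub>0 nat. mdeg m \<le> d}"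
  by (rule finite_imageD[OF finite_subset[OF lookup_mdeg_le] inj_lookup]) (auto intro: finite_PiE)

text \<open>Degrees are integers here, unlike in \<open>graded_part\<close>, so that twists
  \<open>z - a k\<close> may become negative without truncation; the pieces of negative degree are
  zero.\<close>

definition hpart :: "int \<Rightarrow> ('n::finite, 'k::field) mpoly set" where
  "hpart z = {f. \<forall>m \<in> keys f. int (mdeg m) = z}"

definition hcomp :: "int \<Rightarrow> ('n::finite, 'k::field) mpoly \<Rightarrow> ('n, 'k) mpoly" where
  "hcomp z f = (\<Sum>m\<in>{m \<in> keys f. int (mdeg m) = z}. single m (lookup f m))"

lemma graded_part_eq: "graded_part d = hpart (int d)"
  by (auto simp: graded_part_def hpart_def)

lemma lookup_hcomp: "lookup (hcomp z f) m = (if int (mdeg m) = z then lookup f m else 0)"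
  by (auto simp: hcomp_def lookup_sum lookup_single when_def not_in_keys_iff_lookup_eq_zero)

lemma hpart_iff: "f \<in> hpart z \<longleftrightarrow> (\<forall>m. lookup f m \<noteq> 0 \<longrightarrow> int (mdeg m) = z)"
  by (auto simp: hpart_def in_keys_iff)

lemma hpart_zero [simp]: "0 \<in> hpart z"
  by (simp add: hpart_def)

lemma hpart_add: "f \<in> hpart z \<Longrightarrow> g \<in> hpart z \<Longrightarrow> f + g \<in> hpart z"
  unfolding hpart_iff lookup_add by (metis add_0)

lemma hpart_uminus: "f \<in> hpart z \<Longrightarrow> - f \<in> hpart z"
  by (simp add: hpart_iff)

lemma hpart_diff: "f \<in> hpart z \<Longrightarrow> g \<in> hpart z \<Longrightarrow> f - g \<in> hpart z"
  using hpart_add[OF _ hpart_uminus, of f z g] by simp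

lemma hpart_sum: "(\<And>i. i \<in> A \<Longrightarrow> f i \<in> hpart z) \<Longrightarrow> sum f A \<in> hpart z"
  by (induction A rule: infinite_finite_induct) (auto intro: hpart_add)

lemma hpart_mult: "f \<in> hpart y \<Longrightarrow> g \<in> hpart z \<Longrightarrow> f * g \<in> hpart (y + z)"
  using keys_mult[of f g] by (force simp: hpart_def)

lemma hpart_single: "single m c \<in> hpart (int (mdeg m))"
  by (simp add: hpart_iff lookup_single when_def)

lemma hpart_one [simp]: "1 \<in> hpart 0"
  using hpart_single[of 0 1] by simp

lemma hpart_neg: "z < 0 \<Longrightarrow> f \<in> hpart z \<Longrightarrow> f = 0"
  by (rule poly_mapping_eqI) (force simp: hpart_iff)

lemma hpart_mult_graded: "f \<in> hpart y \<Longrightarrow> g \<in> hpart z \<Longrightarrow> y + z = w \<Longrightarrow> f * g \<in> hpart w"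
  using hpart_mult by blast

lemma hpart_power: "f \<in> hpart z \<Longrightarrow> f ^ n \<in> hpart (int n * z)"
  by (induction n) (auto simp: algebra_simps intro: hpart_mult_graded)

lemma hpart_prod: "(\<And>i. i \<in> A \<Longrightarrow> f i \<in> hpart (z i)) \<Longrightarrow> prod f A \<in> hpart (sum z A)"
  by (induction A rule: infinite_finite_induct) (auto intro: hpart_mult)

lemma hcomp_in [simp]: "hcomp z f \<in> hpart z"
  by (simp add: hpart_iff lookup_hcomp)

lemma hcomp_id: "f \<in> hpart z \<Longrightarrow> hcomp z f = f"
  by (rule poly_mapping_eqI) (auto simp: hpart_iff lookup_hcomp)

lemma hcomp_other: "f \<in> hpart y \<Longrightarrow> y \<noteq> z \<Longrightarrow> hcomp z f = 0"
  by (rule poly_mapping_eqI) (auto simp: hpart_iff lookup_hcomp)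

lemma hcomp_add: "hcomp z (f + g) = hcomp z f + hcomp z g"
  by (rule poly_mapping_eqI) (simp add: lookup_hcomp lookup_add)

lemma hcomp_diff: "hcomp z (f - g) = hcomp z f - hcomp z g"
  by (rule poly_mapping_eqI) (simp add: lookup_hcomp lookup_minus)

lemma hcomp_eq_0: "z \<notin> (\<lambda>m. int (mdeg m)) ` keys f \<Longrightarrow> hcomp z f = 0"
  by (intro poly_mapping_eqI) (metis (mono_tags, lifting) image_eqI in_keys_iff lookup_hcomp lookup_zero)

lemma hcomp_zero [simp]: "hcomp z 0 = 0"
  by (rule poly_mapping_eqI) (simp add: lookup_hcomp)

lemma hcomp_sum: "hcomp z (sum f A) = (\<Sum>i\<in>A. hcomp z (f i))"
  by (induction A rule: infinite_finite_induct) (auto simp: hcomp_add)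

lemma sum_hcomp: "f = (\<Sum>z\<in>(\<lambda>m. int (mdeg m)) ` keys f. hcomp z f)"
proof (rule poly_mapping_eqI)
  fix m
  have "(\<Sum>z\<in>(\<lambda>m. int (mdeg m)) ` keys f. lookup (hcomp z f) m) = 
    (if int (mdeg m) \<in> (\<lambda>m. int (mdeg m)) ` keys f then lookup f m else 0)"
    unfolding lookup_hcomp by (subst sum.delta') auto
  moreover have "lookup f m = 0" if "int (mdeg m) \<notin> (\<lambda>m. int (mdeg m)) ` keys f"
    using that by (auto simp flip: not_in_keys_iff_lookup_eq_zero)
  ultimately show "lookup f m = lookup (\<Sum>z\<in>(\<lambda>m. int (mdeg m)) ` keys f. hcomp z f) m"
    by (auto simp: lookup_sum)
qed

text \<open>Multiplication by a form of degree \<open>a\<close> sends the component of degree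
  \<open>y\<close> to degree \<open>a + y\<close>. Most passages to homogeneous cofactors or
  preimages below rest on this.\<close>

lemma hcomp_mult:
  assumes "f \<in> hpart a"
  shows "hcomp z (f * g) = f * hcomp (z - a) g"
proof -
  let ?Z = "(\<lambda>m. int (mdeg m)) ` keys g"
  have "hcomp z (f * g) = (\<Sum>y\<in>?Z. hcomp z (f * hcomp y g))"
    by (subst sum_hcomp[of g]) (simp add: sum_distrib_left hcomp_sum)
  also have "\<dots> = (\<Sum>y\<in>?Z. if y = z - a then f * hcomp (z - a) g else 0)"
  proof (rule sum.cong[OF refl])
    fix y
    have "f * hcomp y g \<in> hpart (a + y)"
      by (rule hpart_mult[OF assms hcomp_in])
    then show "hcomp z (f * hcomp y g) = (if y = z - a then f * hcomp (z - a) g else 0)"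
      by (auto simp: hcomp_id hcomp_other)
  qed
  also have "\<dots> = f * hcomp (z - a) g"
  proof -
    have "hcomp (z - a) g = 0" if "z - a \<notin> ?Z" using that by (rule hcomp_eq_0)
    then show ?thesis by (auto simp: sum.delta)
  qed
  finally show ?thesis .
qed

lemma graded_ideal_hcomp:
  assumes "graded_ideal I" "f \<in> I"
  shows "hcomp z f \<in> I"
proof -
  have sub: "idl.subspace I" and I: "I = idl.span (\<Union>d. I \<inter> graded_part d)"
    using assms by (auto simp: graded_ideal_def)
  have "f \<in> idl.span (\<Union>d. I \<inter> graded_part d)"
    using assms I by simp
  then have "\<forall>z. hcomp z f \<in> I"
  proof (induction rule: idl.span_induct_alt)
    case base
    show ?case using idl.subspace_0[OF sub] by simp
  next
    case (step c x y)
    show ?case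
    proof
      fix z
      from step(1) obtain d where d: "x \<in> I" "x \<in> hpart (int d)"
        by (auto simp: graded_part_eq)
      have "hcomp z (c * x + y) = hcomp (z - int d) c * x + hcomp z y"
        using hcomp_mult[OF d(2), of z c] by (simp add: hcomp_add mult.commute)
      then show "hcomp z (c * x + y) \<in> I"
        using step d idl.subspace_add[OF sub] idl.subspace_scale[OF sub] by auto
    qed
  qed
  then show ?thesis by blast
qed

text \<open>Stability under components is the working form of gradedness: an element is the sum of
  its components, and only degrees of occurring monomials, which are natural numbers, enter that
  sum.\<close>

lemma graded_idealI:
  assumes sub: "idl.subspace I" and h: "\<And>f z. f \<in> I \<Longrightarrow> hcomp z f \<in> I"
  shows "graded_ideal I"
  unfolding graded_ideal_def
proof (intro conjI sub antisym subsetI)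
  fix f assume f: "f \<in> I"
  have "(\<Sum>z\<in>(\<lambda>m. int (mdeg m)) ` keys f. hcomp z f) \<in> idl.span (\<Union>d. I \<inter> graded_part d)"
  proof (rule idl.span_sum)
    fix z assume "z \<in> (\<lambda>m. int (mdeg m)) ` keys f"
    then obtain d where "z = int d" by auto
    then show "hcomp z f \<in> idl.span (\<Union>d. I \<inter> graded_part d)"
      using h[OF f, of z] hcomp_in[of z f] by (intro idl.span_base) (auto simp: graded_part_eq simp del: hcomp_in)
  qed
  then show "f \<in> idl.span (\<Union>d. I \<inter> graded_part d)"
    using sum_hcomp[of f] by simp
next
  fix f assume "f \<in> idl.span (\<Union>d. I \<inter> graded_part d)"
  moreover have "idl.span (\<Union>d. I \<inter> graded_part d) \<subseteq> I"
    by (rule idl.span_minimal) (auto simp: sub)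
  ultimately show "f \<in> I" by blast
qed

lemma graded_ideal_subspace: "graded_ideal I \<Longrightarrow> idl.subspace I"
  by (simp add: graded_ideal_def)

lemma graded_ideal_hcompI:
  assumes "graded_ideal I" "\<And>z. hcomp z f \<in> I"
  shows "f \<in> I"
  by (subst sum_hcomp, rule idl.subspace_sum[OF graded_ideal_subspace]) (use assms in auto)

lemma graded_ideal_exists:
  assumes "graded_ideal J" "f \<in> I" "f \<notin> J" "graded_ideal I"
  shows "\<exists>d. \<exists>g\<in>hpart (int d). g \<in> I \<and> g \<notin> J"
proof -
  obtain z where z: "hcomp z f \<notin> J"
    using graded_ideal_hcompI assms by blast
  have "z \<ge> 0"
  proof (rule ccontr)
    assume "\<not> z \<ge> 0"
    then have "hcomp z f = 0" using hpart_neg[of z "hcomp z f"] by simp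
    then show False using z assms by (simp add: graded_ideal_def idl.subspace_0)
  qed
  then show ?thesis
    using z graded_ideal_hcomp[OF assms(4,2), of z] by (intro exI[of _ "nat z"] bexI[of _ "hcomp z f"]) auto
qed

lemma span_insert_ideal: "idl.subspace I \<Longrightarrow> f \<in> idl.span (insert h I) \<longleftrightarrow> (\<exists>g. f - g * h \<in> I)"
  by (simp add: idl.span_insert idl.span_eq_iff[THEN iffD2])

text \<open>Taking the component of degree \<open>z\<close> in \<open>f - g * h \<in> I\<close>
  replaces an arbitrary cofactor by its component of degree \<open>z - e\<close>.\<close>

lemma span_insert_homogeneous:
  assumes I: "graded_ideal I" and h: "h \<in> hpart e" and f: "f \<in> hpart z" "f \<in> idl.span (insert h I)"
  shows "\<exists>g\<in>hpart (z - e). f - g * h \<in> I"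
proof -
  obtain g where g: "f - g * h \<in> I" using f span_insert_ideal[OF graded_ideal_subspace[OF I]] by blast
  have "hcomp z (f - h * g) = f - h * hcomp (z - e) g"
    by (simp add: hcomp_diff hcomp_id[OF f(1)] hcomp_mult[OF h])
  then show ?thesis
    using graded_ideal_hcomp[OF I g, of z] by (intro bexI[of _ "hcomp (z - e) g"]) (auto simp: mult.commute)
qed

lemma prod_in_ideal:
  assumes "idl.subspace J" "finite A" "i \<in> A" "f i \<in> J"
  shows "prod f A \<in> J"
  using assms by (subst prod.remove[OF assms(2,3)]) (simp add: mult.commute[of "f i"] idl.subspace_scale)

section \<open>Evaluation at a point and the vanishing ideal of a line\<close>

definition var :: "'n \<Rightarrow> ('n::finite, 'k::field) mpoly" where
  "var i = single (single i 1) 1"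

lemma var_hpart: "var i \<in> hpart 1"
  using hpart_single[of "single i 1" 1] by (simp add: var_def)

definition mval :: "('n::finite \<Rightarrow> 'k::field) \<Rightarrow> ('n \<Rightarrow>\<^sub>0 nat) \<Rightarrow> 'k" where
  "mval a m = (\<Prod>i\<in>UNIV. a i ^ lookup m i)"

lemma mval_add: "mval a (m + m') = mval a m * mval a m'"
  by (simp add: mval_def lookup_add power_add prod.distrib)

lemma mval_zero [simp]: "mval a 0 = 1"
  by (simp add: mval_def)

lemma mval_single [simp]: "mval a (single i 1) = a i"
proof -
  have "mval a (single i 1) = (\<Prod>j\<in>UNIV. if i = j then a j else 1)"
    unfolding mval_def by (rule prod.cong) (auto simp: lookup_single when_def)
  then show ?thesis by simp
qed

text \<open>The homomorphism to \<open>K[T]\<close> sending the variable \<open>i\<close> to \<open>a i * T\<close>.\<close>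

definition pev :: "('n::finite \<Rightarrow> 'k::field) \<Rightarrow> ('n, 'k) mpoly \<Rightarrow> 'k poly" where
  "pev a f = (\<Sum>m\<in>keys f. monom (lookup f m * mval a m) (mdeg m))"

lemma pev_superset:
  "finite A \<Longrightarrow> keys f \<subseteq> A \<Longrightarrow> pev a f = (\<Sum>m\<in>A. monom (lookup f m * mval a m) (mdeg m))"
  unfolding pev_def by (rule sum.mono_neutral_left) (auto simp: not_in_keys_iff_lookup_eq_zero)

lemma pev_add: "pev a (f + g) = pev a f + pev a g"
proof -
  let ?A = "keys f \<union> keys g"
  have "pev a (f + g) = (\<Sum>m\<in>?A. monom (lookup (f + g) m * mval a m) (mdeg m))"
    by (rule pev_superset) (auto dest: set_mp[OF Poly_Mapping.keys_add])
  also have "\<dots> = (\<Sum>m\<in>?A. monom (lookup f m * mval a m) (mdeg m)) + (\<Sum>m\<in>?A. monom (lookup g m * mval a m) (mdeg m))"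
    by (simp add: lookup_add distrib_right add_monom[symmetric] sum.distrib)
  also have "\<dots> = pev a f + pev a g"
    by (subst (1 2) pev_superset[symmetric]) auto
  finally show ?thesis .
qed

lemma pev_zero [simp]: "pev a 0 = 0"
  by (simp add: pev_def)

lemma pev_single: "pev a (single m c) = monom (c * mval a m) (mdeg m)"
  by (subst pev_superset[of "{m}"]) auto

lemma pev_mult: "pev a (f * g) = pev a f * pev a g"
proof (induction f rule: mpoly_induct)
  case zero
  show ?case by simp
next
  case (single m c)
  show ?case
  proof (induction g rule: mpoly_induct)
    case zero
    show ?case by simp
  next
    case (single m' c')
    show ?case unfolding mult_single pev_single mult_monom mval_add mdeg_add
      by (simp only: ac_simps)
  next
    case (add f g)
    then show ?case by (simp only: pev_add distrib_left)
  qed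
next
  case (add f g)
  then show ?case by (simp only: pev_add distrib_right)
qed

lemma pev_one [simp]: "pev a 1 = 1"
  using pev_single[of a 0 1] by simp

lemma pev_uminus: "pev a (- f) = - pev a f"
proof -
  have "pev a (- f) + pev a f = 0" by (simp flip: pev_add)
  then show ?thesis by (simp add: add_eq_0_iff2)
qed

definition eva :: "('n::finite \<Rightarrow> 'k::field) \<Rightarrow> ('n, 'k) mpoly \<Rightarrow> 'k" where
  "eva a f = poly (pev a f) 1"

lemma eva_add: "eva a (f + g) = eva a f + eva a g" by (simp add: eva_def pev_add)
lemma eva_mult: "eva a (f * g) = eva a f * eva a g" by (simp add: eva_def pev_mult)
lemma eva_uminus: "eva a (- f) = - eva a f" by (simp add: eva_def pev_uminus)
lemma eva_diff: "eva a (f - g) = eva a f - eva a g"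
  using eva_add[of a f "- g"] by (simp add: eva_uminus)
lemma eva_zero [simp]: "eva a 0 = 0" by (simp add: eva_def)
lemma eva_one [simp]: "eva a 1 = 1" by (simp add: eva_def)
lemma eva_single: "eva a (single m c) = c * mval a m" by (simp add: eva_def pev_single poly_monom)
lemma eva_var [simp]: "eva a (var i) = a i" by (simp add: var_def eva_single flip: One_nat_def)
lemma eva_sum: "eva a (sum f A) = (\<Sum>i\<in>A. eva a (f i))"
  by (induction A rule: infinite_finite_induct) (auto simp: eva_add)
lemma eva_power: "eva a (f ^ n) = eva a f ^ n"
  by (induction n) (auto simp: eva_mult)
lemma eva_scale: "eva a (scale c f) = c * eva a f"
  by (simp add: scale_def eva_mult eva_single)

text \<open>On a form the image in \<open>K[T]\<close> is a single monomial, so vanishing along the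
  line is tested at one point. This holds over every field, finite ones included.\<close>

lemma pev_hpart:
  assumes "f \<in> hpart (int d)"
  shows "pev a f = monom (eva a f) d"
proof -
  have "pev a f = (\<Sum>m\<in>keys f. monom (lookup f m * mval a m) d)"
    unfolding pev_def by (rule sum.cong) (use assms in \<open>auto simp: hpart_def\<close>)
  then have "pev a f = monom (\<Sum>m\<in>keys f. lookup f m * mval a m) d"
    by (simp add: monom_sum)
  then show ?thesis by (simp add: eva_def poly_monom)
qed

text \<open>Kernel of a homomorphism to the domain \<open>K[T]\<close>, hence prime. If
  \<open>a\<close> has a nonzero coordinate it is the homogeneous ideal of the projective point
  \<open>a\<close>; \<open>a = 0\<close> gives \<open>irrelevant\<close>.\<close>

definition line_ideal :: "('n::finite \<Rightarrow> 'k::field) \<Rightarrow> ('n, 'k) mpoly set" where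
  "line_ideal a = {f. pev a f = 0}"

lemma line_ideal_hpart: "f \<in> hpart (int d) \<Longrightarrow> f \<in> line_ideal a \<longleftrightarrow> eva a f = 0"
  by (simp add: line_ideal_def pev_hpart)

lemma line_ideal_subspace: "idl.subspace (line_ideal a)"
  by (auto simp: idl.subspace_def line_ideal_def pev_add pev_mult)

lemma line_ideal_prime: "prime_ideal (line_ideal a)"
proof -
  have "1 \<notin> line_ideal a" by (simp add: line_ideal_def)
  then show ?thesis
    by (auto simp: prime_ideal_def line_ideal_subspace) (auto simp: line_ideal_def pev_mult)
qed

section \<open>The ideal generated by all variables\<close>

definition irrelevant :: "('n::finite, 'k::field) mpoly set" where
  "irrelevant = {f. lookup f 0 = 0}"

text \<open>A sum of two exponent vectors is zero only if both are, so the constant coefficient is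
  multiplicative; this makes \<open>irrelevant\<close> prime.\<close>

lemma lookup_mult_0: "lookup (f * g) (0 :: 'n::finite \<Rightarrow>\<^sub>0 nat) = lookup f 0 * (lookup g 0 :: 'k::field)"
proof (induction f rule: mpoly_induct)
  case (single m c)
  show ?case
  proof (induction g rule: mpoly_induct)
    case (single m' c')
    have "m + m' = 0 \<longleftrightarrow> m = 0 \<and> m' = 0"
      by (metis add_is_0 mdeg_add mdeg_eq_0_iff)
    then show ?case by (auto simp: mult_single lookup_single when_def)
  qed (auto simp: lookup_add distrib_left)
qed (auto simp: lookup_add distrib_right)

lemma irrelevant_subspace: "idl.subspace irrelevant"
  by (auto simp: idl.subspace_def irrelevant_def lookup_add lookup_mult_0)

lemma irrelevant_prime: "prime_ideal irrelevant"
proof -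
  have "1 \<notin> irrelevant" by (simp add: irrelevant_def)
  then show ?thesis
    by (auto simp: prime_ideal_def irrelevant_subspace) (auto simp: irrelevant_def lookup_mult_0)
qed

lemma hpart_irrelevant: "f \<in> hpart d \<Longrightarrow> d \<noteq> 0 \<Longrightarrow> f \<in> irrelevant"
  unfolding hpart_iff irrelevant_def by (metis (mono_tags) mdeg_zero mem_Collect_eq of_nat_0)

lemma hpart_0_eq: "f \<in> hpart 0 \<Longrightarrow> f = single 0 (lookup f 0)"
  by (rule poly_mapping_eqI) (auto simp: hpart_iff lookup_single when_def)

lemma eva_hpart_0: "f \<in> hpart 0 \<Longrightarrow> eva a f = lookup f 0"
  by (subst hpart_0_eq) (auto simp: eva_single)

lemma line_ideal_graded: "graded_ideal (line_ideal a)"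
proof (rule graded_idealI[OF line_ideal_subspace])
  fix f z assume f: "f \<in> line_ideal a"
  show "hcomp z f \<in> line_ideal a"
  proof (cases "z < 0")
    case True
    then show ?thesis using hpart_neg[of z "hcomp z f"] by (simp add: line_ideal_def)
  next
    case False
    then obtain d where d: "z = int d" by (metis linorder_not_less nonneg_int_cases)
    have pev_hcomp: "pev a (hcomp (int d) f) = monom (coeff (pev a f) d) d" for d
    proof (induction f rule: mpoly_induct)
      case (single m c)
      show ?case
      proof (cases "mdeg m = d")
        case True
        then show ?thesis using hcomp_id[OF hpart_single[of m c]] by (simp add: pev_single)
      next
        case False
        then show ?thesis using hcomp_other[OF hpart_single[of m c], of "int d"] by (simp add: pev_single)
      qed
    qed (auto simp: hcomp_add pev_add add_monom)
    show ?thesis using f by (simp add: d line_ideal_def pev_hcomp)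
  qed
qed

lemma line_subset_irrelevant:
  assumes "a i \<noteq> 0"
  shows "line_ideal a \<subset> irrelevant"
proof
  show "line_ideal a \<subseteq> irrelevant"
  proof
    fix f assume "f \<in> line_ideal a"
    then have "hcomp 0 f \<in> line_ideal a"
      using graded_ideal_hcomp line_ideal_graded by blast
    then have "eva a (hcomp 0 f) = 0"
      using line_ideal_hpart[of "hcomp 0 f" 0] by simp
    then show "f \<in> irrelevant"
      by (simp add: eva_hpart_0 irrelevant_def lookup_hcomp)
  qed
  have "var i \<in> irrelevant" using hpart_irrelevant var_hpart by fastforce
  moreover have "var i \<notin> line_ideal a"
    using line_ideal_hpart[of "var i" 1 a] var_hpart[of i] assms by simp
  ultimately show "line_ideal a \<noteq> irrelevant" by blast
qed

text \<open>An element outside \<open>irrelevant\<close> has a nonzero constant term; subtracting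
  its remaining terms, which lie in \<open>irrelevant\<close>, leaves a unit in
  \<open>J\<close>.\<close>

lemma irrelevant_maximal:
  assumes "idl.subspace J" "irrelevant \<subseteq> J" "J \<noteq> irrelevant"
  shows "J = UNIV"
proof -
  obtain f where f: "f \<in> J" "lookup f 0 \<noteq> 0"
    using assms by (auto simp: irrelevant_def)
  have "f - single 0 (lookup f 0) \<in> J"
    using assms(2) by (auto simp: irrelevant_def lookup_minus)
  then have "f - (f - single 0 (lookup f 0)) \<in> J"
    using f assms(1) idl.subspace_diff by blast
  then have "single 0 (inverse (lookup f 0)) * single 0 (lookup f 0) \<in> J"
    using assms(1) idl.subspace_scale by simp
  then have "1 \<in> J" using f by (simp add: mult_single)
  then show ?thesis using idl.subspace_scale[OF assms(1), of 1] by auto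
qed

lemma subspace_eq_UNIV: "idl.subspace J \<Longrightarrow> 1 \<in> J \<Longrightarrow> J = UNIV"
  using idl.subspace_scale[of J 1] by auto

lemma mpoly_eq_sum_var:
  assumes "f \<in> irrelevant"
  shows "\<exists>g. f = (\<Sum>i\<in>UNIV. g i * var i)"
  using assms
proof -
  have "\<exists>g. f = single 0 (lookup f 0) + (\<Sum>i\<in>UNIV. g i * var i)"
  proof (induction f rule: mpoly_induct)
    case zero
    show ?case by (rule exI[of _ "\<lambda>_. 0"]) simp
  next
    case (single m c)
    show ?case
    proof (cases "m = 0")
      case True
      then show ?thesis by (intro exI[of _ "\<lambda>_. 0"]) simp
    next
      case False
      then obtain i where i: "lookup m i \<noteq> 0" by (metis poly_mapping_eqI lookup_zero)
      have m: "m = (m - single i 1) + single i 1"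
        using i by (intro poly_mapping_eqI) (auto simp: lookup_add lookup_minus lookup_single when_def)
      have "single m c = (\<Sum>j\<in>UNIV. (if j = i then single (m - single i 1) c else 0) * var j)"
        by (subst m) (simp add: if_distrib[of "\<lambda>x. x * _"] var_def mult_single cong: if_cong)
      moreover have "single 0 (lookup (single m c) 0) = (0 :: ('a, 'b) mpoly)" using False by (simp add: lookup_single)
      ultimately show ?thesis by (intro exI[of _ "\<lambda>j. if j = i then single (m - single i 1) c else 0"]) (simp only: add_0)
    qed
  next
    case (add f g)
    then obtain u v where "f = single 0 (lookup f 0) + (\<Sum>i\<in>UNIV. u i * var i)" 
      "g = single 0 (lookup g 0) + (\<Sum>i\<in>UNIV. v i * var i)" by blast
    then have "f + g = single 0 (lookup (f + g) 0) + (\<Sum>i\<in>UNIV. (u i + v i) * var i)"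
      by (simp add: lookup_add single_add distrib_right sum.distrib algebra_simps)
    then show ?case by (intro exI[of _ "\<lambda>i. u i + v i"])
  qed
  then show ?thesis using assms by (simp add: irrelevant_def)
qed

lemma irrelevant_subset:
  assumes "idl.subspace J" "\<And>i. var i \<in> J"
  shows "irrelevant \<subseteq> J"
proof
  fix f :: "('a, 'b) mpoly" assume "f \<in> irrelevant"
  then obtain g where "f = (\<Sum>i\<in>UNIV. g i * var i)" using mpoly_eq_sum_var by blast
  then show "f \<in> J" using assms by (auto intro!: idl.subspace_sum idl.subspace_scale)
qed


section \<open>The Hilbert basis theorem\<close>

text \<open>Each chosen index minimises \<open>s\<close> over all later indices, so the chosen
  values increase weakly.\<close>

lemma subseq_mono_nat:
  fixes s :: "nat \<Rightarrow> nat"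
  shows "\<exists>r :: nat \<Rightarrow> nat. strict_mono r \<and> (\<forall>i j. i \<le> j \<longrightarrow> s (r i) \<le> s (r j))"
proof -
  have ex: "\<exists>k>n. \<forall>j\<ge>k. s k \<le> s j" for n
  proof -
    obtain k where "k > n" "\<And>j. j > n \<Longrightarrow> s k \<le> s j"
      using ex_has_least_nat[of "\<lambda>k. k > n" "Suc n" s] by auto
    then show ?thesis by (intro exI[of _ k]) auto
  qed
  obtain r where r: "\<And>n. (\<forall>j\<ge>r n. s (r n) \<le> s j)" "\<And>n. r n < r (Suc n)"
    using dependent_nat_choice[of "\<lambda>n k. \<forall>j\<ge>k. s k \<le> s j" "\<lambda>n k k'. k < k'"] ex by metis
  have "strict_mono r" using r(2) by (simp add: strict_mono_Suc_iff)
  then show ?thesis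
    using r(1) by (intro exI[of _ r]) (auto simp: strict_mono_less_eq)
qed

lemma dickson_subseq:
  fixes s :: "nat \<Rightarrow> 'a \<Rightarrow> nat"
  assumes "finite V"
  shows "\<exists>r :: nat \<Rightarrow> nat. strict_mono r \<and> (\<forall>v\<in>V. \<forall>i j. i \<le> j \<longrightarrow> s (r i) v \<le> s (r j) v)"
  using assms
proof induction
  case empty
  show ?case by (intro exI[of _ id]) (simp add: strict_mono_def)
next
  case (insert v V)
  then obtain r :: "nat \<Rightarrow> nat"
    where r: "strict_mono r" "\<forall>v\<in>V. \<forall>i j. i \<le> j \<longrightarrow> s (r i) v \<le> s (r j) v"
    using insert.IH by (elim exE conjE)
  obtain r' :: "nat \<Rightarrow> nat" where r': "strict_mono r'" "\<forall>i j. i \<le> j \<longrightarrow> s (r (r' i)) v \<le> s (r (r' j)) v"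
    using subseq_mono_nat[of "\<lambda>i. s (r i) v"] by auto
  show ?case
  proof (intro exI[of _ "r \<circ> r'"] conjI)
    show "strict_mono (r \<circ> r')" using r r' by (simp add: strict_mono_o)
    show "\<forall>u\<in>insert v V. \<forall>i j. i \<le> j \<longrightarrow> s ((r \<circ> r') i) u \<le> s ((r \<circ> r') j) u"
      using r r' by (auto simp: strict_mono_less_eq)
  qed
qed

text \<open>Were there no finite \<open>B\<close>, elements could be chosen one after another, none
  a multiple of an earlier one. By \<open>dickson_subseq\<close> two of them have weakly increasing
  exponents throughout, so the later is a multiple of the earlier.\<close>

lemma dickson:
  fixes A :: "('n::finite \<Rightarrow>\<^sub>0 nat) set"
  shows "\<exists>B\<subseteq>A. finite B \<and> (\<forall>m\<in>A. \<exists>b\<in>B. \<exists>c. m = b + c)"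
proof (rule ccontr)
  assume neg: "\<not> ?thesis"
  define good where "good B m \<longleftrightarrow> m \<in> A \<and> \<not> (\<exists>b\<in>B. \<exists>c. m = b + c)" for B m
  have ex: "\<exists>m. good B m" if "finite B" "B \<subseteq> A" for B
    using neg that unfolding good_def by blast
  define next_elem where "next_elem B = (SOME m. good B m)" for B
  define F where "F = rec_nat {} (\<lambda>_ B. insert (next_elem B) B)"
  have F0: "F 0 = {}" and FS: "F (Suc n) = insert (next_elem (F n)) (F n)" for n
    by (auto simp: F_def)
  have F: "finite (F n) \<and> F n \<subseteq> A" for n
  proof (induction n)
    case (Suc n)
    then have "good (F n) (next_elem (F n))"
      unfolding next_elem_def using ex by (meson someI)
    then show ?case using Suc by (auto simp: FS good_def)
  qed (simp add: F0)
  define s where "s n = next_elem (F n)" for n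
  have good: "good (F n) (s n)" for n
    unfolding s_def next_elem_def using ex F by (meson someI)
  have mem: "i < j \<Longrightarrow> s i \<in> F j" for i j
    by (induction j) (auto simp: FS s_def less_Suc_eq)
  obtain r :: "nat \<Rightarrow> nat" where r: "strict_mono r" "\<forall>v. \<forall>i j. i \<le> j \<longrightarrow> lookup (s (r i)) v \<le> lookup (s (r j)) v"
    using dickson_subseq[of UNIV "\<lambda>i. lookup (s i)"] by auto
  have "s (r 1) = s (r 0) + (s (r 1) - s (r 0))"
    using r(2) by (intro poly_mapping_eqI) (simp add: lookup_add lookup_minus)
  moreover have "s (r 0) \<in> F (r 1)"
    using mem r(1) by (simp add: strict_mono_less)
  ultimately show False using good[of "r 1"] unfolding good_def by blast
qed

section \<open>A graded monomial order and leading exponents\<close>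

definition var_index :: "'n::finite \<Rightarrow> nat" where
  "var_index = (SOME f. inj f)"

lemma inj_var_index: "inj (var_index :: 'n::finite \<Rightarrow> nat)"
proof -
  have "\<exists>f :: 'n \<Rightarrow> nat. inj f"
    using finite_imp_inj_to_nat_seg[of "UNIV :: 'n set"] by blast
  then show ?thesis unfolding var_index_def by (rule someI_ex)
qed

text \<open>
  Putting the total degree in front of the exponents turns the lexicographic order of
  the library into a graded monomial order.
\<close>

definition deglex :: "('n::finite \<Rightarrow>\<^sub>0 nat) \<Rightarrow> (nat \<Rightarrow>\<^sub>0 nat)" where
  "deglex m = single 0 (mdeg m) + (\<Sum>i\<in>UNIV. single (Suc (var_index i)) (lookup m i))"

lemma deglex_add: "deglex (m + m') = deglex m + deglex m'"
  by (simp add: deglex_def lookup_add single_add sum.distrib algebra_simps)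

lemma lookup_deglex_0: "lookup (deglex m) 0 = mdeg m"
  by (simp add: deglex_def lookup_add lookup_sum lookup_single)

lemma lookup_deglex_Suc: "lookup (deglex m) (Suc (var_index i)) = lookup m i"
proof -
  have "lookup (deglex m) (Suc (var_index i)) = (\<Sum>j\<in>UNIV. if j = i then lookup m j else 0)"
    unfolding deglex_def lookup_add lookup_sum lookup_single when_def
    by (simp add: inj_eq[OF inj_var_index])
  then show ?thesis by simp
qed

lemma inj_deglex: "inj deglex"
  by (rule injI, rule poly_mapping_eqI) (metis lookup_deglex_Suc)

lemma deglex_le_mdeg:
  fixes m m' :: "'n::finite \<Rightarrow>\<^sub>0 nat"
  assumes "deglex m \<le> deglex m'"
  shows "mdeg m \<le> mdeg m'"
proof -
  from assms
  have "less_fun (lookup (deglex m)) (lookup (deglex m')) \<or> deglex m = deglex m'"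
    by (metis less_eq_poly_mapping.rep_eq poly_mapping_eq_iff)
  then show ?thesis
  proof
    assume "less_fun (lookup (deglex m)) (lookup (deglex m'))"
    then obtain k where k: "lookup (deglex m) k < lookup (deglex m') k"
      "\<And>k'. k' < k \<Longrightarrow> lookup (deglex m) k' = lookup (deglex m') k'"
      by (auto elim: less_funE)
    show ?thesis
      using k by (cases k) (simp_all flip: lookup_deglex_0)
  next
    assume "deglex m = deglex m'"
    then have "m = m'" by (rule injD[OF inj_deglex])
    then show ?thesis by simp
  qed
qed

text \<open>Comparing total degrees first makes initial segments finite, so their cardinality can
  serve as the measure for reduction by leading terms.\<close>

lemma finite_deglex_le: "finite {m' :: 'n::finite \<Rightarrow>\<^sub>0 nat. deglex m' \<le> deglex (m :: 'n \<Rightarrow>\<^sub>0 nat)}"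
  by (rule finite_subset[OF _ finite_mdeg_le[of "mdeg m"]]) (auto dest: deglex_le_mdeg)

lemma lead_exists:
  assumes "f \<noteq> 0"
  shows "\<exists>m\<in>keys f. \<forall>m'\<in>keys f. deglex m' \<le> deglex m"
proof -
  have fin: "finite (deglex ` keys f)" "deglex ` keys f \<noteq> {}" using assms by auto
  obtain m where "m \<in> keys f" "deglex m = Max (deglex ` keys f)"
    using Max_in[OF fin] by (metis (mono_tags, lifting) imageE)
  then show ?thesis using fin by (intro bexI[of _ m]) auto
qed

definition lead :: "('n::finite, 'k::field) mpoly \<Rightarrow> ('n \<Rightarrow>\<^sub>0 nat)" where
  "lead f = (SOME m. m \<in> keys f \<and> (\<forall>m'\<in>keys f. deglex m' \<le> deglex m))"

lemma lead:
  assumes "f \<noteq> 0"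
  shows "lead f \<in> keys f" "m \<in> keys f \<Longrightarrow> deglex m \<le> deglex (lead f)"
  using someI_ex[OF lead_exists[OF assms, unfolded Bex_def]] unfolding lead_def by blast+

lemma lookup_single_mult: "lookup (single c x * f) (c + m) = x * (lookup f m :: 'k::field)"
  for c m :: "'n::finite \<Rightarrow>\<^sub>0 nat"
  by (induction f rule: mpoly_induct)
    (auto simp: mult_single lookup_single when_def distrib_left lookup_add)

text \<open>Choose \<open>B\<close> so that every leading exponent of \<open>I\<close> is a multiple
  of one from \<open>B\<close>. Subtracting a suitable multiple of an element of \<open>B\<close>
  cancels the leading term of \<open>f\<close> and leaves an element of \<open>I\<close> that is
  zero or has a smaller leading exponent.\<close>

theorem ideal_finitely_generated:
  fixes I :: "('n::finite, 'k::field) mpoly set"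
  assumes I: "idl.subspace I"
  shows "\<exists>B\<subseteq>I. finite B \<and> idl.span B = I"
proof -
  obtain M where M: "M \<subseteq> lead ` (I - {0})" "finite M"
    and div: "\<And>m. m \<in> lead ` (I - {0}) \<Longrightarrow> \<exists>b\<in>M. \<exists>c. m = b + c"
    using dickson[of "lead ` (I - {0})"] by blast
  obtain B where B: "B \<subseteq> I - {0}" "finite B" "M = lead ` B"
    using M finite_subset_image[of M lead "I - {0}"] by blast
  have "f \<in> I \<Longrightarrow> f \<in> idl.span B" for f
  proof (induction "card {m :: 'n \<Rightarrow>\<^sub>0 nat. deglex m \<le> deglex (lead f)}" arbitrary: f rule: less_induct)
    case less
    show ?case
    proof (cases "f = 0")
      case False
      then obtain b c where b: "b \<in> B" and c: "lead f = lead b + c"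
        using div[of "lead f"] less.prems B by blast
      have b0: "b \<noteq> 0" "b \<in> I" using b B by auto
      define x where "x = lookup f (lead f) / lookup b (lead b)"
      define f' where "f' = f - single c x * b"
      have f': "f' \<in> I"
        unfolding f'_def using I b0 less.prems by (auto intro: idl.subspace_diff idl.subspace_scale)
      have lb: "lookup b (lead b) \<noteq> 0" using lead(1)[OF b0(1)] by (simp add: in_keys_iff)
      have "f' \<in> idl.span B"
      proof (cases "f' = 0")
        case True
        then show ?thesis by (simp add: idl.span_zero)
      next
        case f'0: False
        have zero: "lookup f' (lead f) = 0"
          using lookup_single_mult[of c x b "lead b"] lb
          by (simp add: f'_def lookup_minus c x_def add.commute)
        have le: "deglex m \<le> deglex (lead f)" if "m \<in> keys f'" for m
        proof -
          have "m \<in> keys f \<or> m \<in> keys (single c x * b)"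
            using that keys_diff[of f "single c x * b"] unfolding f'_def by blast
          then show ?thesis
          proof
            assume "m \<in> keys f"
            then show ?thesis using lead[OF False] by blast
          next
            assume "m \<in> keys (single c x * b)"
            then obtain m' where m': "m = c + m'" "m' \<in> keys b"
              using keys_mult[of "single c x" b] by (auto split: if_splits)
            then show ?thesis
              using lead(2)[OF b0(1) m'(2)] by (simp add: c deglex_add add.commute add_left_mono)
          qed
        qed
        have "lead f' \<in> keys f'" using lead[OF f'0] by blast
        then have "deglex (lead f') \<le> deglex (lead f)" "lead f' \<noteq> lead f"
          using le zero by (auto simp: in_keys_iff)
        then have "deglex (lead f') < deglex (lead f)"
          using inj_deglex by (metis antisym_conv1 injD)
        then have "{m :: 'n \<Rightarrow>\<^sub>0 nat. deglex m \<le> deglex (lead f')} \<subseteq> {m :: 'n \<Rightarrow>\<^sub>0 nat. deglex m \<le> deglex (lead f)}"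
          "lead f \<notin> {m :: 'n \<Rightarrow>\<^sub>0 nat. deglex m \<le> deglex (lead f')}"
          by auto
        then have "{m :: 'n \<Rightarrow>\<^sub>0 nat. deglex m \<le> deglex (lead f')} \<subset> {m :: 'n \<Rightarrow>\<^sub>0 nat. deglex m \<le> deglex (lead f)}"
          by (metis (mono_tags, lifting) mem_Collect_eq order_refl psubsetI)
        then have "card {m :: 'n \<Rightarrow>\<^sub>0 nat. deglex m \<le> deglex (lead f')} < card {m :: 'n \<Rightarrow>\<^sub>0 nat. deglex m \<le> deglex (lead f)}"
          by (rule psubset_card_mono[OF finite_deglex_le])
        then show ?thesis using less.hyps f' by blast
      qed
      moreover have "single c x * b \<in> idl.span B"
        using b by (intro idl.span_scale idl.span_base)
      ultimately have "f' + single c x * b \<in> idl.span B" by (rule idl.span_add)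
      then show ?thesis by (simp add: f'_def)
    qed (simp add: idl.span_zero)
  qed
  moreover have "idl.span B \<subseteq> I" using B I by (intro idl.span_minimal) auto
  ultimately show ?thesis using B by (intro exI[of _ B]) auto
qed

text \<open>The union of a chain is an ideal with finitely many generators, all of which lie in one
  member of the chain. So the union is that member, and Zorn's lemma applies.\<close>

lemma noetherian_maximal:
  fixes F :: "('n::finite, 'k::field) mpoly set set"
  assumes ne: "F \<noteq> {}" and sub: "\<And>J. J \<in> F \<Longrightarrow> idl.subspace J"
  shows "\<exists>M\<in>F. \<forall>J\<in>F. M \<subseteq> J \<longrightarrow> J = M"
proof (rule subset_Zorn_nonempty[OF ne, THEN bexE])
  fix C :: "('n, 'k) mpoly set set" assume C: "C \<noteq> {}" "subset.chain F C"
  have subU: "idl.subspace (\<Union>C)"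
    unfolding idl.subspace_def
  proof (intro conjI ballI allI)
    show "0 \<in> \<Union>C" using C sub by (fastforce simp: subset_chain_def idl.subspace_def)
    fix x y assume "x \<in> \<Union>C" "y \<in> \<Union>C"
    then obtain X Y where "x \<in> X" "y \<in> Y" "X \<in> C" "Y \<in> C" by blast
    moreover have "X \<subseteq> Y \<or> Y \<subseteq> X" using C \<open>X \<in> C\<close> \<open>Y \<in> C\<close> by (auto simp: subset_chain_def)
    moreover have "idl.subspace X" "idl.subspace Y"
      using C sub \<open>X \<in> C\<close> \<open>Y \<in> C\<close> by (auto simp: subset_chain_def)
    ultimately show "x + y \<in> \<Union>C" using idl.subspace_add by (metis UnionI subsetD)
  next
    fix c x assume "x \<in> \<Union>C"
    then obtain X where "x \<in> X" "X \<in> C" by blast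
    moreover from this have "idl.subspace X" using C sub by (auto simp: subset_chain_def)
    ultimately show "c * x \<in> \<Union>C" using idl.subspace_scale by blast
  qed
  from ideal_finitely_generated[OF this]
  obtain B where B: "B \<subseteq> \<Union>C" "finite B" "idl.span B = \<Union>C" by (elim exE conjE)
  then obtain X where X: "X \<in> C" "B \<subseteq> X"
    using finite_subset_Union_chain[OF B(2,1) C(1)] C(2) by blast
  then have "idl.span B \<subseteq> X" using sub C by (intro idl.span_minimal) (auto simp: subset_chain_def)
  then have "\<Union>C = X" using X B by auto
  then show "\<Union>C \<in> F" using X C by (auto simp: subset_chain_def)
qed blast

lemma noetherian_chain:
  fixes J :: "nat \<Rightarrow> ('n::finite, 'k::field) mpoly set"
  assumes "\<And>n. idl.subspace (J n)" "\<And>n. J n \<subseteq> J (Suc n)"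
  shows "\<exists>n. J (Suc n) = J n"
proof -
  obtain n where "\<And>k. J n \<subseteq> J k \<Longrightarrow> J k = J n"
    using noetherian_maximal[of "range J"] assms(1) by auto
  then show ?thesis using assms(2)[of n] by blast
qed

section \<open>Graded submodules of free modules\<close>

definition vscale :: "'a::comm_ring_1 \<Rightarrow> (nat \<Rightarrow> 'a) \<Rightarrow> nat \<Rightarrow> 'a" where
  "vscale c v = (\<lambda>k. c * v k)"

interpretation vm: Modules.module "vscale :: 'a::comm_ring_1 \<Rightarrow> (nat \<Rightarrow> 'a) \<Rightarrow> nat \<Rightarrow> 'a"
proof
  fix a b :: 'a and x y :: "nat \<Rightarrow> 'a"
  show "vscale a (x + y) = vscale a x + vscale a y"
    by (rule ext) (simp only: vscale_def plus_fun_apply distrib_left)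
  show "vscale (a + b) x = vscale a x + vscale b x"
    by (rule ext) (simp only: vscale_def plus_fun_apply distrib_right)
  show "vscale a (vscale b x) = vscale (a * b) x"
    by (rule ext) (simp only: vscale_def mult.assoc)
  show "vscale 1 x = x"
    by (rule ext) (simp only: vscale_def mult_1)
qed

text \<open>Free modules of every rank share one type: a vector of length \<open>n\<close> is a
  sequence that vanishes from \<open>n\<close> on.\<close>

definition vsupp :: "nat \<Rightarrow> (nat \<Rightarrow> 'a::zero) set" where
  "vsupp n = {v. \<forall>k\<ge>n. v k = 0}"

lemma sum_fun_apply: "(\<Sum>i\<in>A. f i) k = (\<Sum>i\<in>A. f i k)" for f :: "'i \<Rightarrow> 'b \<Rightarrow> 'a::comm_monoid_add"
  by (induction A rule: infinite_finite_induct) auto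

text \<open>Induction on the rank: the last coordinates of \<open>N\<close> form a finitely
  generated ideal. Lifts of its generators, together with generators of the part of \<open>N\<close>
  with last coordinate 0, generate \<open>N\<close>.\<close>

lemma submodule_finitely_generated:
  fixes N :: "(nat \<Rightarrow> ('n::finite, 'k::field) mpoly) set"
  assumes "vm.subspace N" "N \<subseteq> vsupp n"
  shows "\<exists>B\<subseteq>N. finite B \<and> vm.span B = N"
  using assms
proof (induction n arbitrary: N)
  case 0
  then have "N \<subseteq> {0}" by (auto simp: vsupp_def fun_eq_iff)
  moreover have "0 \<in> N" using 0 by (simp add: vm.subspace_0)
  ultimately have "N = {0}" by blast
  then show ?case by (intro exI[of _ "{}"]) auto
next
  case (Suc n)
  note sub = Suc.prems(1)
  have "idl.subspace ((\<lambda>v. v n) ` N)"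
    unfolding idl.subspace_def
  proof (intro conjI ballI allI)
    show "0 \<in> (\<lambda>v. v n) ` N" using vm.subspace_0[OF sub] by (intro image_eqI[of _ _ 0]) auto
    fix x y assume "x \<in> (\<lambda>v. v n) ` N" "y \<in> (\<lambda>v. v n) ` N"
    then obtain u v where "u \<in> N" "v \<in> N" "x = u n" "y = v n" by blast
    then show "x + y \<in> (\<lambda>v. v n) ` N"
      using vm.subspace_add[OF sub] by (intro image_eqI[of _ _ "u + v"]) auto
  next
    fix c x assume "x \<in> (\<lambda>v. v n) ` N"
    then obtain u where "u \<in> N" "x = u n" by blast
    then show "c * x \<in> (\<lambda>v. v n) ` N"
      using vm.subspace_scale[OF sub] by (intro image_eqI[of _ _ "vscale c u"]) (auto simp: vscale_def)
  qed
  from ideal_finitely_generated[OF this]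
  obtain B0 where B0: "B0 \<subseteq> (\<lambda>v. v n) ` N" "finite B0" "idl.span B0 = (\<lambda>v. v n) ` N"
    by (elim exE conjE)
  obtain B1 where B1: "B1 \<subseteq> N" "finite B1" "B0 = (\<lambda>v. v n) ` B1"
    using finite_subset_image[OF B0(2,1)] by (elim exE conjE)
  define N' where "N' = {v \<in> N. v n = 0}"
  have "vm.subspace N'"
    using sub by (auto simp: N'_def vm.subspace_def) (auto simp: vscale_def)
  moreover have "N' \<subseteq> vsupp n"
    using Suc.prems(2) by (force simp: N'_def vsupp_def Suc_le_eq dest: le_neq_implies_less)
  ultimately obtain B' where B': "B' \<subseteq> N'" "finite B'" "vm.span B' = N'"
    using Suc.IH[of N'] by metis
  have "v \<in> vm.span (B1 \<union> B')" if v: "v \<in> N" for v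
  proof -
    have "v n \<in> idl.span ((\<lambda>v. v n) ` B1)" using B0 B1 v by auto
    moreover have "\<exists>w\<in>vm.span B1. w n = x" if "x \<in> idl.span ((\<lambda>v. v n) ` B1)" for x
      using that
    proof (induction rule: idl.span_induct_alt)
      case base
      show ?case by (intro bexI[of _ 0]) (auto simp: vm.span_zero)
    next
      case (step c x y)
      then obtain u w where "u \<in> B1" "x = u n" "w \<in> vm.span B1" "w n = y" by blast
      then show ?case
        by (intro bexI[of _ "vscale c u + w"] vm.span_add vm.span_scale)
          (simp_all add: vscale_def vm.span_base)
    qed
    ultimately obtain w where w: "w \<in> vm.span B1" "w n = v n" by blast
    have "w \<in> N" using w vm.span_minimal[OF B1(1) sub] by blast
    then have "v - w \<in> N'" using w v vm.subspace_diff[OF sub] by (simp add: N'_def)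
    then have "v - w \<in> vm.span (B1 \<union> B')" using B' vm.span_mono[of B' "B1 \<union> B'"] by blast
    moreover have "w \<in> vm.span (B1 \<union> B')" using w vm.span_mono[of B1 "B1 \<union> B'"] by blast
    ultimately have "(v - w) + w \<in> vm.span (B1 \<union> B')" by (rule vm.span_add)
    then show ?thesis by simp
  qed
  moreover have "B1 \<union> B' \<subseteq> N" using B1 B' by (auto simp: N'_def)
  moreover have "vm.span (B1 \<union> B') \<subseteq> N" using calculation sub by (intro vm.span_minimal)
  ultimately show ?case using B1 B' by (intro exI[of _ "B1 \<union> B'"]) auto
qed

text \<open>The degree \<open>z\<close> part of the direct sum of the twists
  \<open>S(-a k)\<close>.\<close>

definition vpart :: "(nat \<Rightarrow> int) \<Rightarrow> int \<Rightarrow> (nat \<Rightarrow> ('n::finite, 'k::field) mpoly) set" where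
  "vpart a z = {v. \<forall>k. v k \<in> hpart (z - a k)}"

definition vcomp :: "(nat \<Rightarrow> int) \<Rightarrow> int \<Rightarrow> (nat \<Rightarrow> ('n::finite, 'k::field) mpoly) \<Rightarrow> nat \<Rightarrow> ('n, 'k) mpoly" where
  "vcomp a z v = (\<lambda>k. hcomp (z - a k) (v k))"

lemma vcomp_in: "vcomp a z v \<in> vpart a z"
  by (simp add: vpart_def vcomp_def)

lemma vcomp_sum: "vcomp a z (sum f A) = (\<Sum>i\<in>A. vcomp a z (f i))"
  by (rule ext) (simp add: vcomp_def sum_fun_apply hcomp_sum)

lemma vcomp_vscale: "v \<in> vpart a y \<Longrightarrow> vcomp a z (vscale c v) = vscale (hcomp (z - y) c) v"
proof
  fix k assume "v \<in> vpart a y"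
  then have "v k \<in> hpart (y - a k)" by (simp add: vpart_def)
  from hcomp_mult[OF this, of "z - a k" c]
  show "vcomp a z (vscale c v) k = vscale (hcomp (z - y) c) v k"
    by (simp add: vcomp_def vscale_def mult.commute)
qed

lemma vector_sum_vcomp:
  assumes "v \<in> vsupp n"
  shows "\<exists>Z. finite Z \<and> v = (\<Sum>z\<in>Z. vcomp a z v)"
proof -
  define Z where "Z = (\<Union>k<n. (\<lambda>m. int (mdeg m) + a k) ` keys (v k))"
  have fin: "finite Z" by (simp add: Z_def)
  have "v k = (\<Sum>z\<in>Z. vcomp a z v k)" for k
  proof (rule poly_mapping_eqI)
    fix m
    have "int (mdeg m) + a k \<in> Z" if "lookup (v k) m \<noteq> 0"
    proof -
      have "k < n" using that assms by (metis (mono_tags, lifting) leI lookup_zero mem_Collect_eq vsupp_def)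
      moreover have "int (mdeg m) + a k \<in> (\<lambda>m. int (mdeg m) + a k) ` keys (v k)"
        using that by (intro imageI) (simp add: in_keys_iff)
      ultimately show ?thesis unfolding Z_def by blast
    qed
    then have "lookup (v k) m = (\<Sum>z\<in>Z. if z = int (mdeg m) + a k then lookup (v k) m else 0)"
      using fin by auto
    also have "\<dots> = (\<Sum>z\<in>Z. lookup (vcomp a z v k) m)"
      by (rule sum.cong) (auto simp: vcomp_def lookup_hcomp)
    finally show "lookup (v k) m = lookup (\<Sum>z\<in>Z. vcomp a z v k) m"
      by (simp add: lookup_sum)
  qed
  then show ?thesis using fin by (intro exI[of _ Z]) (auto simp: fun_eq_iff sum_fun_apply)
qed

text \<open>The generators are homogeneous and as few as possible. A relation in which some
  coefficient has a nonzero constant term would express that generator through the others.\<close>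

theorem minimal_generators:
  fixes N :: "(nat \<Rightarrow> ('n::finite, 'k::field) mpoly) set"
  assumes sub: "vm.subspace N" and supp: "N \<subseteq> vsupp n" and gr: "\<And>v z. v \<in> N \<Longrightarrow> vcomp a z v \<in> N"
  shows "\<exists>(q::nat) g b. (\<forall>k<q. g k \<in> N \<and> g k \<in> vpart a (b k)) \<and>
    N = range (\<lambda>c. \<Sum>k<q. vscale (c k) (g k)) \<and>
    (\<forall>c. (\<Sum>k<q. vscale (c k) (g k)) = 0 \<longrightarrow> (\<forall>k<q. lookup (c k) 0 = 0))"
proof -
  define P where "P B \<longleftrightarrow> finite B \<and> B \<subseteq> N \<and> (\<forall>v\<in>B. \<exists>z. v \<in> vpart a z) \<and> vm.span B = N" for B
  have "\<exists>B. P B"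
  proof -
    obtain B where B: "B \<subseteq> N" "finite B" "vm.span B = N"
      using submodule_finitely_generated[OF sub supp] by blast
    have "\<forall>v\<in>B. \<exists>Z. finite Z \<and> v = (\<Sum>z\<in>Z. vcomp a z v)"
      using B supp vector_sum_vcomp by blast
    then obtain Z where Z: "\<And>v. v \<in> B \<Longrightarrow> finite (Z v)" "\<And>v. v \<in> B \<Longrightarrow> v = (\<Sum>z\<in>Z v. vcomp a z v)"
      by metis
    define B' where "B' = (\<Union>v\<in>B. (\<lambda>z. vcomp a z v) ` Z v)"
    have B': "finite B'" "B' \<subseteq> N" "\<forall>v\<in>B'. \<exists>z. v \<in> vpart a z"
      using B Z gr by (auto simp: B'_def intro!: exI vcomp_in)
    have "B \<subseteq> vm.span B'"
    proof
      fix v assume v: "v \<in> B"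
      have "(\<Sum>z\<in>Z v. vcomp a z v) \<in> vm.span B'"
        using v by (intro vm.span_sum vm.span_base) (auto simp: B'_def)
      then show "v \<in> vm.span B'" using Z(2)[OF v] by simp
    qed
    then have "N \<subseteq> vm.span B'" using B by (metis vm.span_minimal vm.subspace_span)
    moreover have "vm.span B' \<subseteq> N" using B' sub by (intro vm.span_minimal)
    ultimately show ?thesis using B' by (auto simp: P_def)
  qed
  then obtain B where B: "P B" and min: "\<And>B'. P B' \<Longrightarrow> card B \<le> card B'"
    using ex_has_least_nat[of P _ card] by blast
  have rel: "lookup (c v) 0 = 0" if c: "(\<Sum>v\<in>B. vscale (c v) v) = 0" and v: "v \<in> B" for c v
  proof (rule ccontr)
    assume c0: "lookup (c v) 0 \<noteq> 0"
    obtain z where z: "\<And>v. v \<in> B \<Longrightarrow> v \<in> vpart a (z v)" using B unfolding P_def by metis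
    define x where "x = lookup (c v) 0"
    \<comment> \<open>The component of the relation in the degree of \<open>v\<close>: there the
      coefficient of \<open>v\<close> is the constant \<open>x\<close>, a unit.\<close>
    define c' where "c' w = hcomp (z v - z w) (c w)" for w
    have "(\<Sum>w\<in>B. vscale (c' w) w) = vcomp a (z v) (\<Sum>w\<in>B. vscale (c w) w)"
      unfolding vcomp_sum by (rule sum.cong[OF refl]) (simp only: vcomp_vscale[OF z] c'_def)
    also have "\<dots> = 0" using c by (auto simp: vcomp_def)
    finally have rel: "(\<Sum>w\<in>B. vscale (c' w) w) = 0" .
    have c'v: "c' v = single 0 x"
      unfolding c'_def x_def
      by (subst hpart_0_eq) (use hcomp_in[of 0 "c v"] in \<open>auto simp: lookup_hcomp\<close>)
    have fB: "finite B" using B by (simp add: P_def)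
    have "vscale (c' v) v + (\<Sum>w\<in>B - {v}. vscale (c' w) w) = 0"
      using rel v fB by (simp add: sum.remove)
    then have "vscale (c' v) v = - (\<Sum>w\<in>B - {v}. vscale (c' w) w)"
      by (simp add: eq_neg_iff_add_eq_0)
    moreover have "(\<Sum>w\<in>B - {v}. vscale (c' w) w) \<in> vm.span (B - {v})"
      by (intro vm.span_sum vm.span_scale vm.span_base)
    ultimately have "vscale (c' v) v \<in> vm.span (B - {v})" by (simp add: vm.span_neg)
    then have "vscale (single 0 (inverse x)) (vscale (c' v) v) \<in> vm.span (B - {v})"
      by (rule vm.span_scale)
    then have v_in: "v \<in> vm.span (B - {v})"
      using c0 by (simp add: c'v mult_single x_def)
    have "vm.span (B - {v}) = vm.span B"
    proof (rule antisym)
      show "vm.span B \<subseteq> vm.span (B - {v})"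
        using v_in by (intro vm.span_minimal) (auto intro: vm.span_base)
    qed (rule vm.span_mono, blast)
    then have "P (B - {v})" using B by (auto simp: P_def)
    from min[OF this] show False using fB v using card_Diff1_less[OF fB v] by simp
  qed
  have fB: "finite B" using B by (simp add: P_def)
  then obtain g where g: "bij_betw g {..<card B} B"
    using ex_bij_betw_nat_finite[of B] by (auto simp: atLeast0LessThan)
  have inj: "inj_on g {..<card B}" using g by (simp add: bij_betw_def)
  obtain z where z: "\<And>v. v \<in> B \<Longrightarrow> v \<in> vpart a (z v)" using B unfolding P_def by metis
  have gB: "g k \<in> B" if "k < card B" for k using g that by (auto simp: bij_betw_def)
  have reindex: "(\<Sum>k<card B. vscale (u (g k)) (g k)) = (\<Sum>v\<in>B. vscale (u v) v)" for u
    using sum.reindex_bij_betw[OF g, of "\<lambda>v. vscale (u v) v"] by simp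
  have reindex': "(\<Sum>k<card B. vscale (c k) (g k)) = (\<Sum>v\<in>B. vscale (c (the_inv_into {..<card B} g v)) v)" for c
    unfolding reindex[symmetric] by (rule sum.cong) (auto simp: the_inv_into_f_f[OF inj])
  have "N = range (\<lambda>u. \<Sum>v\<in>B. vscale (u v) v)"
    using B fB by (simp add: P_def flip: vm.span_finite)
  also have "\<dots> = range (\<lambda>c. \<Sum>k<card B. vscale (c k) (g k))"
  proof (intro antisym subsetI; elim rangeE)
    fix x u assume "x = (\<Sum>v\<in>B. vscale (u v) v)"
    then show "x \<in> range (\<lambda>c. \<Sum>k<card B. vscale (c k) (g k))"
      using reindex[of u] by (intro image_eqI[of _ _ "\<lambda>k. u (g k)"]) auto
  qed (auto simp: reindex')
  finally have "N = range (\<lambda>c. \<Sum>k<card B. vscale (c k) (g k))" .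
  moreover have "lookup (c k) 0 = 0" if "(\<Sum>k<card B. vscale (c k) (g k)) = 0" "k < card B" for c k
  proof -
    have "lookup (c (the_inv_into {..<card B} g (g k))) 0 = 0"
      using rel[of "\<lambda>v. c (the_inv_into {..<card B} g v)" "g k"] that reindex' gB by simp
    then show ?thesis using that by (simp add: the_inv_into_f_f[OF inj])
  qed
  moreover have "B \<subseteq> N" using B by (simp add: P_def)
  ultimately show ?thesis
    using gB z by (intro exI[of _ "card B"] exI[of _ g] exI[of _ "\<lambda>k. z (g k)"] conjI) auto
qed


section \<open>Chains of primes have bounded length\<close>

lemma prime_ideal_subspace: "prime_ideal P \<Longrightarrow> idl.subspace P"
  by (simp add: prime_ideal_def)

lemma prime_ideal_mult: "prime_ideal P \<Longrightarrow> a * b \<in> P \<Longrightarrow> a \<in> P \<or> b \<in> P"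
  by (simp add: prime_ideal_def)

lemma prime_ideal_one: "prime_ideal P \<Longrightarrow> 1 \<notin> P"
  using subspace_eq_UNIV by (auto simp: prime_ideal_def)

lemma prime_ideal_power: "prime_ideal P \<Longrightarrow> a ^ n \<in> P \<Longrightarrow> a \<in> P"
  by (induction n) (auto simp: prime_ideal_one dest: prime_ideal_mult)

lemma prime_ideal_prod:
  "finite A \<Longrightarrow> prime_ideal P \<Longrightarrow> prod f A \<in> P \<Longrightarrow> \<exists>i\<in>A. f i \<in> P"
  by (induction A rule: finite_induct) (auto simp: prime_ideal_one dest: prime_ideal_mult)

definition degree_le :: "nat \<Rightarrow> ('n::finite, 'k::field) mpoly set" where
  "degree_le d = {f. \<forall>m\<in>keys f. mdeg m \<le> d}"

lemma degree_le_mult: "f \<in> degree_le d \<Longrightarrow> g \<in> degree_le e \<Longrightarrow> f * g \<in> degree_le (d + e)"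
  using keys_mult[of f g] by (fastforce simp: degree_le_def intro: add_mono)

lemma degree_le_mono: "f \<in> degree_le d \<Longrightarrow> d \<le> e \<Longrightarrow> f \<in> degree_le e"
  by (force simp: degree_le_def)

lemma degree_le_one: "1 \<in> degree_le d"
  by (simp add: degree_le_def)

lemma degree_le_power: "f \<in> degree_le e \<Longrightarrow> f ^ k \<in> degree_le (k * e)"
  by (induction k) (auto simp: degree_le_one intro: degree_le_mult)

lemma degree_le_exists: "\<exists>e. f \<in> degree_le e"
proof
  show "f \<in> degree_le (\<Sum>m\<in>keys f. mdeg m)"
    by (auto simp: degree_le_def intro: member_le_sum)
qed

text \<open>Linear independence of the classes in \<open>S/P\<close>, stated for a family so that
  sizes can be counted on the index set.\<close>

definition indep_mod :: "('n::finite, 'k::field) mpoly set \<Rightarrow> 'i set \<Rightarrow> ('i \<Rightarrow> ('n, 'k) mpoly) \<Rightarrow> bool" where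
  "indep_mod P A u \<longleftrightarrow> (\<forall>c. (\<Sum>i\<in>A. scale (c i) (u i)) \<in> P \<longrightarrow> (\<forall>i\<in>A. c i = 0))"

lemma ideal_S_subspace: "idl.subspace I \<Longrightarrow> S.subspace I"
  by (auto simp: S.subspace_def idl.subspace_0 idl.subspace_add idl.subspace_scale scale_def)

lemma scale_in_subspaceD:
  assumes "S.subspace W" "scale c f \<in> W" "f \<notin> W"
  shows "c = 0"
proof (rule ccontr)
  assume "c \<noteq> 0"
  then have "f = scale (inverse c) (scale c f)" by simp
  then show False using assms S.subspace_scale by metis
qed

lemma indep_mod_inj:
  fixes W :: "('n::finite, 'k::field) mpoly set"
  assumes "finite A" "indep_mod W A u" "0 \<in> W"
  shows "inj_on u A"
proof (rule inj_onI, rule ccontr)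
  fix i j assume ij: "i \<in> A" "j \<in> A" "u i = u j" "i \<noteq> j"
  define c :: "_ \<Rightarrow> 'k" where "c l = (if l = i then 1 else if l = j then -1 else 0)" for l
  have "(\<Sum>l\<in>A. scale (c l) (u l)) = (\<Sum>l\<in>{i, j}. scale (c l) (u l))"
    using ij assms(1) by (intro sum.mono_neutral_right) (auto simp: c_def)
  also have "\<dots> = 0" using ij by (simp add: c_def)
  finally have "(\<Sum>l\<in>A. scale (c l) (u l)) \<in> W" using assms(3) by simp
  then have "c i = 0" using assms(2) ij unfolding indep_mod_def by blast
  then show False by (simp add: c_def)
qed

text \<open>In a relation the \<open>C\<close>-part lies in \<open>W\<close>, so the
  \<open>u\<close>-part does too and its coefficients vanish; then those of \<open>C\<close> vanish.
  Counting in a quotient is thereby reduced to counting in \<open>S\<close>.\<close>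

lemma indep_mod_independent:
  fixes W :: "('n::finite, 'k::field) mpoly set"
  assumes A: "finite A" "indep_mod W A u" and W: "S.subspace W" and C: "finite C" "C \<subseteq> W" "S.independent C"
  shows "S.independent (u ` A \<union> C)" "card (u ` A \<union> C) = card A + card C"
proof -
  have W0: "0 \<in> W" using W by (rule S.subspace_0)
  note inj = indep_mod_inj[OF A W0]
  have disj: "u ` A \<inter> C = {}"
  proof (rule ccontr)
    assume "u ` A \<inter> C \<noteq> {}"
    then obtain i where i: "i \<in> A" "u i \<in> W" using C by blast
    have "(\<Sum>l\<in>A. scale (if l = i then 1 else 0) (u l)) = u i"
      using i A(1) by (simp add: if_distrib[of "\<lambda>c. scale c _"] cong: if_cong)
    then have "(if i = i then 1 else 0 :: 'k) = 0"
      using spec[OF A(2)[unfolded indep_mod_def], of "\<lambda>l. if l = i then 1 else 0"] i by metis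
    then show False by simp
  qed
  show "card (u ` A \<union> C) = card A + card C"
    using A C disj by (simp add: card_Un_disjoint card_image[OF inj])
  show "S.independent (u ` A \<union> C)"
  proof
    assume "S.dependent (u ` A \<union> C)"
    then obtain c where c: "\<exists>v\<in>u ` A \<union> C. c v \<noteq> 0" "(\<Sum>v\<in>u ` A \<union> C. scale (c v) v) = 0"
      using S.dependent_finite[of "u ` A \<union> C"] A(1) C(1) by auto
    have eq: "(\<Sum>i\<in>A. scale (c (u i)) (u i)) + (\<Sum>v\<in>C. scale (c v) v) = 0"
      using c(2) A(1) C(1) disj by (simp add: sum.union_disjoint sum.reindex[OF inj])
    have CW: "(\<Sum>v\<in>C. scale (c v) v) \<in> W"
      using C by (intro S.subspace_sum[OF W] S.subspace_scale[OF W]) auto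
    have "(\<Sum>i\<in>A. scale (c (u i)) (u i)) = - (\<Sum>v\<in>C. scale (c v) v)" using eq by (simp add: eq_neg_iff_add_eq_0)
    then have "(\<Sum>i\<in>A. scale (c (u i)) (u i)) \<in> W" using S.subspace_neg[OF W CW] by simp
    then have cA: "\<forall>i\<in>A. c (u i) = 0" using A(2) unfolding indep_mod_def by (elim allE[of _ "\<lambda>i. c (u i)"] impE)
    then have "(\<Sum>v\<in>C. scale (c v) v) = 0" using eq by simp
    then have "\<forall>v\<in>C. c v = 0" using S.dependent_finite[OF C(1)] C(3) by blast
    then show False using cA c(1) by blast
  qed
qed

lemma scale_mult_right: "scale c (f * g) = f * scale c g"
  unfolding scale_def by (rule mult.left_commute)

text \<open>Modulo \<open>Q\<close> only the terms with \<open>k = 0\<close> survive, so their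
  coefficients vanish. What remains is divisible by \<open>g\<close>, which cancels modulo the prime
  \<open>P\<close>, and \<open>N\<close> has dropped by one.\<close>

lemma indep_mod_step:
  fixes P Q :: "('n::finite, 'k::field) mpoly set"
  assumes P: "prime_ideal P" and Q: "prime_ideal Q" "P \<subseteq> Q" and g: "g \<in> Q" "g \<notin> P"
    and A: "finite A" and ind: "indep_mod Q A u"
  shows "indep_mod P ({..N} \<times> A) (\<lambda>(k, i). g ^ k * u i)"
proof -
  have *: "\<forall>k\<le>N. \<forall>i\<in>A. c k i = 0" if "(\<Sum>k\<le>N. \<Sum>i\<in>A. scale (c k i) (g ^ k * u i)) \<in> P" for c N
    using that
  proof (induction N arbitrary: c)
    case 0
    then have "(\<Sum>i\<in>A. scale (c 0 i) (u i)) \<in> Q" using Q by auto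
    then show ?case using ind by (auto simp: indep_mod_def)
  next
    case (Suc N)
    define R where "R = (\<Sum>k\<le>N. \<Sum>i\<in>A. scale (c (Suc k) i) (g ^ k * u i))"
    have eq: "(\<Sum>k\<le>Suc N. \<Sum>i\<in>A. scale (c k i) (g ^ k * u i)) =
        (\<Sum>i\<in>A. scale (c 0 i) (u i)) + g * R"
      unfolding R_def sum.atMost_Suc_shift sum_distrib_left scale_mult_right[symmetric] power_Suc mult.assoc
        power_0 mult_1 ..
    have "(\<Sum>i\<in>A. scale (c 0 i) (u i)) + g * R \<in> Q" using Suc.prems eq Q by auto
    moreover have "g * R \<in> Q"
      using g idl.subspace_scale[OF prime_ideal_subspace[OF Q(1)], of g R] by (simp add: mult.commute)
    ultimately have "(\<Sum>i\<in>A. scale (c 0 i) (u i)) + g * R - g * R \<in> Q"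
      by (rule idl.subspace_diff[OF prime_ideal_subspace[OF Q(1)]])
    then have c0: "\<forall>i\<in>A. c 0 i = 0" using ind by (simp add: indep_mod_def)
    then have "g * R \<in> P" using Suc.prems eq by simp
    then have "R \<in> P" using g prime_ideal_mult[OF P] by blast
    from Suc.IH[OF this[unfolded R_def]] have "\<forall>k\<le>N. \<forall>i\<in>A. c (Suc k) i = 0" .
    then show ?case using c0 by (metis Suc_le_mono not0_implies_Suc)
  qed
  show ?thesis
    unfolding indep_mod_def
  proof (intro allI impI ballI)
    fix c ki assume c: "(\<Sum>ki\<in>{..N} \<times> A. scale (c ki) (case ki of (k, i) \<Rightarrow> g ^ k * u i)) \<in> P"
      and ki: "ki \<in> {..N} \<times> A"
    have "(\<Sum>k\<le>N. \<Sum>i\<in>A. scale (c (k, i)) (g ^ k * u i)) \<in> P"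
      using c A by (simp add: sum.cartesian_product split_def)
    from *[OF this] show "c ki = 0" using ki by auto
  qed
qed

text \<open>Each step of the chain contributes powers of one element of the larger prime outside the
  smaller: \<open>n\<close> exponents up to \<open>N\<close> give \<open>(N + 1) ^ n\<close>
  products whose degree is linear in \<open>N\<close>. The exponents form lists because the index
  type must not depend on \<open>n\<close>.\<close>

lemma chain_independent:
  fixes P :: "nat \<Rightarrow> ('n::finite, 'k::field) mpoly set"
  assumes "prime_chain n P"
  shows "\<exists>e. \<forall>N. \<exists>(A :: nat list set) u. finite A \<and> card A = (N + 1) ^ n \<and> indep_mod (P 0) A u \<and>
    (\<forall>i\<in>A. u i \<in> degree_le (e * N))"
  using assms
proof (induction n arbitrary: P)
  case 0
  have "indep_mod (P 0) {[] :: nat list} (\<lambda>_. 1)"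
    unfolding indep_mod_def
  proof (intro allI impI ballI)
    fix c :: "nat list \<Rightarrow> 'k" and i assume c: "(\<Sum>i\<in>{[] :: nat list}. scale (c i) 1) \<in> P 0" and i: "i \<in> {[] :: nat list}"
    have P0: "prime_ideal (P 0)" using 0 by (simp add: prime_chain_def)
    show "c i = 0"
    proof (rule ccontr)
      assume "c i \<noteq> 0"
      then have "single 0 (inverse (c [])) * scale (c []) 1 = 1" using i by (simp add: scale_def mult_single)
      moreover have "single 0 (inverse (c [])) * scale (c []) 1 \<in> P 0"
        using c idl.subspace_scale[OF prime_ideal_subspace[OF P0]] by simp
      ultimately show False using prime_ideal_one[OF P0] by metis
    qed
  qed
  then have "\<forall>N. \<exists>(A :: nat list set) u. finite A \<and> card A = (N + 1) ^ 0 \<and> indep_mod (P 0) A u \<and>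
    (\<forall>i\<in>A. u i \<in> degree_le (0 * N))"
    by (intro allI exI[of _ "{[]}"] exI[of _ "\<lambda>_. 1"]) (simp add: degree_le_one)
  then show ?case by blast
next
  case (Suc n)
  have "prime_chain n (\<lambda>i. P (Suc i))" using Suc.prems by (auto simp: prime_chain_def)
  from Suc.IH[OF this] obtain e where e: "\<And>N. \<exists>(A :: nat list set) u. finite A \<and> card A = (N + 1) ^ n \<and>
      indep_mod (P (Suc 0)) A u \<and> (\<forall>i\<in>A. u i \<in> degree_le (e * N))" by auto
  have P: "prime_ideal (P 0)" "prime_ideal (P (Suc 0))" "P 0 \<subset> P (Suc 0)"
    using Suc.prems by (auto simp: prime_chain_def)
  then obtain g where g: "g \<in> P (Suc 0)" "g \<notin> P 0" by blast
  obtain d where d: "g \<in> degree_le d" using degree_le_exists by blast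
  show ?case
  proof (intro exI[of _ "d + e"] allI)
    fix N
    obtain A :: "nat list set" and u where A: "finite A" "card A = (N + 1) ^ n"
      "indep_mod (P (Suc 0)) A u" "\<And>i. i \<in> A \<Longrightarrow> u i \<in> degree_le (e * N)" using e by metis
    define A' where "A' = (\<lambda>(k, i). k # i) ` ({..N} \<times> A)"
    define u' where "u' l = g ^ hd l * u (tl l)" for l
    have inj: "inj_on (\<lambda>(k, i). k # i) ({..N} \<times> A)" by (auto simp: inj_on_def)
    have "card A' = (N + 1) ^ Suc n"
      using A by (simp add: A'_def card_image[OF inj] card_cartesian_product)
    moreover have "indep_mod (P 0) A' u'"
      unfolding indep_mod_def
    proof (intro allI impI)
      fix c assume "(\<Sum>l\<in>A'. scale (c l) (u' l)) \<in> P 0"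
      then have "(\<Sum>ki\<in>{..N} \<times> A. scale (c (fst ki # snd ki)) (case ki of (k, i) \<Rightarrow> g ^ k * u i)) \<in> P 0"
        unfolding A'_def sum.reindex[OF inj] by (simp add: split_def u'_def comp_def)
      then have "\<forall>ki\<in>{..N} \<times> A. c (fst ki # snd ki) = 0"
        by (rule mp[OF spec[OF indep_mod_step[OF P(1,2) psubset_imp_subset[OF P(3)] g A(1,3), of N,
          unfolded indep_mod_def], of "\<lambda>ki. c (fst ki # snd ki)"]])
      then show "\<forall>l\<in>A'. c l = 0" by (auto simp: A'_def)
    qed
    moreover have "u' l \<in> degree_le ((d + e) * N)" if l_in: "l \<in> A'" for l
    proof -
      obtain k i where l: "l = k # i" "k \<le> N" "i \<in> A" using l_in by (auto simp: A'_def)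
      have "u' l \<in> degree_le (k * d + e * N)"
        using l A(4) degree_le_power[OF d] by (auto simp: u'_def intro: degree_le_mult)
      moreover have "k * d + e * N \<le> (d + e) * N" using l by (simp add: algebra_simps)
      ultimately show ?thesis using degree_le_mono by blast
    qed
    moreover have "finite A'" using A by (simp add: A'_def)
    ultimately show "\<exists>(A :: nat list set) u. finite A \<and> card A = (N + 1) ^ Suc n \<and> indep_mod (P 0) A u \<and>
        (\<forall>i\<in>A. u i \<in> degree_le ((d + e) * N))" by blast
  qed
qed

lemma degree_le_span: "f \<in> degree_le d \<Longrightarrow> f \<in> S.span ((\<lambda>m. single m 1) ` {m. mdeg m \<le> d})"
proof (subst mpoly_as_sum, rule S.span_sum)
  fix m assume "f \<in> degree_le d" "m \<in> keys f"
  then have "scale (lookup f m) (single m 1) \<in> S.span ((\<lambda>m. single m 1) ` {m. mdeg m \<le> d})"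
    by (intro S.span_scale S.span_base) (auto simp: degree_le_def)
  then show "single m (lookup f m) \<in> S.span ((\<lambda>m. single m 1) ` {m. mdeg m \<le> d})"
    by (simp add: scale_def mult_single)
qed

lemma card_mdeg_le: "card {m :: 'n::finite \<Rightarrow>\<^sub>0 nat. mdeg m \<le> d} \<le> (d + 1) ^ card (UNIV :: 'n set)"
proof -
  have "card {m :: 'n \<Rightarrow>\<^sub>0 nat. mdeg m \<le> d} \<le> card (PiE (UNIV :: 'n set) (\<lambda>_. {..d}))"
    by (rule card_inj_on_le[of lookup, OF _ lookup_mdeg_le]) (auto simp: inj_lookup intro: finite_PiE)
  then show ?thesis by (simp add: card_PiE)
qed

text \<open>A comparison of growth: the independent family has \<open>(N + 1) ^ n\<close> members in
  degree at most \<open>e * N\<close>, where there are at most \<open>(e * N + 1) ^ s\<close>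
  monomials.\<close>

theorem prime_chain_bound:
  fixes P :: "nat \<Rightarrow> ('n::finite, 'k::field) mpoly set"
  assumes "prime_chain n P"
  shows "n \<le> card (UNIV :: 'n set)"
proof (rule ccontr)
  assume n: "\<not> n \<le> card (UNIV :: 'n set)"
  define s where "s = card (UNIV :: 'n set)"
  obtain e where e: "\<And>N. \<exists>(A :: nat list set) u. finite A \<and> card A = (N + 1) ^ n \<and> indep_mod (P 0) A u \<and>
    (\<forall>i\<in>A. u i \<in> degree_le (e * N))" using chain_independent[OF assms] by blast
  have P0: "S.subspace (P 0)"
    using assms by (intro ideal_S_subspace prime_ideal_subspace) (simp add: prime_chain_def)
  \<comment> \<open>With this \<open>N\<close> the comparison becomes
    \<open>(N + 1) ^ n \<le> N * (N + 1) ^ s\<close>, which fails for \<open>n > s\<close>.\<close>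
  define N where "N = (e + 1) ^ s"
  obtain A :: "nat list set" and u where A: "finite A" "card A = (N + 1) ^ n" "indep_mod (P 0) A u"
    "\<And>i. i \<in> A \<Longrightarrow> u i \<in> degree_le (e * N)" using e by metis
  have ind: "S.independent (u ` A)" "card (u ` A) = card A"
    using indep_mod_independent[OF A(1,3) P0, of "{}"] S.independent_empty by simp_all
  have "u ` A \<subseteq> S.span ((\<lambda>m. single m 1) ` {m. mdeg m \<le> e * N})"
    using A(4) degree_le_span by blast
  with ind(1) have "card (u ` A) \<le> card ((\<lambda>m. single m (1::'k)) ` {m :: 'n \<Rightarrow>\<^sub>0 nat. mdeg m \<le> e * N})"
    using S.independent_span_bound[of "(\<lambda>m. single m 1) ` {m. mdeg m \<le> e * N}" "u ` A"] finite_mdeg_le by blast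
  also have "\<dots> \<le> card {m :: 'n \<Rightarrow>\<^sub>0 nat. mdeg m \<le> e * N}"
    by (rule card_image_le[OF finite_mdeg_le])
  also have "\<dots> \<le> (e * N + 1) ^ s" unfolding s_def by (rule card_mdeg_le)
  also have "\<dots> \<le> ((e + 1) * (N + 1)) ^ s" by (rule power_mono) auto
  finally have "(N + 1) ^ n \<le> N * (N + 1) ^ s"
    unfolding ind(2) A(2) power_mult_distrib N_def .
  also have "\<dots> < (N + 1) ^ Suc s" by simp
  also have "\<dots> \<le> (N + 1) ^ n" using n by (intro power_increasing) (auto simp: s_def)
  finally show False by simp
qed

section \<open>Heights of primes\<close>

lemma prime_chain_extend:
  assumes "prime_chain n P" "P n \<subset> Q" "prime_ideal Q"
  shows "prime_chain (Suc n) (P(Suc n := Q))"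
  using assms by (auto simp: prime_chain_def less_Suc_eq le_Suc_eq)

lemma height_le_card:
  fixes p :: "('n::finite, 'k::field) mpoly set"
  shows "height p \<le> enat (card (UNIV :: 'n set))"
  unfolding height_def by (rule Sup_least) (auto dest: prime_chain_bound)

text \<open>Every chain ending in \<open>p\<close> extends by \<open>q\<close>. Strictness requires
  \<open>height q\<close> to be finite, which the bound on chain lengths provides.\<close>

lemma height_less:
  fixes p q :: "('n::finite, 'k::field) mpoly set"
  assumes p: "prime_ideal p" and q: "prime_ideal q" and "p \<subset> q"
  shows "height p < height q"
proof -
  obtain h where h: "height q = enat h" using height_le_card[of q] by (metis enat_ile)
  have "n < h" if "prime_chain n P" "P n = p" for n P
  proof -
    have "prime_chain (Suc n) (P(Suc n := q))" using prime_chain_extend that assms by blast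
    then have "enat (Suc n) \<in> {enat n |n P. prime_chain n P \<and> P n = q}"
      by (intro CollectI exI[of _ "Suc n"] exI[of _ "P(Suc n := q)"]) simp
    then have "enat (Suc n) \<le> height q" unfolding height_def by (rule Sup_upper)
    then show ?thesis by (simp add: h)
  qed
  note lt = this
  have "prime_chain 0 (\<lambda>_. p)" using p by (simp add: prime_chain_def)
  then have "0 < h" using lt[of 0 "\<lambda>_. p"] by simp
  have "height p \<le> enat (h - 1)"
    unfolding height_def by (rule Sup_least) (use lt in fastforce)
  also have "\<dots> < enat h" using \<open>0 < h\<close> by simp
  finally show ?thesis by (simp add: h)
qed

section \<open>Associated primes of graded ideals\<close>

lemma colon_subspace: "idl.subspace I \<Longrightarrow> idl.subspace (colon I f)"
  by (simp only: idl.subspace_def colon_def mem_Collect_eq distrib_right mult.assoc mult_zero_left) blast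

lemma colon_graded:
  assumes I: "graded_ideal I" and f: "f \<in> hpart z"
  shows "graded_ideal (colon I f)"
proof (rule graded_idealI[OF colon_subspace[OF graded_ideal_subspace[OF I]]])
  fix g w assume "g \<in> colon I f"
  then have "hcomp (w + z) (f * g) \<in> I"
    using I by (auto simp: colon_def mult.commute intro: graded_ideal_hcomp)
  then show "hcomp w g \<in> colon I f" by (simp add: hcomp_mult[OF f] colon_def mult.commute)
qed

lemma colon_eq_UNIV_iff: "idl.subspace I \<Longrightarrow> colon I f = UNIV \<longleftrightarrow> f \<in> I"
  by (auto simp: colon_def idl.subspace_scale dest: arg_cong[where f = "\<lambda>A. 1 \<in> A"])

lemma colon_colon: "colon (colon I f) g = colon I (g * f)"
  by (simp only: colon_def mem_Collect_eq mult.assoc)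

lemma subset_colon: "idl.subspace I \<Longrightarrow> I \<subseteq> colon I f"
  using idl.subspace_scale[of I _ f] by (auto simp: colon_def mult.commute)

lemma colon_mono_mult: "idl.subspace I \<Longrightarrow> colon I f \<subseteq> colon I (g * f)"
  using idl.subspace_scale[of I _ g] unfolding colon_def mult.left_commute[of _ g] by blast

lemma colon_prime: "prime_ideal P \<Longrightarrow> f \<notin> P \<Longrightarrow> colon P f = P"
  using subset_colon[OF prime_ideal_subspace] prime_ideal_mult by (fastforce simp: colon_def)

lemma Ass_prime: "p \<in> Ass I \<Longrightarrow> prime_ideal p"
  by (simp add: Ass_def)

lemma Ass_superset: "idl.subspace I \<Longrightarrow> p \<in> Ass I \<Longrightarrow> I \<subseteq> p"
  using subset_colon by (auto simp: Ass_def)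

lemma hcomp_mult_sum:
  "hcomp w (a * b) = (\<Sum>z\<in>(\<lambda>m. int (mdeg m)) ` keys a. hcomp z a * hcomp (w - z) b)"
proof -
  have "hcomp w (a * b) = hcomp w ((\<Sum>z\<in>(\<lambda>m. int (mdeg m)) ` keys a. hcomp z a) * b)"
    by (simp flip: sum_hcomp)
  also have "\<dots> = (\<Sum>z\<in>(\<lambda>m. int (mdeg m)) ` keys a. hcomp w (hcomp z a * b))"
    by (simp add: sum_distrib_right hcomp_sum)
  finally show ?thesis by (simp add: hcomp_mult[OF hcomp_in])
qed

lemma lowest_component:
  assumes P: "graded_ideal P" and f: "f \<notin> P"
  shows "\<exists>z. hcomp z f \<notin> P \<and> (\<forall>y<z. hcomp y f \<in> P)"
proof -
  let ?Z = "(\<lambda>m. int (mdeg m)) ` keys f"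
  define A where "A = {z \<in> ?Z. hcomp z f \<notin> P}"
  have sub: "idl.subspace P" using P by (rule graded_ideal_subspace)
  have "A \<noteq> {}"
  proof
    assume "A = {}"
    then have "(\<Sum>z\<in>?Z. hcomp z f) \<in> P" by (intro idl.subspace_sum[OF sub]) (auto simp: A_def)
    then show False using f by (simp flip: sum_hcomp)
  qed
  moreover have fin: "finite A" by (simp add: A_def)
  ultimately have "Min A \<in> A" by simp
  moreover have "hcomp y f \<in> P" if "y < Min A" for y
  proof (cases "y \<in> ?Z")
    case True
    have "y \<notin> A" using that fin Min_le leD by blast
    with True show ?thesis by (simp add: A_def)
  next
    case False
    then have "hcomp y f = 0" by (rule hcomp_eq_0)
    then show ?thesis using sub by (simp add: idl.subspace_0)
  qed
  ultimately show ?thesis unfolding A_def by blast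
qed

text \<open>If \<open>a\<close> and \<open>b\<close> lie outside \<open>P\<close>, take their lowest
  components outside \<open>P\<close>. In the component of \<open>a * b\<close> of the total degree,
  every other product has a factor in \<open>P\<close>, so the product of these two components lies
  in \<open>P\<close>.\<close>

lemma graded_primeI:
  assumes P: "graded_ideal P" "P \<noteq> UNIV"
    and h: "\<And>a b y z. a \<in> hpart y \<Longrightarrow> b \<in> hpart z \<Longrightarrow> a * b \<in> P \<Longrightarrow> a \<in> P \<or> b \<in> P"
  shows "prime_ideal P"
proof -
  have sub: "idl.subspace P" using P by (simp add: graded_ideal_subspace)
  have "a \<in> P \<or> b \<in> P" if ab: "a * b \<in> P" for a b
  proof (rule ccontr)
    assume "\<not> (a \<in> P \<or> b \<in> P)"
    then obtain y z where y: "hcomp y a \<notin> P" "\<And>x. x < y \<Longrightarrow> hcomp x a \<in> P"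
      and z: "hcomp z b \<notin> P" "\<And>x. x < z \<Longrightarrow> hcomp x b \<in> P"
      using lowest_component[OF P(1)] by metis
    let ?Z = "(\<lambda>m. int (mdeg m)) ` keys a"
    have "y \<in> ?Z"
    proof (rule ccontr)
      assume "y \<notin> ?Z"
      then have "hcomp y a = 0" by (rule hcomp_eq_0)
      then show False using y sub by (simp add: idl.subspace_0)
    qed
    have "hcomp (y + z) (a * b) \<in> P" using P ab by (auto intro: graded_ideal_hcomp)
    then have "hcomp y a * hcomp z b + (\<Sum>x\<in>?Z - {y}. hcomp x a * hcomp (y + z - x) b) \<in> P"
      unfolding hcomp_mult_sum using \<open>y \<in> ?Z\<close> by (subst (asm) sum.remove) auto
    moreover have "(\<Sum>x\<in>?Z - {y}. hcomp x a * hcomp (y + z - x) b) \<in> P"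
    proof (rule idl.subspace_sum[OF sub])
      fix x assume "x \<in> ?Z - {y}"
      then consider "x < y" | "y + z - x < z" by force
      then show "hcomp x a * hcomp (y + z - x) b \<in> P"
      proof cases
        case 1
        then show ?thesis
          using idl.subspace_scale[OF sub y(2)] by (subst mult.commute)
      next
        case 2
        then show ?thesis using idl.subspace_scale[OF sub z(2)] by simp
      qed
    qed
    ultimately have "hcomp y a * hcomp z b + (\<Sum>x\<in>?Z - {y}. hcomp x a * hcomp (y + z - x) b)
        - (\<Sum>x\<in>?Z - {y}. hcomp x a * hcomp (y + z - x) b) \<in> P"
      by (rule idl.subspace_diff[OF sub])
    then have "hcomp y a * hcomp z b \<in> P" by simp
    then show False using h[OF hcomp_in hcomp_in] y z by blast
  qed
  then show ?thesis using P sub by (auto simp: prime_ideal_def)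
qed

text \<open>A maximal annihilator is prime. Only multiples of \<open>f\<close> by forms compete, so
  the annihilators are graded and primality need only be tested on forms.\<close>

lemma Ass_above:
  fixes I :: "('n::finite, 'k::field) mpoly set"
  assumes I: "graded_ideal I" and f: "f \<in> hpart z" "f \<notin> I"
  shows "\<exists>g w. g \<in> hpart w \<and> colon I (g * f) \<in> Ass I"
proof -
  have sub: "idl.subspace I" using I by (rule graded_ideal_subspace)
  define F where "F = {colon I (g * f) | g w. g \<in> hpart w \<and> g * f \<notin> I}"
  have "colon I (1 * f) \<in> F"
    unfolding F_def by (intro CollectI exI[of _ 1] exI[of _ 0] conjI) (use f in auto)
  then have "\<exists>M\<in>F. \<forall>J\<in>F. M \<subseteq> J \<longrightarrow> J = M"
    by (intro noetherian_maximal) (auto simp: F_def colon_subspace sub)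
  then obtain M where M: "M \<in> F" and max': "\<And>J. J \<in> F \<Longrightarrow> M \<subseteq> J \<Longrightarrow> J = M" by blast
  obtain g w where g: "g \<in> hpart w" "g * f \<notin> I" and Meq: "M = colon I (g * f)"
    using M unfolding F_def by blast
  note max = max'[unfolded Meq]
  have "prime_ideal (colon I (g * f))"
  proof (rule graded_primeI)
    show "graded_ideal (colon I (g * f))" using colon_graded[OF I hpart_mult[OF g(1) f(1)]] .
    show "colon I (g * f) \<noteq> UNIV" using colon_eq_UNIV_iff[OF sub] g by blast
    fix a b x y assume ab: "a \<in> hpart x" "b \<in> hpart y" "a * b \<in> colon I (g * f)"
    show "a \<in> colon I (g * f) \<or> b \<in> colon I (g * f)"
    proof (rule disjCI)
      assume "b \<notin> colon I (g * f)"
      then have "(b * g) * f \<notin> I" by (simp only: colon_def mem_Collect_eq mult.assoc not_False_eq_True)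
      then have "colon I ((b * g) * f) \<in> F" unfolding F_def using hpart_mult[OF ab(2) g(1)] by blast
      moreover have "colon I (g * f) \<subseteq> colon I ((b * g) * f)"
        using colon_mono_mult[OF sub, of "g * f" b] by (simp add: mult.assoc)
      ultimately have "colon I ((b * g) * f) = colon I (g * f)" using max by blast
      moreover have "a \<in> colon I ((b * g) * f)" using ab(3) by (simp only: colon_def mem_Collect_eq mult.assoc)
      ultimately show "a \<in> colon I (g * f)" by simp
    qed
  qed
  then show ?thesis using g by (auto simp: Ass_def)
qed

text \<open>The chain \<open>colon I (u ^ n)\<close> stabilises. If then \<open>u ^ n\<close> were
  outside \<open>I\<close>, some \<open>g * u ^ n\<close> would have an associated prime as
  annihilator; it contains \<open>u\<close>, and stability puts \<open>g * u ^ n\<close> itself into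
  \<open>I\<close>.\<close>

lemma power_in_graded_ideal:
  fixes I :: "('n::finite, 'k::field) mpoly set"
  assumes I: "graded_ideal I" and u: "u \<in> hpart z" "\<And>p. p \<in> Ass I \<Longrightarrow> u \<in> p"
  shows "\<exists>k. u ^ k \<in> I"
proof -
  have sub: "idl.subspace I" using I by (rule graded_ideal_subspace)
  obtain n where n: "colon I (u ^ Suc n) = colon I (u ^ n)"
    using noetherian_chain[of "\<lambda>n. colon I (u ^ n)"] colon_mono_mult[OF sub] colon_subspace[OF sub]
    by auto
  have "u ^ n \<in> I"
  proof (rule ccontr)
    assume "u ^ n \<notin> I"
    then obtain g where g: "colon I (g * u ^ n) \<in> Ass I"
      using Ass_above[OF I hpart_power[OF u(1)]] by blast
    then have "u * (g * u ^ n) \<in> I" using u(2) by (auto simp: colon_def)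
    then have "g \<in> colon I (u ^ Suc n)" by (simp only: colon_def mem_Collect_eq power_Suc mult_ac)
    then have "g * u ^ n \<in> I" using n by (auto simp: colon_def)
    then have "colon I (g * u ^ n) = UNIV" using colon_eq_UNIV_iff[OF sub] by blast
    then show False using g by (auto simp: Ass_def prime_ideal_def)
  qed
  then show ?thesis by blast
qed

section \<open>The structure of Geramita ideals\<close>

locale geramita_ideal =
  fixes I :: "('n::finite, 'k::field) mpoly set"
  assumes geramita: "geramita I"
begin

lemma graded: "graded_ideal I" and proper: "I \<noteq> UNIV" and dim_1: "quot_krull_dim I = 1"
  and unmixed: "unmixed I"
  and linear_gens: "p \<in> Ass I \<Longrightarrow> \<exists>L\<subseteq>hpart 1. p = idl.span L"
  using geramita by (auto simp: geramita_def graded_part_eq)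

lemma subspace: "idl.subspace I"
  using graded by (rule graded_ideal_subspace)

lemma Ass_nonempty: "Ass I \<noteq> {}"
proof -
  have "1 \<notin> I" using subspace_eq_UNIV[OF subspace] proper by blast
  then show ?thesis using Ass_above[OF graded hpart_one] by blast
qed

lemma no_long_chain:
  assumes "prime_chain n P" "I \<subseteq> P 0"
  shows "n \<le> 1"
proof -
  have "enat n \<le> quot_krull_dim I"
    unfolding quot_krull_dim_def by (rule Sup_upper) (use assms in blast)
  then show ?thesis by (simp add: dim_1 one_enat_def)
qed

lemma no_chain_2:
  assumes "prime_ideal p" "prime_ideal q" "prime_ideal r" "p \<subset> q" "q \<subset> r" "I \<subseteq> p"
  shows False
proof -
  have "prime_chain 2 (\<lambda>i. if i = 0 then p else if i = 1 then q else r)"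
    using assms by (auto simp: prime_chain_def less_Suc_eq numeral_2_eq_2)
  from no_long_chain[OF this] show False using assms by simp
qed

lemma Ass_irrelevant: "p \<in> Ass I \<Longrightarrow> p \<subseteq> irrelevant"
proof -
  assume "p \<in> Ass I"
  then obtain L where L: "L \<subseteq> hpart 1" "p = idl.span L" using linear_gens by blast
  have "L \<subseteq> irrelevant" using L hpart_irrelevant by fastforce
  then show ?thesis unfolding L(2) by (intro idl.span_minimal irrelevant_subspace)
qed

text \<open>Heights increase strictly along inclusions, so by unmixedness \<open>irrelevant\<close>
  would be the only associated prime. Then every variable is nilpotent modulo \<open>I\<close>,
  every prime over \<open>I\<close> contains \<open>irrelevant\<close>, and the dimension is 0
  instead of 1.\<close>

lemma irrelevant_not_Ass: "irrelevant \<notin> Ass I"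
proof
  assume irr: "irrelevant \<in> Ass I"
  have only: "p = irrelevant" if "p \<in> Ass I" for p
  proof (rule ccontr)
    assume "p \<noteq> irrelevant"
    then have "height p < height (irrelevant :: ('n, 'k) mpoly set)"
      using Ass_irrelevant[OF that] irrelevant_prime Ass_prime[OF that] by (intro height_less) auto
    moreover have "height p = height (irrelevant :: ('n, 'k) mpoly set)"
      using unmixed irr that unfolding unmixed_def by metis
    ultimately show False by simp
  qed
  have sup: "irrelevant \<subseteq> Q" if "prime_ideal Q" "I \<subseteq> Q" for Q
  proof (rule irrelevant_subset[OF prime_ideal_subspace[OF that(1)]])
    fix i
    have "\<And>p. p \<in> Ass I \<Longrightarrow> var i \<in> p" using only hpart_irrelevant[OF var_hpart] by auto
    then obtain k where "var i ^ k \<in> I" using power_in_graded_ideal[OF graded var_hpart] by blast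
    then show "var i \<in> Q" using that prime_ideal_power by blast
  qed
  have "quot_krull_dim I \<le> 0"
    unfolding quot_krull_dim_def
  proof (rule Sup_least, clarify)
    fix n P assume P: "prime_chain n P" "I \<subseteq> P 0"
    show "enat n \<le> 0"
    proof (rule ccontr)
      assume "\<not> enat n \<le> 0"
      then have n: "0 < n" by (cases n) (auto simp: zero_enat_def)
      then have pr: "prime_ideal (P 0)" "prime_ideal (P (Suc 0))" "P 0 \<subset> P (Suc 0)"
        using P by (auto simp: prime_chain_def)
      then have "irrelevant \<subset> P (Suc 0)" using sup[OF pr(1) P(2)] by blast
      then have "P (Suc 0) = UNIV"
        using irrelevant_maximal[OF prime_ideal_subspace[OF pr(2)]] by blast
      then show False using pr by (simp add: prime_ideal_def)
    qed
  qed
  then show False by (simp add: dim_1)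
qed

text \<open>The linear generators of \<open>p\<close> do not span all variables, so a linear
  functional kills them but not some \<open>var i\<close>. Its values on the variables are the
  coordinates of \<open>a\<close>. Then \<open>p \<subseteq> line_ideal a\<close>, strictly below
  \<open>irrelevant\<close>, and dimension 1 forces equality.\<close>

lemma Ass_line:
  assumes p: "p \<in> Ass I"
  shows "\<exists>a i. a i \<noteq> 0 \<and> p = line_ideal a"
proof -
  obtain L where L: "L \<subseteq> hpart 1" "p = idl.span L" using linear_gens p by blast
  have p_irr: "p \<subset> irrelevant" using Ass_irrelevant[OF p] irrelevant_not_Ass p by blast
  have "\<exists>i. var i \<notin> S.span L"
  proof (rule ccontr)
    assume "\<not> ?thesis"
    moreover have "S.span L \<subseteq> p"
    proof (rule S.span_minimal)
      show "L \<subseteq> p" unfolding L(2) by (auto intro: idl.span_base)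
      have "idl.subspace p" using p Ass_prime prime_ideal_subspace by blast
      then show "S.subspace p"
        by (auto simp: S.subspace_def scale_def idl.subspace_0 idl.subspace_add idl.subspace_scale)
    qed
    ultimately have "irrelevant \<subseteq> p"
      using prime_ideal_subspace[OF Ass_prime[OF p]] by (intro irrelevant_subset) auto
    then show False using p_irr by blast
  qed
  then obtain i :: 'n where i: "var i \<notin> S.span L" by blast
  obtain B where B: "B \<subseteq> L" "S.independent B" "L \<subseteq> S.span B"
    using S.maximal_independent_subset[of L] by blast
  have spB: "S.span B = S.span L"
    using S.span_mono[OF B(1)] S.span_minimal[OF B(3) S.subspace_span] by (rule antisym)
  have ind: "S.independent (insert (var i) B)"
    using B i spB by (subst S.independent_insert) auto
  interpret vp: vector_space_pair "scale :: 'k \<Rightarrow> ('n, 'k) mpoly \<Rightarrow> _" "(*) :: 'k \<Rightarrow> 'k \<Rightarrow> 'k"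
    by unfold_locales (simp_all only: distrib_left distrib_right mult.assoc mult_1)
  obtain \<phi> where lin: "Vector_Spaces.linear scale (*) \<phi>"
    and \<phi>: "\<And>x. x \<in> insert (var i) B \<Longrightarrow> \<phi> x = (if x = var i then 1 else 0)"
    using vp.linear_independent_extend[OF ind, of "\<lambda>x. if x = var i then 1 else 0"] by blast
  interpret \<phi>: Vector_Spaces.linear scale "(*)" \<phi> by (rule lin)
  define a where "a j = \<phi> (var j)" for j
  have ai: "a i = 1" unfolding a_def using \<phi> by simp
  have eva_phi: "eva a f = \<phi> f" if "f \<in> hpart 1" for f
  proof -
    have single: "eva a (single m c) = \<phi> (single m c)" if m: "mdeg m = 1" for m c
    proof -
      have "m \<noteq> 0" using m by auto
      then obtain j where j: "lookup m j \<noteq> 0" by (metis poly_mapping_eqI lookup_zero)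
      have m': "m = (m - single j 1) + single j 1"
        using j by (intro poly_mapping_eqI) (auto simp: lookup_add lookup_minus lookup_single when_def)
      then have "mdeg (m - single j 1) = 0" using m by (metis add_cancel_left_left mdeg_add mdeg_single)
      then have "m = single j 1" using m' by simp
      then have "single m c = scale c (var j)" by (simp add: scale_def var_def mult_single)
      then show ?thesis by (simp add: eva_scale \<phi>.scale a_def)
    qed
    have "eva a f = (\<Sum>m\<in>keys f. eva a (single m (lookup f m)))"
      by (subst mpoly_as_sum) (simp add: eva_sum)
    also have "\<dots> = (\<Sum>m\<in>keys f. \<phi> (single m (lookup f m)))"
      using that by (intro sum.cong single) (auto simp: hpart_def)
    also have "\<dots> = \<phi> f" by (subst (2) mpoly_as_sum) (simp add: \<phi>.sum)
    finally show ?thesis .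
  qed
  have "var i \<notin> B" using i spB S.span_base by blast
  then have \<phi>B: "\<phi> x = 0" if "x \<in> B" for x using \<phi> that by auto
  have "\<phi> x = 0" if "x \<in> S.span B" for x
    using that by (induction rule: S.span_induct_alt) (auto simp: \<phi>.add \<phi>.scale \<phi>.zero \<phi>B)
  then have "L \<subseteq> line_ideal a"
    using L(1) B(3) eva_phi line_ideal_hpart[of _ 1 a] by (metis of_nat_1 subset_iff)
  then have "p \<subseteq> line_ideal a" unfolding L(2) by (intro idl.span_minimal line_ideal_subspace)
  moreover have "line_ideal a \<subset> irrelevant" using line_subset_irrelevant[of a i] ai by simp
  moreover have "\<not> p \<subset> line_ideal a"
    using no_chain_2[OF Ass_prime[OF p] line_ideal_prime irrelevant_prime _ _ Ass_superset[OF subspace p]]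
      calculation by blast
  ultimately have "p = line_ideal a" by blast
  then show ?thesis using ai by (intro exI[of _ a] exI[of _ i]) simp
qed

text \<open>A strict inclusion would continue to \<open>irrelevant\<close> and give a chain of
  length 2 over \<open>I\<close>.\<close>

lemma Ass_incomparable:
  assumes "p \<in> Ass I" "q \<in> Ass I" "p \<subseteq> q"
  shows "p = q"
proof (rule ccontr)
  assume "p \<noteq> q"
  then have "p \<subset> q" using assms by blast
  moreover have "q \<subset> irrelevant" using Ass_irrelevant[OF assms(2)] irrelevant_not_Ass assms by blast
  ultimately show False
    using no_chain_2 Ass_prime assms irrelevant_prime Ass_superset[OF subspace] by blast
qed

text \<open>As \<open>p\<close> is generated by linear forms, it kills every component of
  \<open>f0\<close>. If each component were also killed by something outside \<open>p\<close>, the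
  product of these elements would kill \<open>f0\<close> and so lie in the prime
  \<open>p\<close>.\<close>

lemma Ass_homogeneous:
  assumes p: "p \<in> Ass I"
  shows "\<exists>d. \<exists>f\<in>hpart (int d). p = colon I f"
proof -
  obtain f0 where f0: "p = colon I f0" and pr: "prime_ideal p" using p by (auto simp: Ass_def)
  obtain L where L: "L \<subseteq> hpart 1" "p = idl.span L" using linear_gens p by blast
  have sub: "p \<subseteq> colon I (hcomp z f0)" for z
    unfolding L(2)
  proof (rule idl.span_minimal[OF _ colon_subspace[OF subspace]], rule subsetI)
    fix l assume l: "l \<in> L"
    then have "l * f0 \<in> I" using L f0 by (auto simp: colon_def intro: idl.span_base)
    then have "hcomp (z + 1) (l * f0) \<in> I" using graded graded_ideal_hcomp by blast
    then show "l \<in> colon I (hcomp z f0)" using hcomp_mult[of l 1 "z + 1"] l L by (auto simp: colon_def)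
  qed
  let ?Z = "(\<lambda>m. int (mdeg m)) ` keys f0"
  have "\<exists>z\<in>?Z. colon I (hcomp z f0) \<subseteq> p"
  proof (rule ccontr)
    assume "\<not> ?thesis"
    then have "\<forall>z\<in>?Z. \<exists>c. c \<in> colon I (hcomp z f0) \<and> c \<notin> p" by blast
    then obtain c where c: "\<And>z. z \<in> ?Z \<Longrightarrow> c z \<in> colon I (hcomp z f0)" "\<And>z. z \<in> ?Z \<Longrightarrow> c z \<notin> p" by metis
    have "prod c ?Z * hcomp z f0 \<in> I" if z: "z \<in> ?Z" for z
      using prod_in_ideal[OF colon_subspace[OF subspace] _ z, of c] c(1)[OF z] by (simp add: colon_def)
    then have "(\<Sum>z\<in>?Z. prod c ?Z * hcomp z f0) \<in> I" by (rule idl.subspace_sum[OF subspace])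
    then have "prod c ?Z * f0 \<in> I" using sum_hcomp[of f0] by (simp flip: sum_distrib_left)
    then have "prod c ?Z \<in> p" by (simp add: f0 colon_def)
    then show False using prime_ideal_prod[of ?Z p c] pr c(2) by auto
  qed
  then obtain m :: "'n \<Rightarrow>\<^sub>0 nat" where "colon I (hcomp (int (mdeg m)) f0) \<subseteq> p" by blast
  then show ?thesis using sub[of "int (mdeg m)"] by (intro exI[of _ "mdeg m"] bexI[of _ "hcomp (int (mdeg m)) f0"]) auto
qed

text \<open>For distinct primes \<open>p n = colon I (f n)\<close> the ideals generated by
  \<open>I\<close> and the first \<open>n\<close> of the \<open>f j\<close> stabilise. A product of
  elements of \<open>p j\<close> outside \<open>p n\<close>, for \<open>j < n\<close>, then kills
  \<open>f n\<close> modulo \<open>I\<close>, so it lies in the prime \<open>p n\<close>.\<close>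

lemma finite_Ass: "finite (Ass I)"
proof (rule ccontr)
  assume "infinite (Ass I)"
  then obtain p :: "nat \<Rightarrow> _" where p: "inj p" "range p \<subseteq> Ass I"
    using infinite_countable_subset by blast
  have pA: "p n \<in> Ass I" for n using p by blast
  obtain f where f: "\<And>n. p n = colon I (f n)" using Ass_homogeneous[OF pA] by metis
  define J where "J n = idl.span (I \<union> f ` {..<n})" for n
  obtain n where n: "J (Suc n) = J n"
    using noetherian_chain[of J] unfolding J_def
    by (metis idl.subspace_span idl.span_mono Un_mono image_mono lessThan_Suc order_refl subset_insertI)
  have "f n \<in> J n" unfolding n[symmetric] by (auto simp: J_def intro: idl.span_base)
  have "\<exists>l. l \<in> p j \<and> l \<notin> p n" if "j < n" for j
    using Ass_incomparable[OF pA pA, of j n] p(1) that by (auto simp: inj_eq)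
  then obtain l where l: "\<And>j. j < n \<Longrightarrow> l j \<in> p j" "\<And>j. j < n \<Longrightarrow> l j \<notin> p n" by metis
  define u where "u = (\<Prod>j<n. l j)"
  have "J n \<subseteq> colon I u"
    unfolding J_def
  proof (rule idl.span_minimal[OF _ colon_subspace[OF subspace]], rule subsetI)
    fix x assume "x \<in> I \<union> f ` {..<n}"
    then show "x \<in> colon I u"
    proof
      assume "x \<in> f ` {..<n}"
      then obtain j where j: "j < n" "x = f j" by blast
      then have "l j \<in> colon I x" using l(1) f by simp
      then have "u \<in> colon I x"
        unfolding u_def using j by (intro prod_in_ideal[OF colon_subspace[OF subspace]]) auto
      then show ?thesis by (simp add: colon_def mult.commute)
    qed (use subset_colon[OF subspace] in blast)
  qed
  then have "u * f n \<in> I" using \<open>f n \<in> J n\<close> by (auto simp: colon_def mult.commute)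
  then have "u \<in> p n" by (simp add: f colon_def)
  then show False using prime_ideal_prod[of "{..<n}" "p n" l] Ass_prime[OF pA] l(2) by (auto simp: u_def)
qed

section \<open>Forms avoiding the associated primes, and reduction modulo them\<close>

lemma linear_avoid:
  assumes "p \<in> Ass I"
  shows "\<exists>l\<in>hpart 1. l \<notin> p"
proof -
  obtain a i where "a i \<noteq> 0" "p = line_ideal a" using Ass_line[OF assms] by blast
  then show ?thesis
    using line_ideal_hpart[of "var i" 1 a] var_hpart[of i] by (intro bexI[of _ "var i"]) auto
qed

lemma linear_separate:
  assumes "p \<in> Ass I" "q \<in> Ass I" "p \<noteq> q"
  shows "\<exists>l\<in>hpart 1. l \<in> q \<and> l \<notin> p"
proof -
  obtain L where L: "L \<subseteq> hpart 1" "q = idl.span L" using linear_gens assms by blast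
  have "\<not> L \<subseteq> p"
    using idl.span_minimal[of L p] Ass_prime prime_ideal_subspace Ass_incomparable assms L(2) by blast
  then show ?thesis using L by (auto intro: idl.span_base)
qed

text \<open>Over a finite field there may be no linear form outside all associated primes.\<close>

lemma form_avoiding_Ass:
  assumes N: "card (Ass I) \<le> N"
  shows "\<exists>h\<in>hpart (int N). \<forall>p\<in>Ass I. h \<notin> p"
proof -
  have "\<exists>f\<in>hpart (int N). f \<notin> p \<and> (\<forall>q\<in>Ass I - {p}. f \<in> q)" if p: "p \<in> Ass I" for p
  proof -
    obtain l0 where l0: "l0 \<in> hpart 1" "l0 \<notin> p" using linear_avoid[OF p] by blast
    obtain l where l: "\<And>q. q \<in> Ass I - {p} \<Longrightarrow> l q \<in> hpart 1" "\<And>q. q \<in> Ass I - {p} \<Longrightarrow> l q \<in> q"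
      "\<And>q. q \<in> Ass I - {p} \<Longrightarrow> l q \<notin> p"
      using linear_separate[OF p] by (metis Diff_iff insertCI)
    define m where "m = card (Ass I - {p})"
    \<comment> \<open>The power of \<open>l0\<close> pads the product to degree exactly
      \<open>N\<close>, so every \<open>N\<close> from the number of primes on is available.\<close>
    define f where "f = l0 ^ (N - m) * (\<Prod>q\<in>Ass I - {p}. l q)"
    have m: "m \<le> N" using N finite_Ass by (simp add: m_def card_Diff_singleton p)
    have "(\<Prod>q\<in>Ass I - {p}. l q) \<in> hpart (int m)"
      using hpart_prod[of "Ass I - {p}" l "\<lambda>_. 1"] l(1) by (simp add: m_def)
    then have "f \<in> hpart (int N)"
      unfolding f_def using hpart_power[OF l0(1), of "N - m"] m by (auto intro: hpart_mult_graded)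
    moreover have "f \<notin> p"
    proof
      assume "f \<in> p"
      then have "l0 ^ (N - m) \<in> p \<or> (\<Prod>q\<in>Ass I - {p}. l q) \<in> p"
        unfolding f_def using prime_ideal_mult Ass_prime p by blast
      then show False
        using l0 l(3) prime_ideal_power[OF Ass_prime[OF p]] prime_ideal_prod[of "Ass I - {p}" p l] finite_Ass
          Ass_prime[OF p] by auto
    qed
    moreover have "f \<in> q" if q: "q \<in> Ass I - {p}" for q
    proof -
      have sub: "idl.subspace q" using q Ass_prime prime_ideal_subspace by blast
      have "(\<Prod>q\<in>Ass I - {p}. l q) \<in> q" using q finite_Ass l(2) by (intro prod_in_ideal[OF sub, of _ q]) auto
      then show ?thesis unfolding f_def by (rule idl.subspace_scale[OF sub])
    qed
    ultimately show ?thesis by blast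
  qed
  then obtain f where f: "\<And>p. p \<in> Ass I \<Longrightarrow> f p \<in> hpart (int N)" "\<And>p. p \<in> Ass I \<Longrightarrow> f p \<notin> p"
    "\<And>p q. p \<in> Ass I \<Longrightarrow> q \<in> Ass I - {p} \<Longrightarrow> f p \<in> q" by metis
  \<comment> \<open>Modulo \<open>p\<close> only the summand \<open>f p\<close> survives, and it is
    not in \<open>p\<close>.\<close>
  define h where "h = (\<Sum>p\<in>Ass I. f p)"
  have "h \<notin> p" if p: "p \<in> Ass I" for p
  proof
    assume "h \<in> p"
    have sub: "idl.subspace p" using p Ass_prime prime_ideal_subspace by blast
    have "(\<Sum>q\<in>Ass I - {p}. f q) \<in> p" by (rule idl.subspace_sum[OF sub]) (use f(3) p in auto)
    then have "h - (\<Sum>q\<in>Ass I - {p}. f q) \<in> p" using \<open>h \<in> p\<close> sub idl.subspace_diff by blast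
    then have "f p \<in> p" unfolding h_def using p finite_Ass by (simp add: sum.remove)
    then show False using f(2) p by blast
  qed
  moreover have "h \<in> hpart (int N)" unfolding h_def by (rule hpart_sum) (use f in auto)
  ultimately show ?thesis by blast
qed

text \<open>A component of \<open>g\<close> outside \<open>I\<close> would have a multiple whose
  annihilator is an associated prime, and that prime would contain \<open>h\<close>.\<close>

lemma nonzerodivisor:
  assumes h: "h \<in> hpart z" "\<And>p. p \<in> Ass I \<Longrightarrow> h \<notin> p" and g: "h * g \<in> I"
  shows "g \<in> I"
proof (rule graded_ideal_hcompI[OF graded], rule ccontr)
  fix y assume y: "hcomp y g \<notin> I"
  have "hcomp (y + z) (h * g) \<in> I" using g graded graded_ideal_hcomp by blast
  then have hg: "h * hcomp y g \<in> I" using hcomp_mult[OF h(1), of "y + z" g] by simp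
  obtain u where u: "colon I (u * hcomp y g) \<in> Ass I" using Ass_above[OF graded hcomp_in y] by blast
  have "u * (h * hcomp y g) \<in> I" using hg idl.subspace_scale[OF subspace] by blast
  then have "h \<in> colon I (u * hcomp y g)" by (simp only: colon_def mem_Collect_eq power_Suc mult_ac)
  then show False using h(2) u by blast
qed

text \<open>For each line the form \<open>w p\<close> combines \<open>var i ^ e\<close> and
  \<open>h\<close> so as to vanish on it. The product over all lines lies in every associated prime,
  so a power of it lies in \<open>I\<close>; modulo \<open>h\<close> it is a nonzero constant times
  a power of \<open>var i\<close>.\<close>

lemma var_power_mod_form:
  assumes h: "h \<in> hpart (int e)" "\<And>p. p \<in> Ass I \<Longrightarrow> h \<notin> p" and e: "0 < e"
  shows "\<exists>k. var i ^ k \<in> idl.span (insert h I)"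
proof -
  let ?J = "idl.span (insert h I)"
  obtain a where a: "\<And>p. p \<in> Ass I \<Longrightarrow> p = line_ideal (a p)" using Ass_line by metis
  define w where "w p = single 0 (eva (a p) h) * var i ^ e - single 0 (a p i ^ e) * h" for p
  define u where "u = (\<Prod>p\<in>Ass I. w p)"
  have w: "w p \<in> hpart (int e)" for p
    unfolding w_def using hpart_power[OF var_hpart[of i], of e] h hpart_single[of 0]
    by (intro hpart_diff) (auto intro!: hpart_mult_graded[of _ 0 _ "int e"])
  have "eva (a p) (w p) = 0" for p
    by (simp add: w_def eva_diff eva_mult eva_single eva_power)
  then have w_in: "w p \<in> p" if "p \<in> Ass I" for p
    using line_ideal_hpart[OF w, of p "a p"] a[OF that] by simp
  have u_h: "u \<in> hpart (int (card (Ass I) * e))"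
    unfolding u_def using hpart_prod[of "Ass I" w "\<lambda>_. int e"] w by simp
  have "u \<in> p" if p: "p \<in> Ass I" for p
    unfolding u_def using w_in finite_Ass p by (intro prod_in_ideal[OF prime_ideal_subspace[OF Ass_prime[OF p]], of _ p])
  then obtain k where k: "u ^ k \<in> I" using power_in_graded_ideal[OF graded u_h] by blast
  have eh: "eva (a p) h \<noteq> 0" if "p \<in> Ass I" for p
    using h(2)[OF that] line_ideal_hpart[OF h(1), of "a p"] a[OF that] by simp
  have J: "idl.subspace ?J" by simp
  have hJ: "h \<in> ?J" by (intro idl.span_base) simp
  \<comment> \<open>Modulo \<open>h\<close> the factor \<open>w p\<close> is the constant
    \<open>eva (a p) h\<close> times \<open>var i ^ e\<close>; \<open>c\<close> collects these
    constants, all of them nonzero.\<close>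
  have prodmod: "\<exists>c. c \<noteq> 0 \<and> (\<Prod>p\<in>A. w p) - single 0 c * var i ^ (card A * e) \<in> ?J" if "finite A" "A \<subseteq> Ass I" for A
    using that
  proof (induction A rule: finite_induct)
    case empty
    then show ?case by (intro exI[of _ 1]) (simp add: idl.span_zero)
  next
    case (insert p A)
    then obtain c where c: "c \<noteq> 0" "(\<Prod>p\<in>A. w p) - single 0 c * var i ^ (card A * e) \<in> ?J" by auto
    have "(\<Prod>p\<in>insert p A. w p) - single 0 (eva (a p) h * c) * var i ^ (card (insert p A) * e) =
      w p * ((\<Prod>p\<in>A. w p) - single 0 c * var i ^ (card A * e)) - (single 0 (a p i ^ e) * single 0 c * var i ^ (card A * e)) * h"
    proof -
      have s: "single 0 (eva (a p) h * c) = single 0 (eva (a p) h) * single (0 :: 'n \<Rightarrow>\<^sub>0 nat) c"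
        by (simp add: mult_single)
      have ring: "(E * X - A * h) * W - (E * C) * (X * Y) = (E * X - A * h) * (W - C * Y) - (A * C * Y) * h"
        for E X A h W C Y :: "'r::comm_ring_1" by (simp add: algebra_simps)
      have "card (insert p A) * e = e + card A * e" using insert by simp
      then show ?thesis unfolding prod.insert[OF insert(1,2)] s w_def[of p] by (simp only: power_add ring)
    qed
    moreover have "w p * ((\<Prod>p\<in>A. w p) - single 0 c * var i ^ (card A * e)) - (single 0 (a p i ^ e) * single 0 c * var i ^ (card A * e)) * h \<in> ?J"
      by (rule idl.span_diff[OF idl.span_scale[OF c(2)] idl.span_scale[OF hJ]])
    moreover have "eva (a p) h * c \<noteq> 0" using eh c insert by simp
    ultimately show ?case by (intro exI[of _ "eva (a p) h * c"]) simp
  qed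
  obtain c where c: "c \<noteq> 0" "u - single 0 c * var i ^ (card (Ass I) * e) \<in> ?J"
    using prodmod[OF finite_Ass] unfolding u_def by auto
  define x where "x = single 0 c * var i ^ (card (Ass I) * e)"
  have "u ^ n - x ^ n \<in> ?J" for n
  proof (induction n)
    case (Suc n)
    have "u ^ Suc n - x ^ Suc n = u ^ n * (u - x) + x * (u ^ n - x ^ n)"
      by (simp only: power_Suc right_diff_distrib mult.commute[of u] mult.commute[of x] diff_add_eq add_diff_cancel) (simp add: mult.commute[of x])
    then show ?case using Suc c by (auto simp: x_def intro!: idl.span_add idl.span_scale)
  qed (simp add: idl.span_zero)
  note um = this
  have "u ^ k \<in> ?J" using k by (intro idl.span_base) simp
  then have "u ^ k - (u ^ k - x ^ k) \<in> ?J" by (rule idl.span_diff[OF _ um])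
  then have "single 0 (inverse c ^ k) * x ^ k \<in> ?J" by (intro idl.span_scale) simp
  moreover have "single 0 (inverse c ^ k) * x ^ k = var i ^ (card (Ass I) * e * k)"
  proof -
    have "single (0 :: 'n \<Rightarrow>\<^sub>0 nat) c ^ k = single 0 (c ^ k)" by (induction k) (auto simp: mult_single)
    then have "x ^ k = single 0 (c ^ k) * var i ^ (card (Ass I) * e * k)"
      by (simp add: x_def power_mult_distrib power_mult)
    then have "single 0 (inverse c ^ k) * x ^ k = (single 0 (inverse c ^ k) * single 0 (c ^ k)) * var i ^ (card (Ass I) * e * k)"
      by (simp only: mult.assoc)
    then show ?thesis using c by (simp add: mult_single flip: power_mult_distrib)
  qed
  ultimately show ?thesis by metis
qed

text \<open>A monomial of degree above the sum of the exponents \<open>k i\<close> is divisible by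
  some \<open>var i ^ k i\<close>.\<close>

lemma artinian_mod_form:
  assumes h: "h \<in> hpart (int e)" "\<And>p. p \<in> Ass I \<Longrightarrow> h \<notin> p" and e: "0 < e"
  shows "\<exists>N. \<forall>j\<ge>int N. hpart j \<subseteq> idl.span (insert h I)"
proof -
  let ?J = "idl.span (insert h I)"
  obtain k where k: "\<And>i. var i ^ k i \<in> ?J" using var_power_mod_form[OF assms] by metis
  define N where "N = (\<Sum>i\<in>UNIV. k i)"
  have mon: "single m c \<in> ?J" if m: "N < mdeg m" for m and c :: 'k
  proof -
    have "\<exists>i. k i \<le> lookup m i"
    proof (rule ccontr)
      assume "\<not> ?thesis"
      then have "mdeg m \<le> N" unfolding mdeg_def N_def by (intro sum_mono) (auto simp: not_le less_imp_le)
      then show False using m by simp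
    qed
    then obtain i where i: "k i \<le> lookup m i" by blast
    have vp: "var i ^ n = single (single i n) 1" for n
      by (induction n) (auto simp: var_def mult_single simp flip: single_add)
    have "m = (m - single i (k i)) + single i (k i)"
      using i by (intro poly_mapping_eqI) (auto simp: lookup_add lookup_minus lookup_single when_def)
    then have "single m c = single (m - single i (k i)) c * var i ^ k i"
      by (simp add: vp mult_single)
    then show ?thesis using k by (simp add: idl.span_scale)
  qed
  have "f \<in> ?J" if "j \<ge> int (Suc N)" "f \<in> hpart j" for j f
    by (subst mpoly_as_sum, rule idl.span_sum, rule mon) (use that in \<open>auto simp: hpart_def\<close>)
  then show ?thesis by blast
qed

text \<open>Some associated prime contains \<open>colon I f\<close>, hence \<open>p\<close>;
  associated primes being incomparable, it is \<open>p\<close>.\<close>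

lemma colon_eq_Ass:
  assumes p: "p \<in> Ass I" and f: "f \<in> hpart z" "f \<notin> I" "p \<subseteq> colon I f"
  shows "colon I f = p"
proof -
  obtain g where g: "colon I (g * f) \<in> Ass I" using Ass_above[OF graded f(1,2)] by blast
  have "colon I f \<subseteq> colon I (g * f)" using colon_mono_mult[OF subspace] .
  moreover have "p = colon I (g * f)" using Ass_incomparable[OF p g] f(3) calculation by blast
  ultimately show ?thesis using f(3) by blast
qed

text \<open>A nonzero class killed by all variables would have annihilator
  \<open>irrelevant\<close>, which is not associated: \<open>S/I\<close> has positive depth.\<close>

lemma socle_trivial:
  assumes "f \<notin> I"
  shows "\<exists>i. var i * f \<notin> I"
proof (rule ccontr)
  assume "\<not> ?thesis"
  then have "irrelevant \<subseteq> colon I f" by (intro irrelevant_subset colon_subspace subspace) (simp add: colon_def)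
  then have "colon I f = irrelevant"
    using irrelevant_maximal[OF colon_subspace[OF subspace]] colon_eq_UNIV_iff[OF subspace] assms by blast
  then have "irrelevant \<in> Ass I" using irrelevant_prime by (auto simp: Ass_def)
  then show False using irrelevant_not_Ass by blast
qed

lemma multiple_not_in:
  assumes "f \<notin> I"
  shows "\<exists>g\<in>hpart (int N). g * f \<notin> I"
proof (induction N)
  case 0
  show ?case using assms by (intro bexI[of _ 1]) auto
next
  case (Suc N)
  then obtain g where g: "g \<in> hpart (int N)" "g * f \<notin> I" by blast
  obtain i where "var i * (g * f) \<notin> I" using socle_trivial[OF g(2)] by blast
  then show ?case
    using hpart_mult[OF var_hpart g(1), of i] by (intro bexI[of _ "var i * g"]) (simp_all only: mult.assoc of_nat_Suc not_False_eq_True)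
qed

end


section \<open>Bounding the degrees of generators of a free resolution\<close>

text \<open>
  Think of \<open>X k i j\<close> as the degree \<open>j\<close> part of \<open>(x\<^sub>1, \<dots>, x\<^sub>k) C\<^sub>i\<close>. Going from \<open>k\<close> to \<open>k + 1\<close>
  replaces \<open>C / X k\<close> by the cokernel of the injective multiplication with the next variable;
  the two steps below are the pieces of the resulting long exact homology sequence that
  are needed.
\<close>

locale variable_filtration =
  fixes C :: "nat \<Rightarrow> int \<Rightarrow> 'c::ab_group_add set"
    and d :: "nat \<Rightarrow> 'c \<Rightarrow> 'c"
    and x :: "nat \<Rightarrow> 'c \<Rightarrow> 'c"
    and X :: "nat \<Rightarrow> nat \<Rightarrow> int \<Rightarrow> 'c set"
    and s :: nat and top :: int
  assumes C_zero: "0 \<in> C i j"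
    and C_diff: "u \<in> C i j \<Longrightarrow> v \<in> C i j \<Longrightarrow> u - v \<in> C i j"
    and d_C: "v \<in> C (Suc i) j \<Longrightarrow> d i v \<in> C i j"
    and d_diff: "d i (u - v) = d i u - d i v"
    and x_C: "v \<in> C i j \<Longrightarrow> x k v \<in> C i (j + 1)"
    and x_diff: "x k (u - v) = x k u - x k v"
    and dd: "v \<in> C (Suc (Suc i)) j \<Longrightarrow> d i (d (Suc i) v) = 0"
    and dx: "d i (x k v) = x k (d i v)"
    and X_0: "X 0 i j = {0}"
    and X_diff: "u \<in> X k i j \<Longrightarrow> v \<in> X k i j \<Longrightarrow> u - v \<in> X k i j"
    and X_Suc: "k < s \<Longrightarrow> v \<in> X (Suc k) i j \<longleftrightarrow> (\<exists>u\<in>C i (j - 1). \<exists>w\<in>X k i j. v = x k u + w)"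
    and X_d: "v \<in> X k (Suc i) j \<Longrightarrow> d i v \<in> X k i j"
    and X_x: "v \<in> X k i j \<Longrightarrow> x l v \<in> X k i (j + 1)"
    and X_regular: "k < s \<Longrightarrow> v \<in> C i j \<Longrightarrow> x k v \<in> X k i (j + 1) \<Longrightarrow> v \<in> X k i j"
    and exact: "v \<in> C (Suc i) j \<Longrightarrow> d i v = 0 \<Longrightarrow> \<exists>w\<in>C (Suc (Suc i)) j. d (Suc i) w = v"
    and above_top: "top < j \<Longrightarrow> v \<in> C 0 j \<Longrightarrow> \<exists>w\<in>C 1 j. d 0 w = v"
    and at_top: "\<exists>v\<in>C 0 top. \<forall>w\<in>C 1 top. d 0 w \<noteq> v"
begin

lemma d_zero [simp]: "d i 0 = 0" and x_zero [simp]: "x k 0 = 0"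
  using d_diff[of i 0 0] x_diff[of k 0 0] by simp_all

text \<open>Together with \<open>boundary\<close> this describes, on representatives, the homology
  of the complex \<open>C / X k\<close>; at index 0 there is no cycle condition.\<close>

definition cycle :: "nat \<Rightarrow> nat \<Rightarrow> int \<Rightarrow> 'c \<Rightarrow> bool" where
  "cycle k i j v \<longleftrightarrow> v \<in> C i j \<and> (case i of 0 \<Rightarrow> True | Suc i' \<Rightarrow> d i' v \<in> X k i' j)"

definition boundary :: "nat \<Rightarrow> nat \<Rightarrow> int \<Rightarrow> 'c \<Rightarrow> bool" where
  "boundary k i j v \<longleftrightarrow> (\<exists>w\<in>C (Suc i) j. v - d i w \<in> X k i j)"

lemma X_zero: "k \<le> s \<Longrightarrow> 0 \<in> X k i j"
proof (induction k)
  case (Suc k)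
  then show ?case using C_zero by (subst X_Suc) (auto intro!: bexI[of _ 0])
qed (simp add: X_0)

lemma X_uminus: "k \<le> s \<Longrightarrow> v \<in> X k i j \<Longrightarrow> - v \<in> X k i j"
  using X_diff[OF X_zero] by fastforce

lemma X_add: "k \<le> s \<Longrightarrow> u \<in> X k i j \<Longrightarrow> v \<in> X k i j \<Longrightarrow> u + v \<in> X k i j"
  using X_diff[of u k i j "- v"] X_uminus by simp

lemma d_add: "d i (u + v) = d i u + d i v"
  using d_diff[of i u "- v"] d_diff[of i 0 v] by simp

lemma X_mono: "k < s \<Longrightarrow> v \<in> X k i j \<Longrightarrow> v \<in> X (Suc k) i j"
  by (subst X_Suc, assumption) (rule bexI[OF bexI[of _ v] C_zero], simp_all)

text \<open>If \<open>v\<close> is a cycle modulo \<open>X (Suc k)\<close>, then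
  \<open>d i' v = x k u + w\<close> with \<open>w\<close> in \<open>X k\<close>. Regularity makes
  \<open>u\<close> a cycle modulo \<open>X k\<close>, one index and one degree lower, which keeps it
  above the bound; so \<open>u\<close> is \<open>d i' y\<close> modulo \<open>X k\<close>, and
  \<open>v - x k y\<close> is a cycle modulo \<open>X k\<close>.\<close>

lemma cycle_is_boundary:
  assumes "k \<le> s" "top + int i < j" "cycle k i j v"
  shows "boundary k i j v"
  using assms
proof (induction k arbitrary: i j v)
  case 0
  show ?case
  proof (cases i)
    case 0
    then obtain w where "w \<in> C 1 j" "d 0 w = v"
      using above_top[of j v] \<open>top + int i < j\<close> \<open>cycle 0 i j v\<close> by (auto simp: cycle_def)
    then show ?thesis using 0 by (auto simp: boundary_def X_0 intro!: bexI[of _ w])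
  next
    case (Suc i')
    then have "v \<in> C (Suc i') j" "d i' v = 0" using 0 by (auto simp: cycle_def X_0)
    from exact[OF this] show ?thesis using Suc by (auto simp: boundary_def X_0)
  qed
next
  case (Suc k)
  have k: "k < s" "k \<le> s" using Suc.prems by auto
  have vC: "v \<in> C i j" using Suc.prems by (simp add: cycle_def)
  show ?case
  proof (cases i)
    case 0
    then have "cycle k i j v" using vC by (simp add: cycle_def)
    from Suc.IH[OF k(2) Suc.prems(2) this] show ?thesis using X_mono[OF k(1)] by (auto simp: boundary_def)
  next
    case i: (Suc i')
    then have "d i' v \<in> X (Suc k) i' j" using Suc.prems by (simp add: cycle_def)
    then obtain u w where u: "u \<in> C i' (j - 1)" and w: "w \<in> X k i' j" and duw: "d i' v = x k u + w"
      using X_Suc[OF k(1)] by blast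
    have "cycle k i' (j - 1) u"
    proof (cases i')
      case 0
      then show ?thesis using u by (simp add: cycle_def)
    next
      case (Suc i'')
      have "x k (d i'' u) = d i'' (x k u)" by (simp add: dx)
      also have "x k u = d i' v - w" using duw by simp
      also have "d i'' (d i' v - w) = - d i'' w"
        using dd[of v i'' j] vC i Suc by (simp add: d_diff)
      finally have "x k (d i'' u) \<in> X k i'' (j - 1 + 1)"
        using X_uminus[OF k(2) X_d] w Suc by simp
      then have "d i'' u \<in> X k i'' (j - 1)"
        using X_regular[OF k(1)] d_C u Suc by blast
      then show ?thesis using u Suc by (simp add: cycle_def)
    qed
    then have "boundary k i' (j - 1) u" using Suc.prems i by (intro Suc.IH k) auto
    then obtain y where y: "y \<in> C i (j - 1)" "u - d i' y \<in> X k i' (j - 1)"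
      using i by (auto simp: boundary_def)
    have xy: "x k y \<in> C i j" using x_C[OF y(1), of k] by simp
    have "d i' (v - x k y) = x k (u - d i' y) + w" by (simp add: d_diff duw dx x_diff)
    moreover have "x k (u - d i' y) \<in> X k i' j" using X_x[OF y(2)] by simp
    ultimately have "d i' (v - x k y) \<in> X k i' j" using X_add[OF k(2)] w by simp
    then have "cycle k i j (v - x k y)" using C_diff[OF vC xy] i by (simp add: cycle_def)
    from Suc.IH[OF k(2) Suc.prems(2) this] obtain z
      where z: "z \<in> C (Suc i) j" "v - x k y - d i z \<in> X k i j" by (auto simp: boundary_def)
    have "x k y + (v - x k y - d i z) \<in> X (Suc k) i j"
      using X_Suc[OF k(1)] y(1) z(2) by blast
    then show ?thesis using z(1) by (auto simp: boundary_def)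
  qed
qed

text \<open>The connecting map, read backwards, raises index and degree by one: \<open>x k v\<close>
  is a cycle just above the vanishing bound, so it is \<open>d k w\<close> modulo
  \<open>X k\<close>, and \<open>w\<close> is the new class. Were \<open>w\<close> a boundary,
  cancelling \<open>x k\<close> would make \<open>v\<close> one.\<close>

lemma nonboundary_cycle:
  assumes "k \<le> s"
  shows "\<exists>v. cycle k k (top + int k) v \<and> \<not> boundary k k (top + int k) v"
  using assms
proof (induction k)
  case 0
  then show ?case using at_top by (auto simp: cycle_def boundary_def X_0)
next
  case (Suc k)
  have k: "k < s" "k \<le> s" using Suc.prems by auto
  let ?j = "top + int (Suc k)"
  have j: "?j - 1 = top + int k" by simp
  obtain v where v: "cycle k k (?j - 1) v" "\<not> boundary k k (?j - 1) v" using Suc.IH k unfolding j by blast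
  have vC: "v \<in> C k (?j - 1)" using v by (simp add: cycle_def)
  have "cycle k k ?j (x k v)"
    unfolding cycle_def
  proof
    show "x k v \<in> C k ?j" using x_C[OF vC, of k] by (simp only: diff_add_cancel)
    show "case k of 0 \<Rightarrow> True | Suc i' \<Rightarrow> d i' (x k v) \<in> X k i' ?j"
    proof (cases k)
      case (Suc i')
      then have "d i' v \<in> X k i' (?j - 1)" using v by (simp add: cycle_def)
      then have "d i' (x k v) \<in> X k i' ?j" using X_x[of "d i' v" k i' "?j - 1" k] by (simp only: dx diff_add_cancel)
      then show ?thesis using Suc by simp
    qed simp
  qed
  from cycle_is_boundary[OF k(2) _ this] obtain w
    where w: "w \<in> C (Suc k) ?j" "x k v - d k w \<in> X k k ?j" by (auto simp: boundary_def)
  have "cycle (Suc k) (Suc k) ?j w"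
  proof -
    have "x k v + - (x k v - d k w) \<in> X (Suc k) k ?j"
      using X_Suc[OF k(1)] vC X_uminus[OF k(2) w(2)] by blast
    then show ?thesis using w by (simp add: cycle_def)
  qed
  moreover have "\<not> boundary (Suc k) (Suc k) ?j w"
  proof
    assume "boundary (Suc k) (Suc k) ?j w"
    then obtain w' where w': "w' \<in> C (Suc (Suc k)) ?j" "w - d (Suc k) w' \<in> X (Suc k) (Suc k) ?j"
      by (auto simp: boundary_def)
    then obtain y y' where y: "y \<in> C (Suc k) (?j - 1)" "y' \<in> X k (Suc k) ?j"
      "w - d (Suc k) w' = x k y + y'" using X_Suc[OF k(1)] by blast
    have "d k w = d k (w - d (Suc k) w')" using dd[OF w'(1)] by (simp add: d_diff)
    also have "\<dots> = x k (d k y) + d k y'" unfolding y(3) by (simp add: d_add dx)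
    finally have "x k (v - d k y) = (x k v - d k w) + d k y'" by (simp add: x_diff)
    also have "\<dots> \<in> X k k ?j" using X_add[OF k(2) w(2) X_d[OF y(2)]] .
    finally have "x k (v - d k y) \<in> X k k (?j - 1 + 1)" by (simp only: diff_add_cancel)
    then have "v - d k y \<in> X k k (?j - 1)"
      using X_regular[OF k(1)] C_diff[OF vC d_C[OF y(1)]] by blast
    then show False using v(2) y(1) by (auto simp: boundary_def)
  qed
  ultimately show ?case by blast
qed

text \<open>When the incoming differential is zero modulo \<open>X s\<close>, every boundary already
  lies in \<open>X s\<close>, so \<open>v\<close> represents a nonzero homology class and the
  vanishing bound applies.\<close>

lemma degree_bound:
  assumes "cycle s i j v" "\<And>w. w \<in> C (Suc i) j \<Longrightarrow> d i w \<in> X s i j" "v \<notin> X s i j"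
  shows "j \<le> top + int i"
proof (rule ccontr)
  assume "\<not> ?thesis"
  then obtain w where w: "w \<in> C (Suc i) j" "v - d i w \<in> X s i j"
    using cycle_is_boundary[OF order_refl _ assms(1)] by (auto simp: boundary_def)
  have "(v - d i w) + d i w \<in> X s i j" using X_add[OF order_refl w(2) assms(2)[OF w(1)]] .
  then show False using assms(3) by simp
qed

lemma degree_attained: "\<exists>v\<in>C s (top + int s). v \<notin> X s s (top + int s)"
proof -
  obtain v where v: "cycle s s (top + int s) v" "\<not> boundary s s (top + int s) v"
    using nonboundary_cycle by blast
  have "v \<notin> X s s (top + int s)" using v(2) C_zero by (force simp: boundary_def)
  then show ?thesis using v by (auto simp: cycle_def)
qed

end

section \<open>The ideals generated by some of the variables\<close>

definition var_enum :: "nat \<Rightarrow> 'n::finite" where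
  "var_enum = (SOME f. bij_betw f {..<card (UNIV :: 'n set)} UNIV)"

lemma bij_var_enum: "bij_betw (var_enum :: nat \<Rightarrow> 'n::finite) {..<card (UNIV :: 'n set)} UNIV"
proof -
  have "\<exists>f :: nat \<Rightarrow> 'n. bij_betw f {..<card (UNIV :: 'n set)} UNIV"
    using ex_bij_betw_nat_finite[of "UNIV :: 'n set"] by (auto simp: atLeast0LessThan)
  then show ?thesis unfolding var_enum_def by (rule someI_ex)
qed

text \<open>The ideal of the first \<open>k\<close> variables, given by its monomials, so that
  membership and regularity are read off exponents.\<close>

definition var_ideal :: "nat \<Rightarrow> ('n::finite, 'k::field) mpoly set" where
  "var_ideal k = {f. \<forall>m\<in>keys f. \<exists>q<k. lookup m (var_enum q) \<noteq> 0}"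

lemma var_ideal_subspace: "idl.subspace (var_ideal k :: ('n::finite, 'k::field) mpoly set)"
  unfolding idl.subspace_def
proof (intro conjI ballI allI)
  show "0 \<in> var_ideal k" by (simp add: var_ideal_def)
  fix f g :: "('n, 'k) mpoly" assume "f \<in> var_ideal k" "g \<in> var_ideal k"
  then show "f + g \<in> var_ideal k"
    using Poly_Mapping.keys_add[of f g] by (fastforce simp: var_ideal_def)
next
  fix c f :: "('n, 'k) mpoly" assume f: "f \<in> var_ideal k"
  show "c * f \<in> var_ideal k"
    unfolding var_ideal_def
  proof (clarify)
    fix m assume "m \<in> keys (c * f)"
    then obtain u v where "m = u + v" "v \<in> keys f" using keys_mult[of c f] by blast
    then show "\<exists>q<k. lookup m (var_enum q) \<noteq> 0" using f by (fastforce simp: var_ideal_def lookup_add)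
  qed
qed

lemma var_ideal_0: "var_ideal 0 = {0}"
  by (auto simp: var_ideal_def)

lemma var_ideal_all: "var_ideal (card (UNIV :: 'n set)) = (irrelevant :: ('n::finite, 'k::field) mpoly set)"
proof -
  have "(\<exists>q<card (UNIV :: 'n set). lookup m (var_enum q) \<noteq> 0) \<longleftrightarrow> m \<noteq> 0" for m :: "'n \<Rightarrow>\<^sub>0 nat"
  proof
    assume "m \<noteq> 0"
    then obtain i where i: "lookup m i \<noteq> 0" by (metis poly_mapping_eqI lookup_zero)
    obtain q where "q < card (UNIV :: 'n set)" "i = var_enum q"
      using bij_var_enum by (metis UNIV_I bij_betw_iff_bijections lessThan_iff)
    then show "\<exists>q<card (UNIV :: 'n set). lookup m (var_enum q) \<noteq> 0" using i by blast
  qed auto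
  then have "f \<in> var_ideal (card (UNIV :: 'n set)) \<longleftrightarrow> 0 \<notin> keys f" for f :: "('n, 'k) mpoly"
    by (auto simp: var_ideal_def)
  then show ?thesis by (auto simp: irrelevant_def in_keys_iff)
qed

lemma lookup_var_mult: "lookup (var i * f) (single i 1 + m) = lookup f m"
  unfolding var_def by (simp only: lookup_single_mult mult_1)

text \<open>Multiplication by \<open>var (var_enum k)\<close> changes only that one exponent, so
  divisibility of a monomial by an earlier variable is unaffected.\<close>

lemma var_ideal_regular:
  fixes f :: "('n::finite, 'k::field) mpoly"
  assumes k: "k < card (UNIV :: 'n set)" and f: "var (var_enum k) * f \<in> var_ideal k"
  shows "f \<in> var_ideal k"
  unfolding var_ideal_def
proof (clarify)
  fix m assume "m \<in> keys f"
  then have "single (var_enum k) 1 + m \<in> keys (var (var_enum k) * f)"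
    unfolding in_keys_iff lookup_var_mult .
  then obtain q where q: "q < k" "lookup (single (var_enum k) 1 + m) (var_enum q) \<noteq> 0"
    using f by (auto simp: var_ideal_def)
  have "var_enum q \<noteq> (var_enum k :: 'n)"
    using bij_var_enum q k by (metis bij_betw_inv_into_left lessThan_iff less_irrefl order_less_trans)
  then show "\<exists>q<k. lookup m (var_enum q) \<noteq> 0"
    using q by (intro exI[of _ q]) (auto simp: lookup_add lookup_single when_def)
qed

text \<open>Monomials divisible by an earlier variable go to \<open>f'\<close>; all others are
  divisible by \<open>var (var_enum k)\<close>.\<close>

lemma var_ideal_Suc:
  fixes f :: "('n::finite, 'k::field) mpoly"
  assumes f: "f \<in> hpart z" "f \<in> var_ideal (Suc k)"
  shows "\<exists>g\<in>hpart (z - 1). \<exists>f'\<in>hpart z. f' \<in> var_ideal k \<and> f = var (var_enum k) * g + f'"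
proof -
  define A where "A = {m \<in> keys f. \<exists>q<k. lookup m (var_enum q) \<noteq> 0}"
  define B where "B = keys f - A"
  define f' where "f' = (\<Sum>m\<in>A. single m (lookup f m))"
  define g where "g = (\<Sum>m\<in>B. single (m - single (var_enum k) 1) (lookup f m))"
  have m: "m = (m - single (var_enum k) 1) + single (var_enum k) 1" if "m \<in> B" for m
  proof (rule poly_mapping_eqI)
    fix i
    have "lookup m (var_enum k) \<noteq> 0"
      using that f(2) by (auto simp: B_def A_def var_ideal_def less_Suc_eq)
    then show "lookup m i = lookup ((m - single (var_enum k) 1) + single (var_enum k) 1) i"
      by (auto simp: lookup_add lookup_minus lookup_single when_def)
  qed
  have "f = (\<Sum>m\<in>B. single m (lookup f m)) + f'"
    unfolding f'_def B_def using mpoly_as_sum[of f] by (subst sum.subset_diff[symmetric]) (auto simp: A_def)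
  also have "(\<Sum>m\<in>B. single m (lookup f m)) = var (var_enum k) * g"
    unfolding g_def sum_distrib_left
  proof (rule sum.cong[OF refl])
    fix m' assume "m' \<in> B"
    from m[OF this] show "single m' (lookup f m') = var (var_enum k) * single (m' - single (var_enum k) 1) (lookup f m')"
      unfolding var_def mult_single by (simp add: add.commute)
  qed
  finally have "f = var (var_enum k) * g + f'" .
  moreover have "g \<in> hpart (z - 1)"
    unfolding g_def
  proof (rule hpart_sum)
    fix m' assume m': "m' \<in> B"
    have "mdeg m' = mdeg (m' - single (var_enum k) 1) + 1" by (subst m[OF m']) (simp only: mdeg_add mdeg_single)
    moreover have "int (mdeg m') = z" using f(1) m' by (auto simp: B_def hpart_def)
    ultimately have "int (mdeg (m' - single (var_enum k) 1)) = z - 1" by simp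
    then show "single (m' - single (var_enum k) 1) (lookup f m') \<in> hpart (z - 1)" using hpart_single by metis
  qed
  moreover have "f' \<in> hpart z"
    unfolding f'_def
  proof (rule hpart_sum)
    fix m' assume "m' \<in> A"
    then have "int (mdeg m') = z" using f(1) by (auto simp: A_def hpart_def)
    then show "single m' (lookup f m') \<in> hpart z" using hpart_single by metis
  qed
  moreover have "f' \<in> var_ideal k"
    unfolding f'_def by (rule idl.subspace_sum[OF var_ideal_subspace]) (auto simp: A_def var_ideal_def)
  ultimately show ?thesis by blast
qed

lemma var_ideal_mono: "var_ideal k \<subseteq> var_ideal (Suc k)"
  by (auto simp: var_ideal_def) (meson less_SucI)

lemma var_in_var_ideal: "var (var_enum k) \<in> var_ideal (Suc k)"
  by (auto simp: var_ideal_def var_def lookup_single intro!: exI[of _ k])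


section \<open>Minimal free resolutions\<close>

type_synonym ('n, 'k) mvec = "nat \<Rightarrow> ('n, 'k) mpoly"

definition fmap :: "nat \<Rightarrow> nat \<Rightarrow> (nat \<Rightarrow> nat \<Rightarrow> 'a::comm_ring_1) \<Rightarrow> (nat \<Rightarrow> 'a) \<Rightarrow> nat \<Rightarrow> 'a" where
  "fmap p q m v = (\<lambda>l. if l < p then \<Sum>k<q. m l k * v k else 0)"

lemma fmap_add: "fmap p q m (u + v) = fmap p q m u + fmap p q m v"
  by (rule ext) (simp add: fmap_def distrib_left sum.distrib)

lemma fmap_vscale: "fmap p q m (vscale c v) = vscale c (fmap p q m v)"
  by (rule ext) (simp add: fmap_def vscale_def sum_distrib_left mult.left_commute)

lemma fmap_uminus: "fmap p q m (- v) = - fmap p q m v"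
  by (rule ext) (simp add: fmap_def sum_negf)

lemma fmap_diff: "fmap p q m (u - v) = fmap p q m u - fmap p q m v"
  using fmap_add[of p q m u "- v"] by (simp add: fmap_uminus)

lemma fmap_zero [simp]: "fmap p q m 0 = 0"
  by (rule ext) (simp add: fmap_def)

lemma fmap_vsupp: "fmap p q m v \<in> vsupp p"
  by (simp add: fmap_def vsupp_def)

lemma vpart_add: "u \<in> vpart a z \<Longrightarrow> v \<in> vpart a z \<Longrightarrow> u + v \<in> vpart a z"
  by (auto simp: vpart_def hpart_add)

lemma vpart_diff: "u \<in> vpart a z \<Longrightarrow> v \<in> vpart a z \<Longrightarrow> u - v \<in> vpart a z"
  by (auto simp: vpart_def hpart_diff)

lemma vpart_uminus: "v \<in> vpart a z \<Longrightarrow> - v \<in> vpart a z"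
  by (auto simp: vpart_def hpart_uminus)

lemma vpart_zero [simp]: "0 \<in> vpart a z"
  by (auto simp: vpart_def)

lemma vsupp_zero [simp]: "0 \<in> vsupp n"
  by (simp add: vsupp_def)

lemma vsupp_add: "u \<in> vsupp n \<Longrightarrow> v \<in> vsupp n \<Longrightarrow> u + v \<in> vsupp n" for u v :: "nat \<Rightarrow> 'a::monoid_add"
  by (simp add: vsupp_def)

lemma vsupp_diff: "u \<in> vsupp n \<Longrightarrow> v \<in> vsupp n \<Longrightarrow> u - v \<in> vsupp n" for u v :: "nat \<Rightarrow> 'a::ab_group_add"
  by (simp add: vsupp_def)

lemma vsupp_uminus: "v \<in> vsupp n \<Longrightarrow> - v \<in> vsupp n" for v :: "nat \<Rightarrow> 'a::ab_group_add"
  by (simp add: vsupp_def)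

lemma vsupp_vscale: "v \<in> vsupp n \<Longrightarrow> vscale c v \<in> vsupp n"
  by (simp add: vsupp_def vscale_def)

lemma vsupp_vcomp: "v \<in> vsupp n \<Longrightarrow> vcomp a z v \<in> vsupp n"
  by (simp add: vsupp_def vcomp_def)

lemma vscale_vpart: "c \<in> hpart y \<Longrightarrow> v \<in> vpart a z \<Longrightarrow> y + z = w \<Longrightarrow> vscale c v \<in> vpart a w"
  unfolding vpart_def vscale_def by (auto intro!: hpart_mult_graded)

lemma vcomp_id: "v \<in> vpart a z \<Longrightarrow> vcomp a z v = v"
  by (rule ext) (simp add: vcomp_def vpart_def hcomp_id)

lemma vcomp_fmap:
  assumes "\<And>l k. l < p \<Longrightarrow> k < q \<Longrightarrow> m l k \<in> hpart (b k - a l)"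
  shows "vcomp a z (fmap p q m v) = fmap p q m (vcomp b z v)"
proof
  fix l
  have "hcomp (z - a l) (m l k * v k) = m l k * hcomp (z - b k) (v k)" if "l < p" "k < q" for k
    using hcomp_mult[OF assms[OF that], of "z - a l" "v k"] by simp
  then show "vcomp a z (fmap p q m v) l = fmap p q m (vcomp b z v) l"
    by (simp add: vcomp_def fmap_def hcomp_sum)
qed

lemma fmap_vpart:
  assumes "\<And>l k. l < p \<Longrightarrow> k < q \<Longrightarrow> m l k \<in> hpart (b k - a l)" "v \<in> vpart b z"
  shows "fmap p q m v \<in> vpart a z"
proof -
  have "vcomp a z (fmap p q m v) = fmap p q m v"
    using vcomp_fmap[OF assms(1), where z = z and v = v] vcomp_id[OF assms(2)] by simp
  then show ?thesis using vcomp_in[of a z "fmap p q m v"] by simp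
qed

text \<open>
  The mapping cone of multiplication by a nonzerodivisor \<open>h\<close> on a resolution \<open>F\<close> of \<open>S/I\<close>
  resolves \<open>S/(I, h)\<close>, whose largest nonzero degree is \<open>top\<close>.
\<close>

locale resolution_with_form =
  fixes I :: "('n::finite, 'k::field) mpoly set" and r :: "nat \<Rightarrow> nat" and a :: "nat \<Rightarrow> nat \<Rightarrow> int"
    and m :: "nat \<Rightarrow> nat \<Rightarrow> nat \<Rightarrow> ('n, 'k) mpoly" and h :: "('n, 'k) mpoly" and e top :: int
  assumes r0: "r 0 = 1" and a0: "a 0 0 = 0"
    and hom: "l < r i \<Longrightarrow> k < r (Suc i) \<Longrightarrow> m i l k \<in> hpart (a (Suc i) k - a i l)"
    and minimal: "l < r i \<Longrightarrow> k < r (Suc i) \<Longrightarrow> m i l k \<in> irrelevant"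
    and image: "I = {fmap (r 0) (r 1) (m 0) v 0 | v. v \<in> vsupp (r 1)}"
    and exact: "v \<in> vsupp (r (Suc i)) \<Longrightarrow> fmap (r i) (r (Suc i)) (m i) v = 0 \<longleftrightarrow>
      (\<exists>w\<in>vsupp (r (Suc (Suc i))). v = fmap (r (Suc i)) (r (Suc (Suc i))) (m (Suc i)) w)"
    and I: "graded_ideal I"
    and h: "h \<in> hpart e" and e: "0 < e" and nzd: "h * f \<in> I \<Longrightarrow> f \<in> I"
    and above: "top < j \<Longrightarrow> hpart j \<subseteq> idl.span (insert h I)"
    and attop: "\<not> hpart top \<subseteq> idl.span (insert h I)"
begin

definition D :: "nat \<Rightarrow> ('n, 'k) mvec \<Rightarrow> nat \<Rightarrow> ('n, 'k) mpoly" where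
  "D i = fmap (r i) (r (Suc i)) (m i)"

definition F :: "nat \<Rightarrow> int \<Rightarrow> ('n, 'k) mvec set" where
  "F i j = vsupp (r i) \<inter> vpart (a i) j"

lemma F_zero: "0 \<in> F i j"
  and F_diff: "u \<in> F i j \<Longrightarrow> v \<in> F i j \<Longrightarrow> u - v \<in> F i j"
  and F_add: "u \<in> F i j \<Longrightarrow> v \<in> F i j \<Longrightarrow> u + v \<in> F i j"
  and F_uminus: "v \<in> F i j \<Longrightarrow> - v \<in> F i j"
  by (simp_all add: F_def vsupp_diff vpart_diff vsupp_add vpart_add vsupp_uminus vpart_uminus)

lemma F_vscale: "c \<in> hpart y \<Longrightarrow> v \<in> F i z \<Longrightarrow> y + z = w \<Longrightarrow> vscale c v \<in> F i w"
  by (auto simp: F_def vsupp_vscale intro: vscale_vpart)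

lemma D_F: "v \<in> F (Suc i) j \<Longrightarrow> D i v \<in> F i j"
  using fmap_vpart[OF hom] by (auto simp: F_def D_def fmap_vsupp)

lemma D_add: "D i (u + v) = D i u + D i v" by (simp add: D_def fmap_add)
lemma D_diff: "D i (u - v) = D i u - D i v" by (simp add: D_def fmap_diff)
lemma D_uminus: "D i (- v) = - D i v" by (simp add: D_def fmap_uminus)
lemma D_vscale: "D i (vscale c v) = vscale c (D i v)" by (simp add: D_def fmap_vscale)

lemma DD: "w \<in> vsupp (r (Suc (Suc i))) \<Longrightarrow> D i (D (Suc i) w) = 0"
  unfolding D_def by (subst exact[OF fmap_vsupp]) blast

lemma vcomp_D: "vcomp (a i) j (D i w) = D i (vcomp (a (Suc i)) j w)"
  unfolding D_def by (rule vcomp_fmap[OF hom])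

text \<open>\<open>D\<close> preserves degrees, so the component of degree \<open>j\<close> of any
  preimage is again a preimage.\<close>

lemma D_exact:
  assumes "v \<in> F (Suc i) j" "D i v = 0"
  shows "\<exists>w\<in>F (Suc (Suc i)) j. D (Suc i) w = v"
proof -
  obtain w where w: "w \<in> vsupp (r (Suc (Suc i)))" "v = D (Suc i) w"
    using assms exact by (auto simp: F_def D_def)
  have "D (Suc i) (vcomp (a (Suc (Suc i))) j w) = vcomp (a (Suc i)) j v"
    unfolding w(2) vcomp_D ..
  also have "\<dots> = v" using assms by (simp add: vcomp_id F_def)
  finally show ?thesis using w(1) by (intro bexI[of _ "vcomp (a (Suc (Suc i))) j w"]) (auto simp: F_def vsupp_vcomp vcomp_in)
qed

lemma vsupp_1_eq: "v \<in> vsupp (r 0) \<Longrightarrow> w \<in> vsupp (r 0) \<Longrightarrow> v 0 = w 0 \<Longrightarrow> v = w"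
  by (rule ext) (metis (mono_tags, lifting) One_nat_def Suc_leI mem_Collect_eq neq0_conv r0 vsupp_def)

lemma D_image_0:
  assumes "v \<in> F 0 j" "v 0 \<in> I"
  shows "\<exists>w\<in>F 1 j. D 0 w = v"
proof -
  obtain w where w: "w \<in> vsupp (r 1)" "v 0 = D 0 w 0" using assms image by (auto simp: D_def)
  have "v = D 0 w" using assms w by (intro vsupp_1_eq) (auto simp: F_def D_def fmap_vsupp)
  have "D 0 (vcomp (a 1) j w) = vcomp (a 0) j (D 0 w)"
    unfolding vcomp_D One_nat_def ..
  also have "\<dots> = v" using assms \<open>v = D 0 w\<close> by (simp add: vcomp_id F_def)
  finally show ?thesis using w(1) by (intro bexI[of _ "vcomp (a 1) j w"]) (auto simp: F_def vsupp_vcomp vcomp_in)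
qed

lemma D_0_in: "w \<in> vsupp (r 1) \<Longrightarrow> D 0 w 0 \<in> I"
  using image by (auto simp: D_def)

text \<open>The second summand of the cone: \<open>F\<close> moved up one index and twisted by
  \<open>e\<close>, hence zero at index 0.\<close>

fun F' :: "nat \<Rightarrow> int \<Rightarrow> ('n, 'k) mvec set" where
  "F' 0 j = {0}" |
  "F' (Suc i) j = F i (j - e)"

fun D' :: "nat \<Rightarrow> ('n, 'k) mvec \<Rightarrow> nat \<Rightarrow> ('n, 'k) mpoly" where
  "D' 0 w = 0" |
  "D' (Suc i) w = D i w"

definition cone :: "nat \<Rightarrow> int \<Rightarrow> (('n, 'k) mvec \<times> ('n, 'k) mvec) set" where
  "cone i j = F i j \<times> F' i j"

text \<open>The sign makes the two copies of \<open>vscale h (D i w)\<close> in the composite of two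
  differentials cancel.\<close>

definition cone_d :: "nat \<Rightarrow> ('n, 'k) mvec \<times> ('n, 'k) mvec \<Rightarrow> ('n, 'k) mvec \<times> ('n, 'k) mvec" where
  "cone_d i v = (D i (fst v) + vscale h (snd v), - D' i (snd v))"

definition cone_x :: "nat \<Rightarrow> ('n, 'k) mvec \<times> ('n, 'k) mvec \<Rightarrow> ('n, 'k) mvec \<times> ('n, 'k) mvec" where
  "cone_x k v = (vscale (var (var_enum k)) (fst v), vscale (var (var_enum k)) (snd v))"

definition Xv :: "nat \<Rightarrow> ('n, 'k) mvec set" where
  "Xv k = {v. \<forall>l. v l \<in> var_ideal k}"

definition cone_X :: "nat \<Rightarrow> nat \<Rightarrow> int \<Rightarrow> (('n, 'k) mvec \<times> ('n, 'k) mvec) set" where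
  "cone_X k i j = cone i j \<inter> (Xv k \<times> Xv k)"

lemma F'_zero: "0 \<in> F' i j" by (cases i) (auto simp: F_zero)
lemma F'_diff: "u \<in> F' i j \<Longrightarrow> v \<in> F' i j \<Longrightarrow> u - v \<in> F' i j" by (cases i) (auto simp: F_diff)
lemma F'_uminus: "v \<in> F' i j \<Longrightarrow> - v \<in> F' i j" by (cases i) (auto simp: F_uminus)
lemma F'_vscale: "c \<in> hpart y \<Longrightarrow> v \<in> F' i z \<Longrightarrow> y + z = w \<Longrightarrow> vscale c v \<in> F' i w"
  by (cases i) (auto intro: F_vscale)
lemma D'_F': "v \<in> F' (Suc i) j \<Longrightarrow> D' i v \<in> F' i j" by (cases i) (auto simp: D_F)
lemma D'_diff: "D' i (u - v) = D' i u - D' i v" by (cases i) (auto simp: D_diff)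
lemma D'_vscale: "D' i (vscale c v) = vscale c (D' i v)" by (cases i) (auto simp: D_vscale)

lemma Xv_zero: "0 \<in> Xv k" using idl.subspace_0[OF var_ideal_subspace] by (auto simp: Xv_def)
lemma Xv_add: "u \<in> Xv k \<Longrightarrow> v \<in> Xv k \<Longrightarrow> u + v \<in> Xv k"
  by (auto simp: Xv_def intro: idl.subspace_add[OF var_ideal_subspace])
lemma Xv_diff: "u \<in> Xv k \<Longrightarrow> v \<in> Xv k \<Longrightarrow> u - v \<in> Xv k"
  by (auto simp: Xv_def intro: idl.subspace_diff[OF var_ideal_subspace])
lemma Xv_uminus: "u \<in> Xv k \<Longrightarrow> - u \<in> Xv k"
  using idl.subspace_neg[OF var_ideal_subspace] by (auto simp: Xv_def)
lemma Xv_vscale: "u \<in> Xv k \<Longrightarrow> vscale c u \<in> Xv k"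
  using idl.subspace_scale[OF var_ideal_subspace] by (auto simp: Xv_def vscale_def)
lemma Xv_D: "u \<in> Xv k \<Longrightarrow> D i u \<in> Xv k"
  using idl.subspace_scale[OF var_ideal_subspace] idl.subspace_0[OF var_ideal_subspace]
  by (auto simp: Xv_def D_def fmap_def intro!: idl.subspace_sum[OF var_ideal_subspace])
lemma Xv_D': "u \<in> Xv k \<Longrightarrow> D' i u \<in> Xv k"
  by (cases i) (auto simp: Xv_D Xv_zero)

lemma Xv_0: "Xv 0 = {0}"
  by (auto simp: Xv_def var_ideal_0 fun_eq_iff)

lemma Xv_regular: "k < card (UNIV :: 'n set) \<Longrightarrow> vscale (var (var_enum k)) v \<in> Xv k \<Longrightarrow> v \<in> Xv k"
  using var_ideal_regular by (auto simp: Xv_def vscale_def)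

lemma Xv_Suc_F:
  assumes "v \<in> F i j" "v \<in> Xv (Suc k)"
  shows "\<exists>u\<in>F i (j - 1). \<exists>w\<in>F i j. w \<in> Xv k \<and> v = vscale (var (var_enum k)) u + w"
proof -
  have "\<exists>u w. u \<in> hpart (j - 1 - a i l) \<and> w \<in> hpart (j - a i l) \<and> w \<in> var_ideal k \<and>
      v l = var (var_enum k) * u + w \<and> (r i \<le> l \<longrightarrow> u = 0 \<and> w = 0)" for l
  proof (cases "r i \<le> l")
    case True
    then have "v l = 0" using assms by (simp add: F_def vsupp_def)
    then show ?thesis using idl.subspace_0[OF var_ideal_subspace] by (intro exI[of _ 0]) simp
  next
    case False
    have "v l \<in> hpart (j - a i l)" "v l \<in> var_ideal (Suc k)"
      using assms by (auto simp: F_def vpart_def Xv_def)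
    from var_ideal_Suc[OF this] obtain g f' where "g \<in> hpart (j - a i l - 1)" "f' \<in> hpart (j - a i l)"
      "f' \<in> var_ideal k" "v l = var (var_enum k) * g + f'" by blast
    moreover have "j - a i l - 1 = j - 1 - a i l" by simp
    ultimately show ?thesis using False by metis
  qed
  then obtain u w where uw: "\<And>l. u l \<in> hpart (j - 1 - a i l)" "\<And>l. w l \<in> hpart (j - a i l)"
    "\<And>l. w l \<in> var_ideal k" "\<And>l. v l = var (var_enum k) * u l + w l" "\<And>l. r i \<le> l \<Longrightarrow> u l = 0"
    "\<And>l. r i \<le> l \<Longrightarrow> w l = 0" by metis
  have "v = vscale (var (var_enum k)) u + w" by (rule ext) (simp add: uw(4) vscale_def)
  moreover have "u \<in> F i (j - 1)" "w \<in> F i j" "w \<in> Xv k"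
    using uw by (auto simp: F_def vsupp_def vpart_def Xv_def)
  ultimately show ?thesis by blast
qed

lemma Xv_Suc_F':
  assumes "v \<in> F' i j" "v \<in> Xv (Suc k)"
  shows "\<exists>u\<in>F' i (j - 1). \<exists>w\<in>F' i j. w \<in> Xv k \<and> v = vscale (var (var_enum k)) u + w"
proof (cases i)
  case 0
  then show ?thesis using assms Xv_zero by simp
next
  case (Suc i')
  then have "v \<in> F i' (j - e)" using assms by simp
  moreover have "j - e - 1 = j - 1 - e" by simp
  ultimately show ?thesis using Xv_Suc_F[OF _ assms(2)] Suc by (metis F'.simps(2))
qed

lemma Xv_Suc_I: "u \<in> Xv k \<Longrightarrow> u \<in> Xv (Suc k)"
  using var_ideal_mono by (auto simp: Xv_def)

lemma Xv_var: "vscale (var (var_enum k)) u \<in> Xv (Suc k)"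
  using idl.subspace_scale[OF var_ideal_subspace var_in_var_ideal] by (auto simp: Xv_def vscale_def mult.commute)

text \<open>For a cycle \<open>(u, w)\<close> one has \<open>vscale h w = - D i u\<close>. At
  \<open>i = 0\<close> this puts \<open>h * w 0\<close> into \<open>I\<close>, hence also
  \<open>w 0\<close>; at larger \<open>i\<close> the element \<open>w\<close> is a cycle. Either way
  \<open>w = D i w'\<close>, and then \<open>u + vscale h w'\<close> is a cycle of the
  resolution.\<close>

lemma cone_exact:
  assumes v: "v \<in> cone (Suc i) j" "cone_d i v = 0"
  shows "\<exists>w\<in>cone (Suc (Suc i)) j. cone_d (Suc i) w = v"
proof -
  obtain u w where vuw: "v = (u, w)" by (cases v)
  have u: "u \<in> F (Suc i) j" and w: "w \<in> F i (j - e)" using v by (auto simp: vuw cone_def)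
  have d1: "D i u + vscale h w = 0" and d2: "D' i w = 0"
    using v(2) by (auto simp: cone_d_def vuw zero_prod_def)
  have "\<exists>w'\<in>F (Suc i) (j - e). D i w' = w"
  proof (cases i)
    case 0
    have "vscale h w 0 = - D 0 u 0" using d1 0 by (metis add_eq_0_iff uminus_apply)
    moreover have "D 0 u 0 \<in> I" using u 0 by (intro D_0_in) (auto simp: F_def)
    ultimately have "h * w 0 \<in> I" using idl.subspace_neg[OF graded_ideal_subspace[OF I]] by (simp add: vscale_def)
    then have "w 0 \<in> I" by (rule nzd)
    then show ?thesis using D_image_0 w 0 by simp
  next
    case (Suc i')
    then show ?thesis using D_exact w d2 by simp
  qed
  then obtain w' where w': "w' \<in> F (Suc i) (j - e)" "D i w' = w" by blast
  have "u + vscale h w' \<in> F (Suc i) j" using u w' h by (intro F_add F_vscale[of h e]) auto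
  moreover have "D i (u + vscale h w') = 0" using d1 w' by (simp add: D_add D_vscale)
  ultimately obtain u' where u': "u' \<in> F (Suc (Suc i)) j" "D (Suc i) u' = u + vscale h w'"
    using D_exact by blast
  have "vscale h (- w') = - vscale h w'" by (rule ext) (simp add: vscale_def)
  then have "cone_d (Suc i) (u', - w') = v"
    using u' w' by (simp add: cone_d_def vuw D_uminus)
  moreover have "(u', - w') \<in> cone (Suc (Suc i)) j" using u' w' by (simp add: cone_def F_uminus)
  ultimately show ?thesis by blast
qed

text \<open>The cokernel at index 0 is \<open>S/(I, h)\<close>, which is zero above
  \<open>top\<close>; a homogeneous cofactor of \<open>h\<close> provides the second entry of the
  preimage.\<close>

lemma cone_top:
  assumes "top < j" "v \<in> cone 0 j"
  shows "\<exists>w\<in>cone 1 j. cone_d 0 w = v"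
proof -
  obtain u where vu: "v = (u, 0)" "u \<in> F 0 j" using assms by (auto simp: cone_def)
  have "u 0 \<in> hpart (j - a 0 0)" using vu by (simp add: F_def vpart_def)
  then have u0: "u 0 \<in> hpart j" by (simp add: a0)
  then obtain g where g: "g \<in> hpart (j - e)" "u 0 - g * h \<in> I"
    using span_insert_homogeneous[OF I h] above[OF assms(1)] by blast
  define w where "w = (\<lambda>l :: nat. if l = 0 then g else 0 :: ('n, 'k) mpoly)"
  have w: "w \<in> F 0 (j - e)" using g by (auto simp: w_def F_def vsupp_def vpart_def r0 a0)
  have "u - vscale h w \<in> F 0 j" using vu w h by (intro F_diff F_vscale[of h e]) auto
  moreover have "(u - vscale h w) 0 \<in> I" using g by (simp add: vscale_def w_def mult.commute)
  ultimately obtain u' where u': "u' \<in> F 1 j" "D 0 u' = u - vscale h w" using D_image_0 by blast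
  then have "cone_d 0 (u', w) = v" by (simp add: cone_d_def vu zero_fun_def)
  moreover have "(u', w) \<in> cone 1 j" using u' w by (simp add: cone_def)
  ultimately show ?thesis by blast
qed

lemma cone_at_top: "\<exists>v\<in>cone 0 top. \<forall>w\<in>cone 1 top. cone_d 0 w \<noteq> v"
proof -
  obtain f where f: "f \<in> hpart top" "f \<notin> idl.span (insert h I)" using attop by blast
  define u where "u = (\<lambda>l :: nat. if l = 0 then f else 0 :: ('n, 'k) mpoly)"
  have "(u, 0) \<in> cone 0 top" using f by (auto simp: u_def cone_def F_def vsupp_def vpart_def r0 a0)
  moreover have "cone_d 0 w \<noteq> (u, 0)" if w: "w \<in> cone 1 top" for w
  proof
    assume "cone_d 0 w = (u, 0)"
    then have "D 0 (fst w) 0 + vscale h (snd w) 0 = f" by (simp add: cone_d_def u_def fun_eq_iff split: if_splits)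
    then have "f - snd w 0 * h = D 0 (fst w) 0" by (simp add: vscale_def mult.commute algebra_simps)
    moreover have "D 0 (fst w) 0 \<in> I" using w by (intro D_0_in) (auto simp: cone_def F_def)
    ultimately show False using f span_insert_ideal[OF graded_ideal_subspace[OF I]] by metis
  qed
  ultimately show ?thesis by blast
qed

text \<open>The filtration consists of the cone elements with all entries in the ideal of the first
  \<open>k\<close> variables; on free modules the variables form a regular sequence.\<close>

sublocale cone: variable_filtration cone cone_d cone_x cone_X "card (UNIV :: 'n set)" top
proof
  fix i j u v
  show "0 \<in> cone i j" by (simp add: cone_def zero_prod_def F_zero F'_zero)
  show "u \<in> cone i j \<Longrightarrow> v \<in> cone i j \<Longrightarrow> u - v \<in> cone i j"
    by (cases u; cases v) (simp add: cone_def F_diff F'_diff)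
  show "v \<in> cone (Suc i) j \<Longrightarrow> cone_d i v \<in> cone i j"
    using h by (cases v) (auto simp: cone_def cone_d_def intro!: F_add D_F F'_uminus D'_F' F_vscale[of h e])
  show "cone_d i (u - v) = cone_d i u - cone_d i v"
    by (cases u; cases v) (simp add: cone_d_def D_diff D'_diff vm.scale_right_diff_distrib)
  fix k
  show "v \<in> cone i j \<Longrightarrow> cone_x k v \<in> cone i (j + 1)"
    using var_hpart by (cases v) (auto simp: cone_def cone_x_def intro!: F_vscale[of _ 1] F'_vscale[of _ 1])
  show "cone_x k (u - v) = cone_x k u - cone_x k v"
    by (cases u; cases v) (simp add: cone_x_def vm.scale_right_diff_distrib)
  show "cone_d i (cone_d (Suc i) v) = 0" if v: "v \<in> cone (Suc (Suc i)) j"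
  proof -
    obtain u w where uw: "v = (u, w)" "u \<in> F (Suc (Suc i)) j" "w \<in> F (Suc i) (j - e)"
      using v by (cases v) (auto simp: cone_def)
    have "D i (D (Suc i) u) = 0" using uw by (intro DD) (simp add: F_def)
    moreover have "D' i (D i w) = 0"
    proof (cases i)
      case (Suc i')
      then show ?thesis using uw DD by (simp add: F_def)
    qed simp
    moreover have "D' i (- D i w) = - D' i (D i w)" using D'_diff[of i 0 "D i w"] D'_diff[of i 0 0] by simp
    moreover have "vscale h (- D i w) = - vscale h (D i w)" by (rule ext) (simp add: vscale_def)
    ultimately show ?thesis by (simp add: cone_d_def uw D_add D_vscale zero_prod_def)
  qed
  show "cone_d i (cone_x k v) = cone_x k (cone_d i v)"
    by (cases v) (simp add: cone_d_def cone_x_def D_vscale D'_vscale vm.scale_right_distrib vm.scale_left_commute[of h] mult.commute[of h])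
  show "cone_X 0 i j = {0}"
    by (auto simp: cone_X_def Xv_0 cone_def F_zero F'_zero zero_prod_def)
  show "u \<in> cone_X k i j \<Longrightarrow> v \<in> cone_X k i j \<Longrightarrow> u - v \<in> cone_X k i j"
    by (cases u; cases v) (simp add: cone_X_def cone_def F_diff F'_diff Xv_diff)
  show "v \<in> cone_X (Suc k) i j \<longleftrightarrow> (\<exists>u\<in>cone i (j - 1). \<exists>w\<in>cone_X k i j. v = cone_x k u + w)"
  proof
    assume v: "v \<in> cone_X (Suc k) i j"
    obtain v1 v2 where v12: "v = (v1, v2)" by (cases v)
    obtain u1 w1 where 1: "u1 \<in> F i (j - 1)" "w1 \<in> F i j" "w1 \<in> Xv k" "v1 = vscale (var (var_enum k)) u1 + w1"
      using Xv_Suc_F[of v1 i j k] v by (auto simp: v12 cone_X_def cone_def)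
    obtain u2 w2 where 2: "u2 \<in> F' i (j - 1)" "w2 \<in> F' i j" "w2 \<in> Xv k" "v2 = vscale (var (var_enum k)) u2 + w2"
      using Xv_Suc_F'[of v2 i j k] v by (auto simp: v12 cone_X_def cone_def)
    show "\<exists>u\<in>cone i (j - 1). \<exists>w\<in>cone_X k i j. v = cone_x k u + w"
      by (rule bexI[of _ "(u1, u2)"], rule bexI[of _ "(w1, w2)"]) (use 1 2 in \<open>auto simp: v12 cone_x_def cone_X_def cone_def\<close>)
  next
    assume "\<exists>u\<in>cone i (j - 1). \<exists>w\<in>cone_X k i j. v = cone_x k u + w"
    then obtain u w where uw: "u \<in> cone i (j - 1)" "w \<in> cone_X k i j" "v = cone_x k u + w" by blast
    have "cone_x k u \<in> cone i j"
      using uw(1) var_hpart by (cases u) (auto simp: cone_def cone_x_def intro!: F_vscale[of _ 1] F'_vscale[of _ 1])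
    moreover have "c + b \<in> cone i j" if "c \<in> cone i j" "b \<in> cone i j" for b c
      using that F'_diff[of "snd c" i j "- snd b"] F'_uminus by (cases c; cases b) (auto simp: cone_def F_add)
    ultimately have "v \<in> cone i j" using uw by (auto simp: cone_X_def)
    moreover have "v \<in> Xv (Suc k) \<times> Xv (Suc k)"
      using uw by (cases u; cases w) (auto simp: cone_X_def cone_x_def intro!: Xv_add intro: Xv_var Xv_Suc_I)
    ultimately show "v \<in> cone_X (Suc k) i j" by (simp add: cone_X_def)
  qed
  show "cone_d i v \<in> cone_X k i j" if "v \<in> cone_X k (Suc i) j"
  proof -
    have "cone_d i v \<in> cone i j"
      using that h by (cases v) (auto simp: cone_X_def cone_def cone_d_def intro!: F_add D_F F'_uminus D'_F' F_vscale[of h e])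
    then show ?thesis
      using that by (cases v) (auto simp: cone_X_def cone_d_def intro!: Xv_add Xv_D Xv_D' Xv_uminus Xv_vscale)
  qed
  show "cone_x l v \<in> cone_X k i (j + 1)" if "v \<in> cone_X k i j" for l
    using that var_hpart by (cases v) (auto simp: cone_X_def cone_def cone_x_def intro!: F_vscale[of _ 1] F'_vscale[of _ 1] Xv_vscale)
  show "v \<in> cone_X k i j" if "k < card (UNIV :: 'n set)" "v \<in> cone i j" "cone_x k v \<in> cone_X k i (j + 1)"
    using that by (cases v) (auto simp: cone_X_def cone_x_def dest: Xv_regular)
  show "v \<in> cone (Suc i) j \<Longrightarrow> cone_d i v = 0 \<Longrightarrow> \<exists>w\<in>cone (Suc (Suc i)) j. cone_d (Suc i) w = v"
    by (rule cone_exact)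
  show "top < j \<Longrightarrow> v \<in> cone 0 j \<Longrightarrow> \<exists>w\<in>cone 1 j. cone_d 0 w = v"
    by (rule cone_top)
  show "\<exists>v\<in>cone 0 top. \<forall>w\<in>cone 1 top. cone_d 0 w \<noteq> v"
    by (rule cone_at_top)
qed

lemma Xv_all: "Xv (card (UNIV :: 'n set)) = {v. \<forall>l. v l \<in> irrelevant}"
  by (simp add: Xv_def var_ideal_all)

lemma vscale_irrelevant: "vscale h w \<in> Xv (card (UNIV :: 'n set))"
proof -
  have "h \<in> irrelevant" using hpart_irrelevant[OF h] e by simp
  then show ?thesis
    using idl.subspace_scale[OF irrelevant_subspace] by (auto simp: Xv_all vscale_def mult.commute)
qed

lemma D_irrelevant: "D i w \<in> Xv (card (UNIV :: 'n set))"
proof -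
  have "m i l k * w k \<in> irrelevant" if "l < r i" "k < r (Suc i)" for l k
    using idl.subspace_scale[OF irrelevant_subspace minimal[OF that]] by (simp add: mult.commute)
  then show ?thesis
    by (auto simp: Xv_all D_def fmap_def idl.subspace_0[OF irrelevant_subspace]
        intro!: idl.subspace_sum[OF irrelevant_subspace])
qed

lemma D'_irrelevant: "D' i w \<in> Xv (card (UNIV :: 'n set))"
  by (cases i) (auto simp: D_irrelevant Xv_zero)

text \<open>The matrices have no constant terms by minimality, and neither has \<open>h\<close>, as
  \<open>e > 0\<close>. So the cone is minimal, and modulo all variables each generator is a
  homology class.\<close>

lemma cone_d_irrelevant: "w \<in> cone (Suc i) j \<Longrightarrow> cone_d i w \<in> cone_X (card (UNIV :: 'n set)) i j"
  using cone.d_C by (auto simp: cone_X_def cone_d_def Xv_add Xv_uminus D_irrelevant D'_irrelevant vscale_irrelevant)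

text \<open>The generator is tested in the second summand of the cone, at index \<open>i + 1\<close>
  and degree \<open>a i k + e\<close>. The copy in the first summand would only give
  \<open>top\<close>, which is weaker for \<open>e > 1\<close>.\<close>

lemma generator_degree_le:
  assumes k: "k < r i"
  shows "a i k - int i \<le> top - e + 1"
proof -
  define w where "w = (\<lambda>l. if l = k then 1 else 0 :: ('n, 'k) mpoly)"
  have w: "w \<in> F i (a i k)" using k by (auto simp: w_def F_def vsupp_def vpart_def)
  have C: "(0, w) \<in> cone (Suc i) (a i k + e)" using w by (simp add: cone_def F_zero)
  have "cone.cycle (card (UNIV :: 'n set)) (Suc i) (a i k + e) (0, w)"
    using C cone_d_irrelevant[OF C] by (simp add: cone.cycle_def)
  moreover have "(0, w) \<notin> cone_X (card (UNIV :: 'n set)) (Suc i) (a i k + e)"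
  proof
    assume "(0, w) \<in> cone_X (card (UNIV :: 'n set)) (Suc i) (a i k + e)"
    then have "w k \<in> irrelevant" by (auto simp: cone_X_def Xv_all)
    then show False by (simp add: w_def irrelevant_def)
  qed
  ultimately have "a i k + e \<le> top + int (Suc i)"
    using cone_d_irrelevant by (intro cone.degree_bound) auto
  then show ?thesis by simp
qed

lemma generator_degree_attained: "\<exists>i k. k < r i \<and> a i k - int i = top - e + 1"
proof -
  define s where "s = card (UNIV :: 'n set)"
  have s: "s = Suc (s - 1)" by (simp add: s_def card_gt_0_iff)
  obtain v where v: "v \<in> cone s (top + int s)" "v \<notin> cone_X s s (top + int s)"
    unfolding s_def using cone.degree_attained by blast
  obtain u w where uw: "v = (u, w)" by (cases v)
  have gen: "\<exists>k<r i. a i k = j" if u: "u \<in> F i j" "u \<notin> Xv s" for u i j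
  proof -
    obtain k where k: "u k \<notin> irrelevant" using u by (auto simp: Xv_all s_def)
    have "u k \<noteq> 0" using k idl.subspace_0[OF irrelevant_subspace] by metis
    then have "k < r i" using that by (force simp: F_def vsupp_def not_le[symmetric])
    moreover have "j - a i k = 0"
      using hpart_irrelevant[of "u k" "j - a i k"] k that by (auto simp: F_def vpart_def)
    ultimately show ?thesis by (intro exI[of _ k]) simp
  qed
  have "u \<notin> Xv s \<or> w \<notin> Xv s" using v by (auto simp: uw cone_X_def)
  then show ?thesis
  proof
    assume "u \<notin> Xv s"
    moreover have "u \<in> F s (top + int s)" using v by (simp add: uw cone_def)
    ultimately obtain k where k: "k < r s" "a s k = top + int s" using gen by blast
    \<comment> \<open>Here \<open>a s k - int s = top\<close>, so the upper bound and
      \<open>e > 0\<close> force \<open>e = 1\<close>.\<close>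
    then have "a s k - int s = top - e + 1" using generator_degree_le[OF k(1)] e by simp
    then show ?thesis using k by blast
  next
    assume "w \<notin> Xv s"
    moreover have "w \<in> F (s - 1) (top + int s - e)" using v s by (metis F'.simps(2) cone_def mem_Sigma_iff uw)
    ultimately obtain k where k: "k < r (s - 1)" "a (s - 1) k = top + int s - e" using gen by blast
    moreover have "int (s - 1) = int s - 1" using s by simp
    ultimately show ?thesis by (intro exI[of _ "s - 1"] exI[of _ k]) simp
  qed
qed

text \<open>Column \<open>k\<close> of the matrix has a nonzero entry, since otherwise the unit
  vector would be a cycle and hence have entries in \<open>irrelevant\<close>. By minimality that
  entry has positive degree. This lower bound makes the set below \<open>Max\<close> finite although
  no bound on the length of the resolution is given.\<close>

lemma generator_degree_ge: "k < r i \<Longrightarrow> int i \<le> a i k"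
proof (induction i arbitrary: k)
  case 0
  then show ?case by (simp add: r0 a0)
next
  case (Suc i)
  have "\<exists>l<r i. m i l k \<noteq> 0"
  proof (rule ccontr)
    assume neg: "\<not> ?thesis"
    define w where "w = (\<lambda>l. if l = k then 1 else 0 :: ('n, 'k) mpoly)"
    have w: "w \<in> vsupp (r (Suc i))" using Suc.prems by (auto simp: w_def vsupp_def)
    have "D i w = 0"
      using neg Suc.prems by (auto simp: D_def fmap_def w_def fun_eq_iff if_distrib[of "\<lambda>x. _ * x"] cong: if_cong)
    then obtain v where "w = D (Suc i) v" using exact[OF w] by (auto simp: D_def)
    then have "w k \<in> irrelevant" using D_irrelevant by (auto simp: Xv_all)
    then show False by (simp add: w_def irrelevant_def)
  qed
  then obtain l where l: "l < r i" "m i l k \<noteq> 0" by blast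
  have "a (Suc i) k - a i l > 0"
  proof (rule ccontr)
    assume "\<not> ?thesis"
    then consider "a (Suc i) k - a i l < 0" | "a (Suc i) k - a i l = 0" by linarith
    then show False
    proof cases
      case 1
      then show ?thesis using hpart_neg hom[OF l(1) Suc.prems] l(2) by blast
    next
      case 2
      then have "m i l k = single 0 (lookup (m i l k) 0)" using hpart_0_eq hom[OF l(1) Suc.prems] by metis
      moreover have "lookup (m i l k) 0 = 0" using minimal[OF l(1) Suc.prems] by (simp add: irrelevant_def)
      ultimately show ?thesis using l(2) by simp
    qed
  qed
  then show ?case using Suc.IH[OF l(1)] by simp
qed

lemma max_generator_degree: "Max {a i k - int i | i k. k < r i} = top - e + 1"
proof (rule Max_eqI)
  have "{a i k - int i | i k. k < r i} \<subseteq> {0..top - e + 1}"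
    using generator_degree_ge generator_degree_le by fastforce
  then show "finite {a i k - int i | i k. k < r i}" by (rule finite_subset) simp
qed (use generator_degree_le generator_degree_attained in \<open>auto simp: eq_commute\<close>)

end


section \<open>Existence of minimal resolutions and the regularity\<close>

definition vfun :: "nat \<Rightarrow> 'a::zero vec \<Rightarrow> nat \<Rightarrow> 'a" where
  "vfun q x = (\<lambda>k. if k < q then x $ k else 0)"

lemma vfun_vsupp: "vfun q x \<in> vsupp q"
  by (simp add: vfun_def vsupp_def)

lemma vec_vfun: "x \<in> carrier_vec q \<Longrightarrow> vec q (vfun q x) = x"
  by (rule eq_vecI) (auto simp: vfun_def)

lemma vfun_vec: "v \<in> vsupp q \<Longrightarrow> vfun q (vec q v) = v"
  by (rule ext) (auto simp: vfun_def vsupp_def)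

lemma carrier_vec_eq: "carrier_vec q = vec q ` (vsupp q :: (nat \<Rightarrow> 'a::zero) set)"
proof (intro antisym subsetI)
  fix x :: "'a vec" assume "x \<in> carrier_vec q"
  then show "x \<in> vec q ` vsupp q"
    by (intro image_eqI[of _ _ "vfun q x"]) (simp_all add: vec_vfun vfun_vsupp)
qed auto

lemma mult_mat_vec_fmap:
  "A \<in> carrier_mat p q \<Longrightarrow> A *\<^sub>v vec q v = vec p (fmap p q (\<lambda>l k. A $$ (l, k)) v)"
  by (rule eq_vecI) (auto simp: fmap_def scalar_prod_def atLeast0LessThan)

lemma vec_eq_iff_vsupp: "u \<in> vsupp q \<Longrightarrow> v \<in> vsupp q \<Longrightarrow> vec q u = vec q v \<longleftrightarrow> u = v"
  using vfun_vec by metis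

lemma mat_kernel_fmap:
  assumes "A \<in> carrier_mat p q"
  shows "mat_kernel A = vec q ` {v \<in> vsupp q. fmap p q (\<lambda>l k. A $$ (l, k)) v = 0}"
proof -
  have "A *\<^sub>v vec q v = 0\<^sub>v p \<longleftrightarrow> fmap p q (\<lambda>l k. A $$ (l, k)) v = 0" for v
  proof -
    have "0\<^sub>v p = vec p (0 :: nat \<Rightarrow> 'a)" by auto
    then show ?thesis
      unfolding mult_mat_vec_fmap[OF assms] by (simp add: vec_eq_iff_vsupp[OF fmap_vsupp])
  qed
  then show ?thesis unfolding mat_kernel[OF assms] carrier_vec_eq by auto
qed

lemma mat_image_fmap:
  assumes "A \<in> carrier_mat p q"
  shows "{A *\<^sub>v v | v. v \<in> carrier_vec q} = vec p ` fmap p q (\<lambda>l k. A $$ (l, k)) ` vsupp q"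
  by (simp add: Setcompr_eq_image carrier_vec_eq image_image mult_mat_vec_fmap[OF assms])

lemma resolution_with_formI:
  fixes I :: "('n::finite, 'k::field) mpoly set" and e top :: int
  assumes res: "minimal_graded_free_resolution I r a M"
    and I: "graded_ideal I" and h: "h \<in> hpart e" "0 < e" "\<And>f. h * f \<in> I \<Longrightarrow> f \<in> I"
    and top: "\<And>j. top < j \<Longrightarrow> hpart j \<subseteq> idl.span (insert h I)" "\<not> hpart top \<subseteq> idl.span (insert h I)"
  shows "resolution_with_form I r a (\<lambda>i l k. M i $$ (l, k)) h e top"
proof -
  have M: "M i \<in> carrier_mat (r i) (r (Suc i))" for i
    using res by (simp add: minimal_graded_free_resolution_def)
  have r0: "r 0 = 1" using res by (simp add: minimal_graded_free_resolution_def)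
  show ?thesis
  proof
    show "r 0 = 1" "a 0 0 = 0" using res by (simp_all add: minimal_graded_free_resolution_def)
    fix i l k assume lk: "l < r i" "k < r (Suc i)"
    have "\<forall>m\<in>keys (M i $$ (l, k)). a i l + int (mdeg m) = a (Suc i) k"
      using res lk by (simp add: minimal_graded_free_resolution_def)
    then show "M i $$ (l, k) \<in> hpart (a (Suc i) k - a i l)" by (force simp: hpart_def)
    show "M i $$ (l, k) \<in> irrelevant"
      using res lk by (simp add: minimal_graded_free_resolution_def irrelevant_def)
  next
    have "I = {(M 0 *\<^sub>v v) $ 0 | v. v \<in> carrier_vec (r 1)}"
      using res by (simp add: minimal_graded_free_resolution_def)
    also have "\<dots> = {fmap (r 0) (r 1) (\<lambda>l k. M 0 $$ (l, k)) v 0 | v. v \<in> vsupp (r 1)}"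
      by (simp add: Setcompr_eq_image carrier_vec_eq image_image mult_mat_vec_fmap[OF M[of 0]] r0)
    finally show "I = {fmap (r 0) (r 1) (\<lambda>l k. M 0 $$ (l, k)) v 0 | v. v \<in> vsupp (r 1)}" .
  next
    fix v :: "nat \<Rightarrow> ('n, 'k) mpoly" and i assume v: "v \<in> vsupp (r (Suc i))"
    have "{M (Suc i) *\<^sub>v v | v. v \<in> carrier_vec (r (Suc (Suc i)))} = mat_kernel (M i)"
      using res by (simp add: minimal_graded_free_resolution_def)
    then have eq: "vec (r (Suc i)) ` fmap (r (Suc i)) (r (Suc (Suc i))) (\<lambda>l k. M (Suc i) $$ (l, k)) ` vsupp (r (Suc (Suc i))) =
        vec (r (Suc i)) ` {v \<in> vsupp (r (Suc i)). fmap (r i) (r (Suc i)) (\<lambda>l k. M i $$ (l, k)) v = 0}"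
      unfolding mat_image_fmap[OF M] mat_kernel_fmap[OF M] .
    have inj: "inj_on (vec (r (Suc i))) (vsupp (r (Suc i)))"
      by (rule inj_onI) (simp add: vec_eq_iff_vsupp)
    have "fmap (r (Suc i)) (r (Suc (Suc i))) (\<lambda>l k. M (Suc i) $$ (l, k)) ` vsupp (r (Suc (Suc i))) =
        {v \<in> vsupp (r (Suc i)). fmap (r i) (r (Suc i)) (\<lambda>l k. M i $$ (l, k)) v = 0}"
      using eq by (subst (asm) inj_on_image_eq_iff[OF inj]) (auto simp: fmap_vsupp)
    then show "fmap (r i) (r (Suc i)) (\<lambda>l k. M i $$ (l, k)) v = 0 \<longleftrightarrow>
      (\<exists>w\<in>vsupp (r (Suc (Suc i))). v = fmap (r (Suc i)) (r (Suc (Suc i))) (\<lambda>l k. M (Suc i) $$ (l, k)) w)"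
      using v by auto
  qed (use assms in auto)
qed

text \<open>A stage consists of the numbers of rows and columns, their degrees, and the entries.\<close>

type_synonym ('n, 'k) stage = "nat \<times> (nat \<Rightarrow> int) \<times> nat \<times> (nat \<Rightarrow> int) \<times> (nat \<Rightarrow> nat \<Rightarrow> ('n, 'k) mpoly)"

text \<open>Relations among the columns have no constant terms; this second condition hands
  minimality on to the entries of the following stage.\<close>

definition stage_ok :: "('n::finite, 'k::field) stage \<Rightarrow> bool" where
  "stage_ok T = (case T of (p, a, q, b, m) \<Rightarrow>
     (\<forall>l<p. \<forall>k<q. m l k \<in> hpart (b k - a l)) \<and>
     (\<forall>v. fmap p q m v = 0 \<longrightarrow> (\<forall>k<q. v k \<in> irrelevant)))"

definition stage_next :: "('n::finite, 'k::field) stage \<Rightarrow> ('n, 'k) stage \<Rightarrow> bool" where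
  "stage_next T T' = (case T of (p, a, q, b, m) \<Rightarrow> case T' of (p', a', q', b', m') \<Rightarrow>
     p' = q \<and> a' = b \<and> fmap p' q' m' ` vsupp q' = {v \<in> vsupp q. fmap p q m v = 0} \<and>
     (\<forall>l<p'. \<forall>k<q'. m' l k \<in> irrelevant))"

text \<open>Homogeneous generators of \<open>N\<close>, as supplied by
  \<open>minimal_generators\<close>, become the columns of the matrix.\<close>

lemma stage_of_submodule:
  fixes N :: "(nat \<Rightarrow> ('n::finite, 'k::field) mpoly) set"
  assumes "vm.subspace N" "N \<subseteq> vsupp q" "\<And>v z. v \<in> N \<Longrightarrow> vcomp b z v \<in> N"
    and irr: "\<And>v k. v \<in> N \<Longrightarrow> v k \<in> irrelevant"
  shows "\<exists>q' b' m'. stage_ok (q, b, q', b', m') \<and> fmap q q' m' ` vsupp q' = N \<and>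
    (\<forall>l<q. \<forall>k<q'. m' l k \<in> irrelevant)"
proof -
  have "\<exists>(q' :: nat) g b'. (\<forall>k<q'. g k \<in> N \<and> g k \<in> vpart b (b' k)) \<and>
    N = range (\<lambda>c. \<Sum>k<q'. vscale (c k) (g k)) \<and>
    (\<forall>c. (\<Sum>k<q'. vscale (c k) (g k)) = 0 \<longrightarrow> (\<forall>k<q'. lookup (c k) 0 = 0))"
    by (rule minimal_generators[OF assms(1,2)]) (rule assms(3))
  then obtain q' :: nat and g b'
    where g': "\<forall>k<q'. g k \<in> N \<and> g k \<in> vpart b (b' k)"
    and N: "N = range (\<lambda>c. \<Sum>k<q'. vscale (c k) (g k))"
    and rel': "\<forall>c. (\<Sum>k<q'. vscale (c k) (g k)) = 0 \<longrightarrow> (\<forall>k<q'. lookup (c k) 0 = 0)"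
    by (elim exE conjE)
  note g = g'[rule_format] and rel = rel'[rule_format]
  define m' where "m' l k = g k l" for l k
  have eq: "fmap q q' m' c = (\<Sum>k<q'. vscale (c k) (g k))" for c
  proof
    fix l
    have "g k l = 0" if "k < q'" "\<not> l < q" for k
      using g[OF that(1)] assms(2) that(2) by (auto simp: vsupp_def)
    then show "fmap q q' m' c l = (\<Sum>k<q'. vscale (c k) (g k)) l"
      by (auto simp: fmap_def sum_fun_apply vscale_def m'_def mult.commute)
  qed
  have "fmap q q' m' ` vsupp q' = N"
  proof (intro antisym subsetI)
    fix x assume "x \<in> N"
    then obtain c where c: "x = fmap q q' m' c" using N eq by auto
    have "fmap q q' m' c = fmap q q' m' (\<lambda>k. if k < q' then c k else 0)"
      by (auto simp: fmap_def fun_eq_iff intro!: sum.cong)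
    then show "x \<in> fmap q q' m' ` vsupp q'"
      using c by (intro image_eqI[of _ _ "\<lambda>k. if k < q' then c k else 0"]) (auto simp: vsupp_def)
  qed (auto simp: N eq)
  moreover have "stage_ok (q, b, q', b', m')"
    unfolding stage_ok_def using g rel by (auto simp: m'_def vpart_def irrelevant_def eq)
  moreover have "\<forall>l<q. \<forall>k<q'. m' l k \<in> irrelevant" using g irr by (simp add: m'_def)
  ultimately show ?thesis by blast
qed

lemma stage_next_exists:
  fixes T :: "('n::finite, 'k::field) stage"
  assumes "stage_ok T"
  shows "\<exists>T'. stage_ok T' \<and> stage_next T T'"
proof -
  obtain p a q b m where T: "T = (p, a, q, b, m)" by (cases T)
  have hom: "\<And>l k. l < p \<Longrightarrow> k < q \<Longrightarrow> m l k \<in> hpart (b k - a l)"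
    and irr: "\<And>v k. fmap p q m v = 0 \<Longrightarrow> k < q \<Longrightarrow> v k \<in> irrelevant"
    using assms by (auto simp: stage_ok_def T)
  define N where "N = {v \<in> vsupp q. fmap p q m v = 0}"
  have "\<exists>q' b' m'. stage_ok (q, b, q', b', m') \<and> fmap q q' m' ` vsupp q' = N \<and>
    (\<forall>l<q. \<forall>k<q'. m' l k \<in> irrelevant)"
  proof (rule stage_of_submodule)
    show "vm.subspace N"
      by (auto simp: vm.subspace_def N_def fmap_add fmap_vscale vsupp_add vsupp_vscale)
    show "N \<subseteq> vsupp q" by (auto simp: N_def)
    show "vcomp b z v \<in> N" if "v \<in> N" for v z
    proof -
      have "fmap p q m (vcomp b z v) = vcomp a z (fmap p q m v)" by (rule vcomp_fmap[symmetric]) (rule hom)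
      also have "\<dots> = 0" using that by (auto simp: N_def vcomp_def)
      finally show ?thesis using that by (simp add: N_def vsupp_vcomp)
    qed
    show "v k \<in> irrelevant" if "v \<in> N" for v k
    proof (cases "k < q")
      case False
      then have "v k = 0" using that by (simp add: N_def vsupp_def)
      then show ?thesis by (simp add: irrelevant_def)
    qed (use irr that in \<open>auto simp: N_def\<close>)
  qed
  then obtain q' b' m' where "stage_ok (q, b, q', b', m')" "fmap q q' m' ` vsupp q' = N"
    "\<forall>l<q. \<forall>k<q'. m' l k \<in> irrelevant" by blast
  then show ?thesis by (intro exI[of _ "(q, b, q', b', m')"]) (auto simp: T stage_next_def N_def)
qed

text \<open>The constant term of an element of \<open>I\<close> is its component of degree 0 and so
  lies in \<open>I\<close>; if nonzero it would be a unit.\<close>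

lemma graded_proper_irrelevant:
  assumes I: "graded_ideal I" "I \<noteq> UNIV"
  shows "I \<subseteq> irrelevant"
proof
  fix f assume f: "f \<in> I"
  show "f \<in> irrelevant"
  proof (rule ccontr)
    assume c: "f \<notin> irrelevant"
    have sub: "idl.subspace I" using I by (simp add: graded_ideal_subspace)
    have "hcomp 0 f = single 0 (lookup f 0)"
      by (subst hpart_0_eq[OF hcomp_in]) (simp add: lookup_hcomp)
    then have "single 0 (inverse (lookup f 0)) * single 0 (lookup f 0) \<in> I"
      using idl.subspace_scale[OF sub graded_ideal_hcomp[OF I(1) f, of 0]] by simp
    then have "1 \<in> I" using c by (simp add: mult_single irrelevant_def)
    then show False using subspace_eq_UNIV[OF sub] I by blast
  qed
qed

text \<open>Stages are picked by dependent choice, each mapping onto the kernel of the one before,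
  starting from \<open>I\<close> as a submodule of the free module of rank 1.\<close>

theorem minimal_resolution_exists:
  fixes I :: "('n::finite, 'k::field) mpoly set"
  assumes I: "graded_ideal I" "I \<noteq> UNIV"
  shows "\<exists>r a M. minimal_graded_free_resolution I r a M"
proof -
  define N where "N = {v :: nat \<Rightarrow> ('n, 'k) mpoly. v \<in> vsupp 1 \<and> v 0 \<in> I}"
  have sub: "idl.subspace I" using I by (simp add: graded_ideal_subspace)
  have v_eq: "v k = 0" if "v \<in> N" "k \<noteq> 0" for v k
    using that by (cases k) (auto simp: N_def vsupp_def)
  have "\<exists>q' b' m'. stage_ok (1, \<lambda>_. 0, q', b', m') \<and> fmap 1 q' m' ` vsupp q' = N \<and>
    (\<forall>l<1. \<forall>k<q'. m' l k \<in> irrelevant)"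
  proof (rule stage_of_submodule)
    show "vm.subspace N"
      using sub by (auto simp: vm.subspace_def N_def vsupp_add vsupp_vscale idl.subspace_def) (simp add: vscale_def)
    show "vcomp (\<lambda>_. 0) z v \<in> N" if "v \<in> N" for v z
      using that graded_ideal_hcomp[OF I(1)] by (auto simp: N_def vsupp_vcomp) (simp add: vcomp_def)
    show "v k \<in> irrelevant" if "v \<in> N" for v k
      using v_eq[OF that, of k] graded_proper_irrelevant[OF I] that
      by (cases "k = 0") (auto simp: N_def, simp add: irrelevant_def)
  qed (auto simp: N_def)
  then obtain q0 b0 m0 where s0: "stage_ok (1, \<lambda>_. 0, q0, b0, m0)" "fmap 1 q0 m0 ` vsupp q0 = N"
    "\<forall>l<1. \<forall>k<q0. m0 l k \<in> irrelevant" by blast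
  define T0 where "T0 = (1 :: nat, \<lambda>_ :: nat. 0 :: int, q0, b0, m0)"
  have "\<exists>T. \<forall>n. (stage_ok (T n) \<and> (n = 0 \<longrightarrow> T n = T0)) \<and> stage_next (T n) (T (Suc n))"
  proof (rule dependent_nat_choice)
    show "\<exists>T. stage_ok T \<and> ((0 :: nat) = 0 \<longrightarrow> T = T0)" using s0(1) by (auto simp: T0_def)
    fix T :: "('n, 'k) stage" and n :: nat assume "stage_ok T \<and> (n = 0 \<longrightarrow> T = T0)"
    then show "\<exists>T'. (stage_ok T' \<and> (Suc n = 0 \<longrightarrow> T' = T0)) \<and> stage_next T T'"
      using stage_next_exists[of T] by auto
  qed
  then obtain T where T: "T 0 = T0" "\<And>n. stage_ok (T n)" "\<And>n. stage_next (T n) (T (Suc n))" by blast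
  define r where "r i = fst (T i)" for i
  define a where "a i = fst (snd (T i))" for i
  define m where "m i = snd (snd (snd (snd (T i))))" for i
  have next_eq: "fst (snd (snd (T i))) = r (Suc i)" "fst (snd (snd (snd (T i)))) = a (Suc i)" for i
    using T(3)[of i] by (auto simp: stage_next_def r_def a_def split: prod.splits)
  have T_eq: "T i = (r i, a i, r (Suc i), a (Suc i), m i)" for i
    using next_eq[of i] by (simp add: r_def a_def m_def prod_eq_iff)
  have hom: "m i l k \<in> hpart (a (Suc i) k - a i l)" if "l < r i" "k < r (Suc i)" for i l k
    using T(2)[of i] that by (auto simp: stage_ok_def T_eq)
  have exact: "fmap (r (Suc i)) (r (Suc (Suc i))) (m (Suc i)) ` vsupp (r (Suc (Suc i))) =
      {v \<in> vsupp (r (Suc i)). fmap (r i) (r (Suc i)) (m i) v = 0}" for i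
    using T(3)[of i] by (auto simp: stage_next_def T_eq)
  have 0: "r 0 = 1" "a 0 = (\<lambda>_. 0)" "r 1 = q0" "m 0 = m0"
    using T(1) T_eq[of 0] by (auto simp: T0_def)
  have irr: "m i l k \<in> irrelevant" if "l < r i" "k < r (Suc i)" for i l k
  proof (cases i)
    case 0
    then show ?thesis using that s0(3) \<open>r 0 = 1\<close> \<open>r 1 = q0\<close> \<open>m 0 = m0\<close> by simp
  next
    case (Suc j)
    then show ?thesis using T(3)[of j] that by (auto simp: stage_next_def T_eq)
  qed
  define M where "M i = mat (r i) (r (Suc i)) (\<lambda>(l, k). m i l k)" for i
  have M: "M i \<in> carrier_mat (r i) (r (Suc i))" for i by (simp add: M_def)
  have M_idx: "M i $$ (l, k) = m i l k" if "l < r i" "k < r (Suc i)" for i l k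
    using that by (simp add: M_def)
  have fM: "fmap (r i) (r (Suc i)) (\<lambda>l k. M i $$ (l, k)) = fmap (r i) (r (Suc i)) (m i)" for i
    by (intro ext) (auto simp: fmap_def M_idx)
  have "{(M 0 *\<^sub>v v) $ 0 | v. v \<in> carrier_vec (r 1)} = (\<lambda>v. (M 0 *\<^sub>v v) $ 0) ` vec (r (Suc 0)) ` vsupp (r (Suc 0))"
    by (simp add: Setcompr_eq_image carrier_vec_eq)
  also have "\<dots> = (\<lambda>v. v 0) ` fmap (r 0) (r (Suc 0)) (m 0) ` vsupp (r 1)"
    unfolding image_image mult_mat_vec_fmap[OF M] fM by (simp add: 0(1))
  also have "\<dots> = (\<lambda>v. v 0) ` N" using s0(2) 0 by simp
  also have "\<dots> = I"
    by (auto simp: N_def image_iff vsupp_def intro!: exI[of _ "\<lambda>k. if k = 0 then x else 0" for x])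
  finally have img: "{(M 0 *\<^sub>v v) $ 0 | v. v \<in> carrier_vec (r 1)} = I" .
  have ker: "{M (Suc i) *\<^sub>v v | v. v \<in> carrier_vec (r (Suc (Suc i)))} = mat_kernel (M i)" for i
    unfolding mat_image_fmap[OF M] mat_kernel_fmap[OF M] fM exact ..
  have "a i l + int (mdeg x) = a (Suc i) k" if "l < r i" "k < r (Suc i)" "x \<in> keys (M i $$ (l, k))" for i l k x
    using hom[OF that(1,2)] that M_idx by (auto simp: hpart_def)
  then have "minimal_graded_free_resolution I r a M"
    unfolding minimal_graded_free_resolution_def
    using 0(1,2) M img ker irr M_idx by (auto simp: irrelevant_def)
  then show ?thesis by blast
qed

text \<open>Every minimal resolution gives the same maximum, expressed by \<open>top\<close> and
  \<open>e\<close> alone; together with existence this determines the definite description.\<close>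

theorem cm_reg_eq:
  fixes I :: "('n::finite, 'k::field) mpoly set" and e top :: int
  assumes I: "graded_ideal I" "I \<noteq> UNIV"
    and h: "h \<in> hpart e" "0 < e" "\<And>f. h * f \<in> I \<Longrightarrow> f \<in> I"
    and top: "\<And>j. top < j \<Longrightarrow> hpart j \<subseteq> idl.span (insert h I)" "\<not> hpart top \<subseteq> idl.span (insert h I)"
  shows "cm_reg I = top - e + 1"
proof -
  have *: "Max {a i k - int i | i k. k < r i} = top - e + 1" if "minimal_graded_free_resolution I r a M" for r a M
    using resolution_with_form.max_generator_degree[OF resolution_with_formI[OF that I(1) h top]] .
  show ?thesis
    unfolding cm_reg_def
  proof (rule the_equality)
    obtain r a M where res: "minimal_graded_free_resolution I r a M"
      using minimal_resolution_exists[OF I] by (elim exE)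
    show "\<exists>r a M. minimal_graded_free_resolution I r a M \<and> top - e + 1 = Max {a i k - int i | i k. k < r i}"
      using *[OF res] by (intro exI[of _ r] exI[of _ a] exI[of _ M] conjI res) simp
  qed (use * in auto)
qed


section \<open>Hilbert functions\<close>

lemma hpart_S_subspace: "S.subspace (hpart z)"
proof -
  have "scale c f \<in> hpart z" if "f \<in> hpart z" for c f
    using hpart_mult[OF hpart_single[of 0 c] that] by (simp add: scale_def)
  then show ?thesis by (auto simp: S.subspace_def hpart_add)
qed

lemma hpart_span: "(hpart z :: ('a::finite, 'b::field) mpoly set) \<subseteq> S.span ((\<lambda>m. single m 1) ` {m. mdeg m \<le> nat z})"
proof
  fix f :: "('a, 'b) mpoly" assume "f \<in> hpart z"
  then have "f \<in> degree_le (nat z)" by (auto simp: hpart_def degree_le_def)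
  then show "f \<in> S.span ((\<lambda>m. single m 1) ` {m. mdeg m \<le> nat z})" by (rule degree_le_span)
qed

text \<open>A basis \<open>C\<close> of \<open>W\<close>, finite because \<open>W\<close> lies in
  the span of \<open>M\<close>, is added on both sides; this turns the claim into the exchange
  lemma.\<close>

lemma indep_mod_card_le:
  assumes A: "finite A" "indep_mod W A u" "u ` A \<subseteq> S.span (v ` B \<union> W)" and B: "finite B"
    and W: "S.subspace W" "W \<subseteq> S.span M" "finite M"
  shows "card A \<le> card B"
proof -
  obtain C where C: "C \<subseteq> W" "S.independent C" "W \<subseteq> S.span C"
    using S.maximal_independent_subset[of W] by blast
  have fC: "finite C" using S.independent_span_bound[OF W(3) C(2)] C(1) W(2) by blast
  note ind = indep_mod_independent[OF A(1,2) W(1) fC C(1,2)]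
  have W_span: "W \<subseteq> S.span (v ` B \<union> C)" using C(3) S.span_mono[of C "v ` B \<union> C"] by blast
  have "v ` B \<union> W \<subseteq> S.span (v ` B \<union> C)" using W_span S.span_superset[of "v ` B \<union> C"] by blast
  then have "S.span (v ` B \<union> W) \<subseteq> S.span (v ` B \<union> C)" by (rule S.span_minimal) (rule S.subspace_span)
  then have "u ` A \<union> C \<subseteq> S.span (v ` B \<union> C)" using A(3) C(1) W_span by blast
  then have "card (u ` A \<union> C) \<le> card (v ` B \<union> C)"
    using S.independent_span_bound[OF _ ind(1), of "v ` B \<union> C"] B fC by simp
  also have "\<dots> \<le> card B + card C" using card_Un_le[of "v ` B" C] card_image_le[OF B, of v] by linarith
  finally show ?thesis using ind(2) by simp
qed

lemma indep_mod_iff: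
  assumes "finite B" "S.subspace W"
  shows "S.independent B \<and> S.span B \<inter> W = {0} \<longleftrightarrow> indep_mod W B (\<lambda>x. x)"
proof
  assume B: "S.independent B \<and> S.span B \<inter> W = {0}"
  show "indep_mod W B (\<lambda>x. x)"
    unfolding indep_mod_def
  proof (intro allI impI)
    fix c assume "(\<Sum>x\<in>B. scale (c x) x) \<in> W"
    moreover have "(\<Sum>x\<in>B. scale (c x) x) \<in> S.span B" by (intro S.span_sum S.span_scale S.span_base)
    ultimately have "(\<Sum>x\<in>B. scale (c x) x) = 0" using B by blast
    then show "\<forall>x\<in>B. c x = 0" using S.dependent_finite[OF assms(1)] B by blast
  qed
next
  assume ind: "indep_mod W B (\<lambda>x. x)"
  have "S.span B \<inter> W \<subseteq> {0}"
  proof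
    fix x assume x: "x \<in> S.span B \<inter> W"
    then obtain c where c: "x = (\<Sum>v\<in>B. scale (c v) v)" using S.span_finite[OF assms(1)] by auto
    then have "\<forall>v\<in>B. c v = 0" using x ind unfolding indep_mod_def by blast
    then show "x \<in> {0}" using c by simp
  qed
  moreover have "0 \<in> S.span B \<inter> W" using S.subspace_0[OF assms(2)] S.span_zero by blast
  moreover have "S.independent B" using indep_mod_independent(1)[OF assms(1) ind assms(2), of "{}"] S.independent_empty
    by simp
  ultimately show "S.independent B \<and> S.span B \<inter> W = {0}" by blast
qed

text \<open>Any two bases of the quotient bound each other in size, so the definite description is
  determined. The finite set \<open>M\<close> excludes infinite candidates for
  \<open>B\<close>.\<close>

lemma quot_dim_eq:
  assumes A: "finite A" "u ` A \<subseteq> V" "indep_mod W A u" "V \<subseteq> S.span (u ` A \<union> W)"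
    and W: "S.subspace W" "W \<subseteq> V" and V: "V \<subseteq> S.span M" "finite M"
  shows "quot_dim V W = card A"
  unfolding quot_dim_def
proof (rule the_equality)
  have W0: "0 \<in> W" using W(1) by (rule S.subspace_0)
  note inj = indep_mod_inj[OF A(1,3) W0]
  have "indep_mod W (u ` A) (\<lambda>x. x)"
    using A(3) by (auto simp: indep_mod_def sum.reindex[OF inj])
  then have "S.independent (u ` A) \<and> S.span (u ` A) \<inter> W = {0}"
    using indep_mod_iff[OF _ W(1)] A(1) by blast
  then show "\<exists>B\<subseteq>V. S.independent B \<and> S.span B \<inter> W = {0} \<and> V \<subseteq> S.span (B \<union> W) \<and> card A = card B"
    using A by (intro exI[of _ "u ` A"]) (simp add: card_image[OF inj])
next
  fix n assume "\<exists>B\<subseteq>V. S.independent B \<and> S.span B \<inter> W = {0} \<and> V \<subseteq> S.span (B \<union> W) \<and> n = card B"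
  then obtain B where B: "B \<subseteq> V" "S.independent B" "S.span B \<inter> W = {0}" "V \<subseteq> S.span (B \<union> W)" "n = card B" by blast
  have fB: "finite B" using S.independent_span_bound[OF V(2) B(2)] B(1) V(1) by blast
  have ind: "indep_mod W B (\<lambda>x. x)" using indep_mod_iff[OF fB W(1)] B by blast
  have WM: "W \<subseteq> S.span M" using W(2) V(1) by blast
  have "card B \<le> card A"
    using indep_mod_card_le[OF fB ind _ A(1) W(1) WM V(2), of u] B(1) A(4) by auto
  moreover have "card A \<le> card B"
    using indep_mod_card_le[OF A(1,3) _ fB W(1) WM V(2), of "\<lambda>x. x"] A(2) B(4) by auto
  ultimately show "n = card A" using B(5) by simp
qed

text \<open>Take an independent family modulo \<open>W\<close> of greatest size; sizes are bounded
  by that of \<open>M\<close>. A vector outside its span with \<open>W\<close> could be added to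
  it.\<close>

lemma quot_basis_exists:
  assumes W: "S.subspace W" "W \<subseteq> V" and V: "V \<subseteq> S.span M" "finite M"
  shows "\<exists>A\<subseteq>V. finite A \<and> indep_mod W A (\<lambda>x. x) \<and> V \<subseteq> S.span (A \<union> W)"
proof -
  define P where "P A \<longleftrightarrow> A \<subseteq> V \<and> finite A \<and> indep_mod W A (\<lambda>x. x)" for A
  have WM: "W \<subseteq> S.span M" using W(2) V(1) by blast
  have bound: "card A \<le> card M" if "P A" for A
  proof (rule indep_mod_card_le[OF _ _ _ V(2) W(1) WM V(2)])
    show "(\<lambda>x. x) ` A \<subseteq> S.span ((\<lambda>x. x) ` M \<union> W)"
      using that V(1) S.span_mono[of M "M \<union> W"] by (auto simp: P_def)
  qed (use that in \<open>auto simp: P_def\<close>)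
  have "P {}" by (simp add: P_def indep_mod_def)
  then obtain A where A: "P A" and max: "\<And>A'. P A' \<Longrightarrow> card A' \<le> card A"
    using ex_has_greatest_nat[of P "{}" card "Suc (card M)"] bound by (auto simp: less_Suc_eq_le)
  have "V \<subseteq> S.span (A \<union> W)"
  proof (rule subsetI, rule ccontr)
    fix v assume v: "v \<in> V" "v \<notin> S.span (A \<union> W)"
    have vA: "v \<notin> A" using v S.span_base by blast
    have "indep_mod W (insert v A) (\<lambda>x. x)"
      unfolding indep_mod_def
    proof (intro allI impI)
      fix c assume "(\<Sum>x\<in>insert v A. scale (c x) x) \<in> W"
      then have s: "scale (c v) v + (\<Sum>x\<in>A. scale (c x) x) \<in> W" using A vA by (simp add: P_def)
      have "scale (c v) v + (\<Sum>x\<in>A. scale (c x) x) \<in> S.span (A \<union> W)" using s by (intro S.span_base) simp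
      moreover have "(\<Sum>x\<in>A. scale (c x) x) \<in> S.span (A \<union> W)"
        by (intro S.span_sum S.span_scale S.span_base) simp
      ultimately have "scale (c v) v \<in> S.span (A \<union> W)" using S.span_diff by fastforce
      from scale_in_subspaceD[OF S.subspace_span this v(2)] have cv: "c v = 0" .
      then have "(\<Sum>x\<in>A. scale (c x) x) \<in> W" using s by simp
      then have "\<forall>x\<in>A. c x = 0" using A unfolding P_def indep_mod_def by blast
      then show "\<forall>x\<in>insert v A. c x = 0" using cv by simp
    qed
    then have "P (insert v A)" using A v by (simp add: P_def)
    from max[OF this] show False using A vA by (simp add: P_def)
  qed
  then show ?thesis using A by (auto simp: P_def)
qed

text \<open>A basis of the degree \<open>n\<close> part of \<open>S/J\<close>. The index type stays
  free so that two bases can be joined over a disjoint sum.\<close>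

definition hbasis :: "('n::finite, 'k::field) mpoly set \<Rightarrow> nat \<Rightarrow> 'i set \<Rightarrow> ('i \<Rightarrow> ('n, 'k) mpoly) \<Rightarrow> bool" where
  "hbasis J n A u \<longleftrightarrow> finite A \<and> u ` A \<subseteq> hpart (int n) \<and> indep_mod J A u \<and>
    (\<forall>f\<in>hpart (int n). \<exists>c. f - (\<Sum>i\<in>A. scale (c i) (u i)) \<in> J)"

lemma sum_scale_hpart: "u ` A \<subseteq> hpart z \<Longrightarrow> (\<Sum>i\<in>A. scale (c i) (u i)) \<in> hpart z"
  by (intro hpart_sum S.subspace_scale[OF hpart_S_subspace]) auto

lemma indep_mod_Int_hpart:
  "u ` A \<subseteq> hpart z \<Longrightarrow> indep_mod (J \<inter> hpart z) A u \<longleftrightarrow> indep_mod J A u"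
  using sum_scale_hpart unfolding indep_mod_def by blast

lemma span_Un_subspace:
  assumes "finite A" "S.subspace W"
  shows "x \<in> S.span (u ` A \<union> W) \<longleftrightarrow> (\<exists>c. x - (\<Sum>i\<in>A. scale (c i) (u i)) \<in> W)"
proof
  have WW: "S.span W = W" using assms(2) by (simp add: S.span_eq_iff)
  assume "x \<in> S.span (u ` A \<union> W)"
  then have "x \<in> {x + y |x y. x \<in> S.span (u ` A) \<and> y \<in> S.span W}" by (simp only: S.span_Un)
  then obtain y w where y: "y \<in> S.span (u ` A)" "w \<in> W" "x = y + w" using WW by auto
  from y(1) have "\<exists>c. y = (\<Sum>i\<in>A. scale (c i) (u i))"
  proof (induction rule: S.span_induct_alt)
    case base
    show ?case by (intro exI[of _ "\<lambda>_. 0"]) simp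
  next
    case (step k z y)
    then obtain c i where c: "y = (\<Sum>i\<in>A. scale (c i) (u i))" "i \<in> A" "z = u i" by blast
    have "(\<Sum>j\<in>A. scale ((if j = i then k else 0) + c j) (u j)) =
        (\<Sum>j\<in>A. if j = i then scale k (u j) else 0) + (\<Sum>j\<in>A. scale (c j) (u j))"
      by (simp add: S.scale_left_distrib sum.distrib if_distrib[of "\<lambda>c. scale c _"] cong: if_cong)
    also have "\<dots> = scale k z + y" using c assms(1) by simp
    finally show ?case by metis
  qed
  then obtain c where "y = (\<Sum>i\<in>A. scale (c i) (u i))" by blast
  then have "x - (\<Sum>i\<in>A. scale (c i) (u i)) = w" using y(3) by simp
  then show "\<exists>c. x - (\<Sum>i\<in>A. scale (c i) (u i)) \<in> W" using y(2) by blast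
next
  assume "\<exists>c. x - (\<Sum>i\<in>A. scale (c i) (u i)) \<in> W"
  then obtain c where c: "x - (\<Sum>i\<in>A. scale (c i) (u i)) \<in> W" by blast
  have "(\<Sum>i\<in>A. scale (c i) (u i)) \<in> S.span (u ` A \<union> W)" by (intro S.span_sum S.span_scale S.span_base) auto
  moreover have "x - (\<Sum>i\<in>A. scale (c i) (u i)) \<in> S.span (u ` A \<union> W)" using c by (intro S.span_base) simp
  ultimately have "(\<Sum>i\<in>A. scale (c i) (u i)) + (x - (\<Sum>i\<in>A. scale (c i) (u i))) \<in> S.span (u ` A \<union> W)"
    by (rule S.span_add)
  then show "x \<in> S.span (u ` A \<union> W)" by simp
qed

lemma Int_hpart_subspace: "idl.subspace J \<Longrightarrow> S.subspace (J \<inter> hpart z)"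
  by (intro S.subspace_inter ideal_S_subspace hpart_S_subspace)

lemma hbasis_card:
  fixes J :: "('n::finite, 'k::field) mpoly set"
  assumes J: "idl.subspace J" and A: "hbasis J n A u"
  shows "hilbert_function J n = card A"
  unfolding hilbert_function_def graded_part_eq
proof (rule quot_dim_eq[OF _ _ _ _ Int_hpart_subspace[OF J] _ hpart_span])
  show "finite A" "u ` A \<subseteq> hpart (int n)" "J \<inter> hpart (int n) \<subseteq> hpart (int n)"
    using A by (auto simp: hbasis_def)
  show "indep_mod (J \<inter> hpart (int n)) A u"
    using A by (subst indep_mod_Int_hpart) (auto simp: hbasis_def)
  show "hpart (int n) \<subseteq> S.span (u ` A \<union> (J \<inter> hpart (int n)))"
  proof
    fix f :: "('n, 'k) mpoly" assume f: "f \<in> hpart (int n)"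
    then obtain c where "f - (\<Sum>i\<in>A. scale (c i) (u i)) \<in> J" using A unfolding hbasis_def by blast
    moreover have "f - (\<Sum>i\<in>A. scale (c i) (u i)) \<in> hpart (int n)"
      using A by (intro hpart_diff f sum_scale_hpart) (simp add: hbasis_def)
    ultimately show "f \<in> S.span (u ` A \<union> (J \<inter> hpart (int n)))"
      using A by (subst span_Un_subspace[OF _ Int_hpart_subspace[OF J]]) (auto simp: hbasis_def)
  qed
  show "finite ((\<lambda>m. single m 1) ` {m. mdeg m \<le> nat (int n)})" by (intro finite_imageI finite_mdeg_le)
qed

lemma hbasis_exists:
  assumes J: "idl.subspace J"
  shows "\<exists>A. hbasis J n A (\<lambda>x. x)"
proof -
  have "\<exists>A\<subseteq>hpart (int n). finite A \<and> indep_mod (J \<inter> hpart (int n)) A (\<lambda>x. x) \<and>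
      hpart (int n) \<subseteq> S.span (A \<union> (J \<inter> hpart (int n)))"
    by (rule quot_basis_exists[OF Int_hpart_subspace[OF J] _ hpart_span]) (auto intro: finite_mdeg_le)
  then obtain A where A: "A \<subseteq> hpart (int n)" "finite A" "indep_mod (J \<inter> hpart (int n)) A (\<lambda>x. x)"
    "hpart (int n) \<subseteq> S.span (A \<union> (J \<inter> hpart (int n)))" by blast
  have "\<exists>c. f - (\<Sum>i\<in>A. scale (c i) i) \<in> J" if "f \<in> hpart (int n)" for f
  proof -
    have "f \<in> S.span ((\<lambda>x. x) ` A \<union> (J \<inter> hpart (int n)))" using A(4) that by auto
    then show ?thesis unfolding span_Un_subspace[OF A(2) Int_hpart_subspace[OF J]] by blast
  qed
  then have "hbasis J n A (\<lambda>x. x)"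
    using A indep_mod_Int_hpart[of "\<lambda>x. x" A "int n" J] by (auto simp: hbasis_def)
  then show ?thesis by blast
qed

lemma indep_mod_le_hilbert:
  assumes J: "idl.subspace J" and A: "finite A" "u ` A \<subseteq> hpart (int n)" "indep_mod J A u"
  shows "card A \<le> hilbert_function J n"
proof -
  obtain B where B: "hbasis J n B (\<lambda>x. x)" using hbasis_exists[OF J] by blast
  have "card A \<le> card B"
  proof (rule indep_mod_card_le[OF A(1) _ _ _ Int_hpart_subspace[OF J, of "int n"], where v = "\<lambda>x. x"])
    show "indep_mod (J \<inter> hpart (int n)) A u" using A by (simp add: indep_mod_Int_hpart)
    show "finite B" using B by (simp add: hbasis_def)
    show "u ` A \<subseteq> S.span ((\<lambda>x. x) ` B \<union> (J \<inter> hpart (int n)))"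
    proof
      fix f assume "f \<in> u ` A"
      then have f: "f \<in> hpart (int n)" using A by blast
      then obtain c where "f - (\<Sum>i\<in>B. scale (c i) i) \<in> J" using B unfolding hbasis_def by blast
      moreover have "f - (\<Sum>i\<in>B. scale (c i) i) \<in> hpart (int n)"
        using B sum_scale_hpart[of "\<lambda>x. x" B] by (intro hpart_diff f) (simp add: hbasis_def)
      ultimately show "f \<in> S.span ((\<lambda>x. x) ` B \<union> (J \<inter> hpart (int n)))"
        using B by (subst span_Un_subspace[OF _ Int_hpart_subspace[OF J]]) (auto simp: hbasis_def)
    qed
    show "J \<inter> hpart (int n) \<subseteq> S.span ((\<lambda>m. single m 1) ` {m. mdeg m \<le> nat (int n)})" using hpart_span by blast
  qed (intro finite_imageI finite_mdeg_le)
  then show ?thesis using hbasis_card[OF J B] by simp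
qed

lemma hilbert_zero:
  assumes "idl.subspace J" "hpart (int n) \<subseteq> J"
  shows "hilbert_function J n = 0"
  using hbasis_card[OF assms(1), of n "{} :: nat set" "\<lambda>_. 0"] assms(2)
  by (auto simp: hbasis_def indep_mod_def)

lemma scale_mult_left: "scale c f * g = scale c (f * g)"
  by (simp add: scale_def mult.assoc)

text \<open>Additivity on \<open>0 \<longrightarrow> (S/(I : f))(-d) \<longrightarrow> S/I \<longrightarrow> S/(I, f) \<longrightarrow> 0\<close>.\<close>

lemma hilbert_exact:
  fixes I :: "('n::finite, 'k::field) mpoly set"
  assumes I: "graded_ideal I" and f: "f \<in> hpart (int d)"
  shows "hilbert_function I (n + d) = hilbert_function (colon I f) n + hilbert_function (idl.span (insert f I)) (n + d)"
proof -
  have sub: "idl.subspace I" using I by (rule graded_ideal_subspace)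
  obtain A where A: "hbasis (colon I f) n A (\<lambda>x. x)" using hbasis_exists[OF colon_subspace[OF sub]] by blast
  obtain B where B: "hbasis (idl.span (insert f I)) (n + d) B (\<lambda>x. x)"
    using hbasis_exists[OF idl.subspace_span] by blast
  \<comment> \<open>A basis modulo \<open>colon I f\<close>, multiplied by \<open>f\<close>, is
    completed by a basis modulo \<open>(I, f)\<close>.\<close>
  define u where "u = case_sum (\<lambda>x. x * f) (\<lambda>x :: ('n, 'k) mpoly. x)"
  have fin: "finite A" "finite B" using A B by (auto simp: hbasis_def)
  have indA: "indep_mod (colon I f) A (\<lambda>x. x)" and indB: "indep_mod (idl.span (insert f I)) B (\<lambda>x. x)"
    using A B by (simp_all add: hbasis_def)
  have usum: "(\<Sum>i\<in>A <+> B. scale (c i) (u i)) = (\<Sum>x\<in>A. scale (c (Inl x)) x) * f + (\<Sum>x\<in>B. scale (c (Inr x)) x)" for c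
    using fin by (simp add: sum.Plus u_def sum_distrib_right scale_mult_left)
  have "hbasis I (n + d) (A <+> B) u"
    unfolding hbasis_def
  proof (intro conjI)
    show "finite (A <+> B)" using fin by simp
    show "u ` (A <+> B) \<subseteq> hpart (int (n + d))"
      using A B f by (auto simp: hbasis_def u_def intro!: hpart_mult_graded)
    show "indep_mod I (A <+> B) u"
      unfolding indep_mod_def
    proof (intro allI impI)
      fix c assume "(\<Sum>i\<in>A <+> B. scale (c i) (u i)) \<in> I"
      then have s: "(\<Sum>x\<in>A. scale (c (Inl x)) x) * f + (\<Sum>x\<in>B. scale (c (Inr x)) x) \<in> I" by (simp add: usum)
      have "(\<Sum>x\<in>B. scale (c (Inr x)) x) \<in> idl.span (insert f I)"
        unfolding span_insert_ideal[OF sub]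
        using s by (intro exI[of _ "- (\<Sum>x\<in>A. scale (c (Inl x)) x)"]) (simp add: add.commute)
      then have cB: "\<forall>x\<in>B. c (Inr x) = 0"
        by (rule mp[OF spec[OF indB[unfolded indep_mod_def], of "\<lambda>x. c (Inr x)"]])
      then have "(\<Sum>x\<in>A. scale (c (Inl x)) x) \<in> colon I f" using s by (simp add: colon_def)
      then have "\<forall>x\<in>A. c (Inl x) = 0"
        by (rule mp[OF spec[OF indA[unfolded indep_mod_def], of "\<lambda>x. c (Inl x)"]])
      then show "\<forall>i\<in>A <+> B. c i = 0" using cB by auto
    qed
    show "\<forall>g\<in>hpart (int (n + d)). \<exists>c. g - (\<Sum>i\<in>A <+> B. scale (c i) (u i)) \<in> I"
    proof
      fix g :: "('n, 'k) mpoly" assume g: "g \<in> hpart (int (n + d))"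
      then obtain b where b: "g - (\<Sum>x\<in>B. scale (b x) x) \<in> idl.span (insert f I)"
        using B unfolding hbasis_def by blast
      have gb: "g - (\<Sum>x\<in>B. scale (b x) x) \<in> hpart (int (n + d))"
        using B sum_scale_hpart[of "\<lambda>x. x" B] by (intro hpart_diff g) (simp add: hbasis_def)
      obtain q where qn: "q \<in> hpart (int n)" and q: "g - (\<Sum>x\<in>B. scale (b x) x) - q * f \<in> I"
        using span_insert_homogeneous[OF I f gb b] by auto
      from qn obtain a where "q - (\<Sum>x\<in>A. scale (a x) x) \<in> colon I f" using A unfolding hbasis_def by blast
      then have "(q - (\<Sum>x\<in>A. scale (a x) x)) * f \<in> I" by (simp add: colon_def)
      then have "(g - (\<Sum>x\<in>B. scale (b x) x) - q * f) + (q - (\<Sum>x\<in>A. scale (a x) x)) * f \<in> I"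
        using q idl.subspace_add[OF sub] by blast
      moreover have "(g - (\<Sum>x\<in>B. scale (b x) x) - q * f) + (q - (\<Sum>x\<in>A. scale (a x) x)) * f =
          g - (\<Sum>i\<in>A <+> B. scale (case_sum a b i) (u i))"
        by (simp add: usum algebra_simps)
      ultimately show "\<exists>c. g - (\<Sum>i\<in>A <+> B. scale (c i) (u i)) \<in> I" by metis
    qed
  qed
  then have "hilbert_function I (n + d) = card (A <+> B)" by (rule hbasis_card[OF sub])
  then show ?thesis
    using fin hbasis_card[OF colon_subspace[OF sub] A] hbasis_card[OF idl.subspace_span B] by (simp add: card_Plus)
qed

text \<open>In dimension 1 the factorial and the power of \<open>d\<close> are both 1, so the degree
  is the eventual value of the Hilbert function.\<close>

lemma quot_degree_eq:
  assumes "quot_krull_dim J = 1" "\<And>n. N \<le> n \<Longrightarrow> hilbert_function J n = c"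
  shows "quot_degree J = real c"
proof -
  have "(\<lambda>d. real (hilbert_function J d)) \<longlonglongrightarrow> real c"
    by (rule tendsto_eventually) (use assms(2) in \<open>auto simp: eventually_sequentially\<close>)
  then have "lim (\<lambda>d. real (hilbert_function J d)) = real c" by (rule limI)
  then show ?thesis by (simp add: quot_degree_def assms(1) one_enat_def Let_def)
qed

context geramita_ideal
begin

section \<open>The minimum distance function of a Geramita ideal\<close>

lemma form_power_outside:
  assumes "p \<in> Ass I"
  shows "\<exists>l\<in>hpart (int n). l \<notin> p"
proof -
  obtain l where l: "l \<in> hpart 1" "l \<notin> p" using linear_avoid[OF assms] by blast
  then show ?thesis
    using hpart_power[OF l(1), of n] prime_ideal_power[OF Ass_prime[OF assms], of l n] by auto
qed

lemma card_Ass_pos: "0 < card (Ass I)"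
  using finite_Ass Ass_nonempty by (simp add: card_gt_0_iff)

text \<open>\<open>h\<close> is a nonzerodivisor modulo \<open>colon I f\<close> too, and since this
  ideal contains \<open>I\<close>, its quotient modulo \<open>h\<close> vanishes in large degrees.
  Additivity for \<open>h\<close> leaves only the two values \<open>e\<close> apart.\<close>

lemma hilbert_colon_periodic:
  assumes f: "f \<in> hpart (int d)" and e: "card (Ass I) \<le> e"
  shows "\<exists>N. \<forall>n\<ge>N. hilbert_function (colon I f) (n + e) = hilbert_function (colon I f) n"
proof -
  obtain h where h: "h \<in> hpart (int e)" "\<And>p. p \<in> Ass I \<Longrightarrow> h \<notin> p" using form_avoiding_Ass[OF e] by blast
  have "0 < e" using e card_Ass_pos by simp
  then obtain N where N: "\<And>j. int N \<le> j \<Longrightarrow> hpart j \<subseteq> idl.span (insert h I)"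
    using artinian_mod_form[OF h] by blast
  let ?J = "colon I f"
  have "colon ?J h = ?J"
  proof
    show "colon ?J h \<subseteq> ?J"
    proof
      fix g assume "g \<in> colon ?J h"
      then have "h * (g * f) \<in> I" by (simp add: colon_def mult_ac)
      then show "g \<in> ?J" using nonzerodivisor[OF h] by (simp add: colon_def)
    qed
  qed (rule subset_colon[OF colon_subspace[OF subspace]])
  moreover have "hilbert_function (idl.span (insert h ?J)) (n + e) = 0" if "N \<le> n" for n
  proof (rule hilbert_zero)
    have "idl.span (insert h I) \<subseteq> idl.span (insert h ?J)"
      using subset_colon[OF subspace, of f] by (intro idl.span_mono) auto
    then show "hpart (int (n + e)) \<subseteq> idl.span (insert h ?J)" using N[of "int (n + e)"] that by auto
  qed simp
  ultimately show ?thesis using hilbert_exact[OF colon_graded[OF graded f] h(1)] by auto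
qed

text \<open>Both \<open>card (Ass I)\<close> and its successor are eventual periods, so consecutive
  values agree. A linear form outside the primes would give period 1 at once, but need not
  exist.\<close>

lemma hilbert_colon_constant:
  assumes f: "f \<in> hpart (int d)"
  shows "\<exists>c N. \<forall>n\<ge>N. hilbert_function (colon I f) n = c"
proof -
  let ?H = "hilbert_function (colon I f)" and ?e = "card (Ass I)"
  obtain N1 where N1: "\<And>n. N1 \<le> n \<Longrightarrow> ?H (n + ?e) = ?H n" using hilbert_colon_periodic[OF f, of ?e] by auto
  obtain N2 where N2: "\<And>n. N2 \<le> n \<Longrightarrow> ?H (n + Suc ?e) = ?H n" using hilbert_colon_periodic[OF f, of "Suc ?e"] by auto
  define N where "N = max N1 N2"
  have "?H (Suc n) = ?H n" if "N \<le> n" for n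
    using N1[of "Suc n"] N2[of n] that by (simp add: N_def)
  note step = this
  have "?H n = ?H N" if "N \<le> n" for n
    using that by (induction n rule: dec_induct) (auto simp: step)
  then show ?thesis by blast
qed

section \<open>Degrees of the quotients by colon ideals\<close>

definition colon_degree :: "('n, 'k) mpoly \<Rightarrow> nat" where
  "colon_degree f = (SOME c. \<exists>N. \<forall>n\<ge>N. hilbert_function (colon I f) n = c)"

lemma colon_degree:
  assumes "f \<in> hpart (int d)"
  shows "\<exists>N. \<forall>n\<ge>N. hilbert_function (colon I f) n = colon_degree f"
  unfolding colon_degree_def using someI_ex[OF hilbert_colon_constant[OF assms]] .

lemma colon_degree_pos:
  assumes f: "f \<in> hpart (int d)" "f \<notin> I"
  shows "1 \<le> colon_degree f"
proof -
  obtain N where N: "\<And>n. N \<le> n \<Longrightarrow> hilbert_function (colon I f) n = colon_degree f"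
    using colon_degree[OF f(1)] by blast
  obtain g where g: "colon I (g * f) \<in> Ass I" using Ass_above[OF graded f] by blast
  obtain l where l: "l \<in> hpart (int N)" "l \<notin> colon I (g * f)" using form_power_outside[OF g] by blast
  have "l \<notin> colon I f" using l colon_mono_mult[OF subspace] by blast
  moreover have "S.subspace (colon I f)" by (intro ideal_S_subspace colon_subspace subspace)
  ultimately have "indep_mod (colon I f) {0 :: nat} (\<lambda>_. l)" using scale_in_subspaceD by (auto simp: indep_mod_def)
  then have "card {0 :: nat} \<le> hilbert_function (colon I f) N"
    using l by (intro indep_mod_le_hilbert colon_subspace subspace) auto
  then show ?thesis using N by simp
qed

text \<open>For the ideal of a line, evaluation identifies each graded piece of the quotient with
  \<open>K\<close>. Conversely, let an associated prime contain \<open>colon I f\<close> strictly: a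
  form in the difference has multiples outside \<open>colon I f\<close> in all higher degrees, and
  together with a form outside the prime this gives two independent classes.\<close>

lemma colon_degree_eq_1_iff:
  assumes f: "f \<in> hpart (int d)" "f \<notin> I"
  shows "colon_degree f = 1 \<longleftrightarrow> colon I f \<in> Ass I"
proof
  obtain N where N: "\<And>n. N \<le> n \<Longrightarrow> hilbert_function (colon I f) n = colon_degree f"
    using colon_degree[OF f(1)] by blast
  assume J: "colon I f \<in> Ass I"
  obtain a i where a: "a i \<noteq> 0" "colon I f = line_ideal a" using Ass_line[OF J] by blast
  obtain l where l: "l \<in> hpart (int N)" "l \<notin> colon I f" using form_power_outside[OF J] by blast
  have la: "eva a l \<noteq> 0" using l line_ideal_hpart[OF l(1)] a by simp
  have sc: "scale c l \<in> hpart (int N)" for c using S.subspace_scale[OF hpart_S_subspace l(1)] .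
  have "hbasis (colon I f) N {0 :: nat} (\<lambda>_. l)"
    unfolding hbasis_def
  proof (intro conjI ballI)
    show "indep_mod (colon I f) {0 :: nat} (\<lambda>_. l)"
      using line_ideal_hpart[OF sc, where a = a] la by (auto simp: indep_mod_def a eva_scale)
    fix g :: "('n, 'k) mpoly" assume g: "g \<in> hpart (int N)"
    have "g - scale (eva a g / eva a l) l \<in> line_ideal a"
      using line_ideal_hpart[OF hpart_diff[OF g sc], where a = a] la by (simp add: eva_diff eva_scale)
    then show "\<exists>c. g - (\<Sum>i\<in>{0 :: nat}. scale (c i) l) \<in> colon I f"
      by (intro exI[of _ "\<lambda>_. eva a g / eva a l"]) (simp add: a)
  qed (use l in auto)
  from hbasis_card[OF colon_subspace[OF subspace] this] show "colon_degree f = 1" using N by simp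
next
  obtain N where N: "\<And>n. N \<le> n \<Longrightarrow> hilbert_function (colon I f) n = colon_degree f"
    using colon_degree[OF f(1)] by blast
  assume deg: "colon_degree f = 1"
  obtain g z where g: "g \<in> hpart z" "colon I (g * f) \<in> Ass I" using Ass_above[OF graded f] by blast
  have le: "colon I f \<subseteq> colon I (g * f)" by (rule colon_mono_mult[OF subspace])
  have "colon I f = colon I (g * f)"
  proof (rule ccontr)
    assume "colon I f \<noteq> colon I (g * f)"
    then obtain y where "y \<in> colon I (g * f)" "y \<notin> colon I f" using le by blast
    then obtain m x where x: "x \<in> hpart (int m)" "x \<in> colon I (g * f)" "x \<notin> colon I f"
      using graded_ideal_exists[OF colon_graded[OF graded f(1)] _ _ colon_graded[OF graded hpart_mult[OF g(1) f(1)]]]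
      by blast
    have "x * f \<notin> I" using x by (simp add: colon_def)
    then obtain w where w: "w \<in> hpart (int N)" "w * (x * f) \<notin> I" using multiple_not_in by blast
    obtain l where l: "l \<in> hpart (int (N + m))" "l \<notin> colon I (g * f)" using form_power_outside[OF g(2)] by blast
    have sp: "S.subspace (colon I (g * f))" "S.subspace (colon I f)"
      by (intro ideal_S_subspace colon_subspace subspace)+
    have wx: "w * x \<in> colon I (g * f)" using x(2) idl.subspace_scale[OF colon_subspace[OF subspace]] by blast
    have wx': "w * x \<notin> colon I f" using w(2) by (simp add: colon_def mult.assoc)
    define u where "u b = (if b then w * x else l)" for b
    have "indep_mod (colon I f) UNIV u"
      unfolding indep_mod_def
    proof (intro allI impI)
      fix c assume "(\<Sum>b\<in>UNIV. scale (c b) (u b)) \<in> colon I f"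
      then have s: "scale (c True) (w * x) + scale (c False) l \<in> colon I f" by (simp add: UNIV_bool u_def add.commute)
      have "scale (c True) (w * x) + scale (c False) l - scale (c True) (w * x) \<in> colon I (g * f)"
        using s le wx by (intro S.subspace_diff[OF sp(1)] S.subspace_scale[OF sp(1)]) auto
      then have cl: "scale (c False) l \<in> colon I (g * f)" by simp
      have cF: "c False = 0" by (rule scale_in_subspaceD[OF sp(1) cl l(2)])
      then have cw: "scale (c True) (w * x) \<in> colon I f" using s by simp
      have "c True = 0" by (rule scale_in_subspaceD[OF sp(2) cw wx'])
      then show "\<forall>b\<in>UNIV. c b = 0" using cF by (auto simp: UNIV_bool)
    qed
    moreover have "u ` UNIV \<subseteq> hpart (int (N + m))"
      using l hpart_mult[OF w(1) x(1)] by (auto simp: u_def)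
    ultimately have "card (UNIV :: bool set) \<le> hilbert_function (colon I f) (N + m)"
      by (intro indep_mod_le_hilbert colon_subspace subspace) auto
    then show False using N[of "N + m"] deg by simp
  qed
  then show "colon I f \<in> Ass I" using g by simp
qed

lemma colon_one: "colon I 1 = I"
  by (simp add: colon_def)

lemma quot_degree_I: "quot_degree I = real (colon_degree 1)"
  using colon_degree[of 1 0] quot_degree_eq[OF dim_1] by (auto simp: colon_one)

lemma zero_div_forms_Ass:
  assumes "f \<in> zero_div_forms I d"
  shows "\<exists>p\<in>Ass I. f \<in> p"
proof -
  have f: "f \<in> hpart (int d)" "colon I f \<noteq> I" using assms by (auto simp: zero_div_forms_def graded_part_eq)
  then obtain y where "y \<in> colon I f" "y \<notin> I" using subset_colon[OF subspace, of f] by blast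
  then obtain m g where g: "g \<in> hpart (int m)" "g \<in> colon I f" "g \<notin> I"
    using graded_ideal_exists[OF graded _ _ colon_graded[OF graded f(1)]] by blast
  obtain u where u: "colon I (u * g) \<in> Ass I" using Ass_above[OF graded g(1,3)] by blast
  have "u * (g * f) \<in> I" using g(2) idl.subspace_scale[OF subspace] by (simp add: colon_def)
  then have "f \<in> colon I (u * g)" by (simp add: colon_def mult_ac)
  then show ?thesis using u by blast
qed

text \<open>A zero divisor lies in some associated prime \<open>p\<close>, so \<open>p\<close> still
  contains \<open>(I, f)\<close> and the dimension stays 1. Hence \<open>quot_degree\<close> is
  again an eventual Hilbert value and \<open>hilbert_exact\<close> applies.\<close>

lemma quot_degree_insert:
  assumes f: "f \<in> zero_div_forms I d"
  shows "quot_degree (idl.span (insert f I)) = quot_degree I - real (colon_degree f)"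
    and "real (colon_degree f) \<le> quot_degree I"
proof -
  let ?J = "idl.span (insert f I)"
  have fd: "f \<in> hpart (int d)" using f by (simp add: zero_div_forms_def graded_part_eq)
  have IJ: "I \<subseteq> ?J" by (auto intro: idl.span_base)
  obtain p where p: "p \<in> Ass I" "f \<in> p" using zero_div_forms_Ass[OF f] by blast
  have sub_p: "idl.subspace p" using p Ass_prime prime_ideal_subspace by blast
  have Jp: "?J \<subseteq> p" using p Ass_superset[OF subspace p(1)] by (intro idl.span_minimal sub_p) auto
  have "prime_chain 1 (\<lambda>i. if i = 0 then p else irrelevant)"
    using Ass_prime[OF p(1)] irrelevant_prime Ass_irrelevant[OF p(1)] irrelevant_not_Ass p(1)
    by (auto simp: prime_chain_def le_Suc_eq)
  then have "enat 1 \<le> quot_krull_dim ?J"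
    unfolding quot_krull_dim_def using Jp
    by (intro Sup_upper CollectI exI[of _ 1] exI[of _ "\<lambda>i. if i = 0 then p else irrelevant"]) auto
  moreover have "quot_krull_dim ?J \<le> quot_krull_dim I"
    unfolding quot_krull_dim_def using IJ by (intro Sup_subset_mono) blast
  ultimately have dim: "quot_krull_dim ?J = 1" using dim_1 by (simp add: one_enat_def)
  obtain N1 where N1: "\<And>n. N1 \<le> n \<Longrightarrow> hilbert_function (colon I f) n = colon_degree f"
    using colon_degree[OF fd] by blast
  obtain N2 where N2: "\<And>n. N2 \<le> n \<Longrightarrow> hilbert_function I n = colon_degree 1"
    using colon_degree[of 1 0] by (auto simp: colon_one)
  have H: "colon_degree 1 = colon_degree f + hilbert_function ?J n" if "N1 + N2 + d \<le> n" for n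
    using hilbert_exact[OF graded fd, of "n - d"] N1[of "n - d"] N2[of n] that by simp
  have "quot_degree ?J = real (colon_degree 1 - colon_degree f)"
    by (rule quot_degree_eq[OF dim, of "N1 + N2 + d"]) (use H in fastforce)
  moreover have "colon_degree f \<le> colon_degree 1" using H[of "N1 + N2 + d"] by simp
  ultimately show "quot_degree ?J = quot_degree I - real (colon_degree f)" "real (colon_degree f) \<le> quot_degree I"
    by (simp_all add: quot_degree_I of_nat_diff)
qed

lemma Ass_not_containing: "colon I f \<in> Ass I \<Longrightarrow> f \<notin> I"
  using colon_eq_UNIV_iff[OF subspace, of f] by (auto simp: Ass_def prime_ideal_def)

text \<open>Maximising the degree of \<open>S/(I, f)\<close> means minimising
  \<open>colon_degree f\<close>, which is at least 1 and equals 1 exactly at associated primes.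
  Without zero divisors in degree \<open>d\<close> the value is \<open>colon_degree 1\<close>,
  different from 1 as \<open>I\<close> is not prime.\<close>

lemma min_dist_eq_1_iff:
  assumes np: "\<not> prime_ideal I"
  shows "min_dist I d = 1 \<longleftrightarrow> (\<exists>f\<in>hpart (int d). colon I f \<in> Ass I)"
proof (cases "zero_div_forms I d = {}")
  case True
  have "colon_degree 1 \<noteq> 1"
    using colon_degree_eq_1_iff[of 1 0] np subspace_eq_UNIV[OF subspace] proper
    by (auto simp: colon_one dest: Ass_prime)
  moreover have "\<not> (\<exists>f\<in>hpart (int d). colon I f \<in> Ass I)"
    using True np Ass_not_containing Ass_prime unfolding zero_div_forms_def graded_part_eq by fastforce
  ultimately show ?thesis using True by (simp add: min_dist_def quot_degree_I)
next
  case False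
  define Q where "Q = {quot_degree (idl.span (insert f I)) | f. f \<in> zero_div_forms I d}"
  have Q: "Q = (\<lambda>f. quot_degree I - real (colon_degree f)) ` zero_div_forms I d"
    unfolding Q_def Setcompr_eq_image by (rule image_cong[OF refl quot_degree_insert(1)])
  \<comment> \<open>There may be infinitely many forms, but only finitely many degrees occur, so
    \<open>Max\<close> is meaningful.\<close>
  have "Q \<subseteq> (\<lambda>c. quot_degree I - real c) ` {..colon_degree 1}"
    using quot_degree_insert(2) by (auto simp: Q quot_degree_I)
  then have fin: "finite Q" by (rule finite_subset) simp
  have ne: "Q \<noteq> {}" using False by (simp add: Q)
  have zf: "f \<in> hpart (int d) \<and> f \<notin> I" if "f \<in> zero_div_forms I d" for f
    using that by (simp add: zero_div_forms_def graded_part_eq)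
  have min_dist: "min_dist I d = quot_degree I - Max Q" using False by (simp add: min_dist_def Q_def)
  show ?thesis
  proof
    assume "min_dist I d = 1"
    moreover have "Max Q \<in> Q" using fin ne by (rule Max_in)
    ultimately obtain f where f: "f \<in> zero_div_forms I d" "colon_degree f = 1" by (auto simp: min_dist Q)
    then show "\<exists>f\<in>hpart (int d). colon I f \<in> Ass I" using zf colon_degree_eq_1_iff by blast
  next
    assume "\<exists>f\<in>hpart (int d). colon I f \<in> Ass I"
    then obtain f where f: "f \<in> hpart (int d)" "colon I f \<in> Ass I" by blast
    have fI: "f \<notin> I" using Ass_not_containing[OF f(2)] .
    have "colon I f \<noteq> I" using Ass_prime[OF f(2)] np by auto
    then have fz: "f \<in> zero_div_forms I d"
      using f(1) fI by (simp add: zero_div_forms_def graded_part_eq)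
    have "Max Q = quot_degree I - 1"
    proof (rule Max_eqI[OF fin])
      show "quot_degree I - 1 \<in> Q" using fz colon_degree_eq_1_iff[OF f(1) fI] f(2) by (force simp: Q)
      fix y assume "y \<in> Q"
      then obtain g where "g \<in> zero_div_forms I d" "y = quot_degree I - real (colon_degree g)" by (auto simp: Q)
      then show "y \<le> quot_degree I - 1" using colon_degree_pos zf by fastforce
    qed
    then show "min_dist I d = 1" by (simp add: min_dist)
  qed
qed

section \<open>The v-number\<close>

text \<open>The available witness might have degree 0, while v-numbers start at 1; multiplying it by
  a linear form outside \<open>p\<close> leaves the colon ideal unchanged.\<close>

lemma v_at_exists:
  assumes p: "p \<in> Ass I"
  shows "\<exists>d\<ge>1. \<exists>f\<in>graded_part d. colon I f = p"
proof -
  obtain d f where f: "f \<in> hpart (int d)" "p = colon I f" using Ass_homogeneous[OF p] by blast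
  obtain l where l: "l \<in> hpart 1" "l \<notin> p" using linear_avoid[OF p] by blast
  have "colon I (l * f) = p" using colon_prime[OF Ass_prime[OF p] l(2)] f by (simp add: colon_colon)
  moreover have "l * f \<in> graded_part (Suc d)"
    unfolding graded_part_eq by (rule hpart_mult_graded[OF l(1) f(1)]) simp
  ultimately show ?thesis by (intro exI[of _ "Suc d"]) auto
qed

lemma v_at:
  assumes p: "p \<in> Ass I"
  shows "1 \<le> v_at p I" "\<exists>f\<in>graded_part (v_at p I). colon I f = p"
  using LeastI_ex[OF v_at_exists[OF p]] unfolding v_at_def by blast+

lemma v_at_le: "1 \<le> d \<Longrightarrow> f \<in> graded_part d \<Longrightarrow> colon I f = p \<Longrightarrow> v_at p I \<le> d"
  unfolding v_at_def by (rule Least_le) blast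

lemma v_values: "finite {v_at p I | p. p \<in> Ass I}" "{v_at p I | p. p \<in> Ass I} \<noteq> {}"
  using finite_Ass Ass_nonempty by (auto simp: Setcompr_eq_image)

lemma v_number_le: "p \<in> Ass I \<Longrightarrow> v_number I \<le> v_at p I"
  unfolding v_number_def by (rule Min_le[OF v_values(1)]) blast

lemma v_number_in: "\<exists>p\<in>Ass I. v_number I = v_at p I"
  using Min_in[OF v_values] unfolding v_number_def by blast

lemma Ass_of_prime:
  assumes "prime_ideal I"
  shows "Ass I = {I}"
proof -
  have "I \<in> Ass I" using assms colon_one by (auto simp: Ass_def)
  moreover have "p = I" if "p \<in> Ass I" for p
    using that Ass_incomparable[OF calculation that Ass_superset[OF subspace that]] by simp
  ultimately show ?thesis by blast
qed

text \<open>Any linear form outside \<open>I\<close> has colon ideal \<open>I\<close>, so the value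
  agrees with the convention for primes in \<open>reg_min_dist\<close>.\<close>

lemma v_number_prime:
  assumes "prime_ideal I"
  shows "v_number I = 1"
proof -
  have I: "I \<in> Ass I" using Ass_of_prime[OF assms] by simp
  obtain l where l: "l \<in> hpart 1" "l \<notin> I" using linear_avoid[OF I] by blast
  have "v_at I I \<le> 1"
    using l colon_prime[OF assms l(2)] by (intro v_at_le[of 1 l]) (auto simp: graded_part_eq)
  then have "v_at I I = 1" using v_at(1)[OF I] by simp
  then show ?thesis using v_number_in Ass_of_prime[OF assms] by simp
qed

theorem reg_min_dist_eq_v_number: "reg_min_dist I = v_number I"
proof (cases "prime_ideal I")
  case True
  then show ?thesis by (simp add: reg_min_dist_def v_number_prime)
next
  case False
  have "(LEAST d. d \<ge> 1 \<and> min_dist I d = 1) = v_number I"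
  proof (rule Least_equality)
    obtain p where p: "p \<in> Ass I" "v_number I = v_at p I" using v_number_in by blast
    then show "1 \<le> v_number I \<and> min_dist I (v_number I) = 1"
      using v_at[OF p(1)] by (auto simp: min_dist_eq_1_iff[OF False] graded_part_eq)
    fix d assume "1 \<le> d \<and> min_dist I d = 1"
    then obtain f where f: "1 \<le> d" "f \<in> graded_part d" "colon I f \<in> Ass I"
      by (auto simp: min_dist_eq_1_iff[OF False] graded_part_eq)
    then show "v_number I \<le> d" using v_number_le[OF f(3)] v_at_le[OF f(1,2) refl] by simp
  qed
  then show ?thesis using False by (simp add: reg_min_dist_def)
qed

theorem v_at_le_cm_reg:
  assumes p: "p \<in> Ass I" and np: "\<not> prime_ideal I"
  shows "int (v_at p I) \<le> cm_reg I"
proof -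
  define e where "e = card (Ass I)"
  have e: "0 < e" using card_Ass_pos by (simp add: e_def)
  obtain h where h: "h \<in> hpart (int e)" "\<And>p. p \<in> Ass I \<Longrightarrow> h \<notin> p"
    using form_avoiding_Ass[of e] by (auto simp: e_def)
  let ?J = "idl.span (insert h I)"
  obtain N where N: "\<And>j. int N \<le> j \<Longrightarrow> hpart j \<subseteq> ?J" using artinian_mod_form[OF h e] by blast
  define T where "T = {n. \<not> hpart (int n) \<subseteq> ?J}"
  have "T \<subseteq> {..<N}"
  proof
    fix n assume "n \<in> T"
    then show "n \<in> {..<N}" using N[of "int n"] by (cases "n < N") (auto simp: T_def)
  qed
  then have finT: "finite T" by (rule finite_subset) simp
  \<comment> \<open>Degree 0 survives modulo \<open>(I, h)\<close>, so the set \<open>T\<close> is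
    nonempty and has a greatest element.\<close>
  have "?J \<subseteq> irrelevant"
    using graded_proper_irrelevant[OF graded proper] hpart_irrelevant[OF h(1)] e
    by (intro idl.span_minimal irrelevant_subspace) auto
  then have "1 \<notin> ?J" by (auto simp: irrelevant_def)
  moreover have "1 \<in> hpart (int 0)" by simp
  ultimately have "0 \<in> T" unfolding T_def by blast
  define t where "t = Max T"
  have tT: "t \<in> T" using finT \<open>0 \<in> T\<close> unfolding t_def by (intro Max_in) auto
  have above: "hpart j \<subseteq> ?J" if "int t < j" for j
  proof -
    have j: "j = int (nat j)" using that by simp
    have "t < nat j" using that by simp
    then have "nat j \<notin> T" using Max_ge[OF finT, of "nat j"] by (auto simp: t_def)
    then show ?thesis using j by (simp add: T_def)
  qed
  have reg: "cm_reg I = int t - int e + 1"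
    by (rule cm_reg_eq[OF graded proper h(1) _ nonzerodivisor[OF h] above])
      (use e tT in \<open>auto simp: T_def\<close>)
  \<comment> \<open>Only an inclusion is required: the cofactor \<open>u\<close> below inherits this
    form of the condition, and \<open>colon_eq_Ass\<close> upgrades it to equality.\<close>
  define P where "P d \<longleftrightarrow> (\<exists>f\<in>hpart (int d). f \<notin> I \<and> p \<subseteq> colon I f)" for d
  have "\<exists>d. P d"
  proof -
    obtain d f where "f \<in> hpart (int d)" "p = colon I f" using Ass_homogeneous[OF p] by blast
    then show ?thesis using Ass_not_containing p by (auto simp: P_def)
  qed
  define d where "d = (LEAST d. P d)"
  have "P d" unfolding d_def using \<open>\<exists>d. P d\<close> by (rule LeastI_ex)
  then obtain f where f: "f \<in> hpart (int d)" "f \<notin> I" "p \<subseteq> colon I f" by (auto simp: P_def)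
  have min: "u \<in> I" if "u \<in> hpart (int d')" "d' < d" "p \<subseteq> colon I u" for d' u
  proof -
    have "\<not> P d'" using that(2) unfolding d_def by (rule not_less_Least)
    then show ?thesis using that(1,3) by (auto simp: P_def)
  qed
  have cf: "colon I f = p" using colon_eq_Ass[OF p f] .
  \<comment> \<open>In degree 0 the witness would be a nonzero constant, giving
    \<open>p = I\<close>; this is where primality of \<open>I\<close> has to be excluded.\<close>
  have d1: "1 \<le> d"
  proof (rule ccontr)
    assume "\<not> 1 \<le> d"
    then have "d = 0" by simp
    then have f0: "f = single 0 (lookup f 0)" using f(1) hpart_0_eq by simp
    have "p \<subseteq> I"
    proof
      fix x assume "x \<in> p"
      then have "x * f \<in> I" using f(3) by (auto simp: colon_def)
      then have "single 0 (inverse (lookup f 0)) * (x * f) \<in> I" using idl.subspace_scale[OF subspace] by blast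
      moreover have "lookup f 0 \<noteq> 0" using f0 f(2) idl.subspace_0[OF subspace] by auto
      then have "single 0 (inverse (lookup f 0)) * f = 1" by (subst f0) (simp add: mult_single)
      then have "single 0 (inverse (lookup f 0)) * (x * f) = x" by (metis mult.left_commute mult.right_neutral)
      ultimately show "x \<in> I" by simp
    qed
    then have "p = I" using Ass_superset[OF subspace p] by blast
    then show False using np Ass_prime[OF p] by simp
  qed
  have "\<exists>g\<in>hpart (int (e - 1)). g * f \<notin> ?J"
  proof (rule ccontr)
    assume neg: "\<not> ?thesis"
    obtain g where g: "g \<in> hpart (int (e - 1))" "g * f \<notin> I" using multiple_not_in[OF f(2)] by blast
    have "g * f \<in> ?J" using neg g by blast
    \<comment> \<open>Since \<open>(e - 1) + d = (d - 1) + e\<close>, the cofactor of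
      \<open>h\<close> has degree \<open>d - 1\<close>, just below the least degree in
      \<open>P\<close>.\<close>
    have gf: "g * f \<in> hpart (int (d - 1) + int e)"
      by (rule hpart_mult_graded[OF g(1) f(1)]) (use d1 e in simp)
    obtain u where uh: "u \<in> hpart (int (d - 1))" and "g * f - u * h \<in> I"
      using span_insert_homogeneous[OF graded h(1) gf \<open>g * f \<in> ?J\<close>] by auto
    then have u: "g * f - h * u \<in> I" by (simp add: mult.commute)
    \<comment> \<open>An element of \<open>p\<close> kills \<open>g * f\<close> modulo
      \<open>I\<close>, hence also \<open>h * u\<close>, and \<open>h\<close> cancels.\<close>
    have "p \<subseteq> colon I u"
    proof
      fix x assume "x \<in> p"
      then have "x * f \<in> I" using f(3) by (auto simp: colon_def)
      then have "g * (x * f) \<in> I" using idl.subspace_scale[OF subspace] by blast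
      moreover have "x * (g * f - h * u) \<in> I" using u idl.subspace_scale[OF subspace] by blast
      ultimately have "g * (x * f) - x * (g * f - h * u) \<in> I" by (rule idl.subspace_diff[OF subspace])
      then have "h * (x * u) \<in> I" by (simp add: algebra_simps)
      then show "x \<in> colon I u" using nonzerodivisor[OF h] by (simp add: colon_def)
    qed
    then have "u \<in> I" using d1 by (intro min[OF uh]) auto
    then have "(g * f - h * u) + h * u \<in> I"
      using u idl.subspace_add[OF subspace] idl.subspace_scale[OF subspace] by blast
    then show False using g by simp
  qed
  then obtain g where g: "g \<in> hpart (int (e - 1))" "g * f \<notin> ?J" by blast
  have "g * f \<in> hpart (int (e - 1) + int d)" using g f by (intro hpart_mult)
  then have "int (e - 1) + int d \<le> int t" using above g by (metis linorder_not_less subsetD)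
  then have "int d \<le> cm_reg I" using reg e by simp
  moreover have "v_at p I \<le> d" using d1 f(1) cf by (intro v_at_le[of d f]) (auto simp: graded_part_eq)
  ultimately show ?thesis by simp
qed

end

theorem corollary4p15:
  fixes I :: "('n::finite, 'k::field) mpoly set"
  assumes "geramita I" and "I \<noteq> {0}"
  shows "cayley_bacharach I \<longleftrightarrow>
    reg_min_dist I = v_number I \<and> int (v_number I) = cm_reg I"
proof -
  interpret geramita_ideal I by unfold_locales (rule assms(1))
  show ?thesis
  proof
    assume "cayley_bacharach I"
    then have "\<forall>p\<in>Ass I. int (v_at p I) = cm_reg I" by (simp add: cayley_bacharach_def)
    then show "reg_min_dist I = v_number I \<and> int (v_number I) = cm_reg I"
      using v_number_in reg_min_dist_eq_v_number by auto
  next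
    assume "reg_min_dist I = v_number I \<and> int (v_number I) = cm_reg I"
    then have v: "int (v_number I) = cm_reg I" by simp
    have "int (v_at p I) = cm_reg I" if p: "p \<in> Ass I" for p
    proof (cases "prime_ideal I")
      case True
      then show ?thesis using v v_number_in Ass_of_prime p by auto
    next
      case False
      \<comment> \<open>\<open>v_at p I\<close> is squeezed between \<open>v_number I\<close> and
        \<open>cm_reg I\<close>, which agree.\<close>
      then show ?thesis using v v_number_le[OF p] v_at_le_cm_reg[OF p] by simp
    qed
    then show "cayley_bacharach I" using assms(1) by (simp add: cayley_bacharach_def)
  qed
qed


end
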